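(* Let $A$ be an Artinian local $K$-algebra of embedding dimension $h\ge 1$ with maximal ideal $\mathfrak m$, and let $n=HF_A(2)=\dim_K \mathfrak m^2/\mathfrak m^3$, with $n\ge 1$. Then $A$ is Gorenstein of socle degree three if and only if $n\le h$ and there exists a non-degenerate cubic form $F_3\in S_n$ such that $A\cong R/I$, where $$ I=\begin{cases} \mathrm{Ann}_{R_n}(F_3)R+\bigl(x_ix_j,\ x_j^2-2\sigma(x_1,\dots,x_n)\bigr)_{1\le i<j,\ n+1\le j\le h} & \text{if } n<h,\\[4pt] \mathrm{Ann}_{R}(F_3) & \text{if } n=h, \end{cases} $$ $\sigma\in R_n$ being any form of degree $3$ such that $\sigma\circ F_3=1$.
   Context: $K$ is an algebraically closed field of characteristic $0$. All $K$-algebras are commutative, Noetherian and local; Artinian local $K$-algebras are assumed to be finite-dimensional over $K$ (equivalently, with residue field $K$), so that they are quotients of power series rings over $K$. For an Artinian local $K$-algebra $A$ with maximal ideal $\mathfrak m$, the Hilbert function is $HF_A(i)=\dim_K \mathfrak m^i/\mathfrak m^{i+1}$, the embedding dimension is $HF_A(1)$, and the socle degree is the integer $s$ with $\mathfrak m^s\ne 0$, $\mathfrak m^{s+1}=0$. For a positive integer $j\le h$ let $R_j=K[[x_1,\dots,x_j]]$ and $S_j=K[y_1,\dots,y_j]$; put $R=R_h$, $S=S_h$. $R_j$ acts on $S_j$ by differentiation: $f\circ g=f(\partial_{y_1},\dots,\partial_{y_j})(g)$, and for $F\in S_j$, $\mathrm{Ann}_{R_j}(F)=\{g\in R_j : g\circ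 F=0\}$. A form $F\in S_n$ of degree $d$ is non-degenerate if the $K$-vector space spanned by its partial derivatives of order $d-1$ has the maximal dimension, namely $n$. A form of degree $3$ in $R_n$ means a homogeneous polynomial of degree $3$ in $x_1,\dots,x_n$. *)

theory Defs
  imports
    "HOL-Algebra.Algebraic_Closure_Type"
    "HOL-Algebra.Ideal_Product"
    "HOL-Algebra.QuotRing"
    "HOL-Library.Poly_Mapping"
    "Jordan_Normal_Form.Missing_VectorSpace"
begin

text \<open>
  The ground field is a type \<open>'k\<close>; algebras, ideals, quotients and vector spaces over it are
  objects with carriers in the sense of HOL-Algebra, for which \<open>'k\<close> is turned into the ring
  record \<open>ground\<close>. Throughout, dimensions are \<open>vectorspace.dim\<close>.
\<close>

abbreviation ground :: "'k::field ring" where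
  "ground \<equiv> ring_of_type_algebra"


section \<open>Artinian local algebras\<close>

text \<open>
  Finite-dimensionality over the ground field makes the algebra Artinian and Noetherian.
\<close>

definition artinian_local_algebra :: "('k::field, 'a, 'c) module_scheme \<Rightarrow> 'a set \<Rightarrow> bool" where
  "artinian_local_algebra A m \<longleftrightarrow>
     algebra ground A \<and> vectorspace.fin_dim ground A \<and>
     maximalideal m A \<and> (\<forall>J. maximalideal J A \<longrightarrow> J = m)"

primrec ideal_power :: "('a, 'b) ring_scheme \<Rightarrow> 'a set \<Rightarrow> nat \<Rightarrow> 'a set" where
  "ideal_power A I 0 = carrier A"
| "ideal_power A I (Suc i) = ideal_prod A I (ideal_power A I i)"

text \<open>
  The scalar multiplication on \<open>A / I\<close> sends \<open>(c, I + x)\<close> to \<open>I + c x\<close>. It is written as a union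
  of cosets so that no representative has to be chosen; for an ideal \<open>I\<close> all of them coincide.
\<close>

definition quotient_algebra ::
  "('k, 'a, 'c) module_scheme \<Rightarrow> 'a set \<Rightarrow> ('k, 'a set) module" where
  "quotient_algebra A I =
     ring.extend (A Quot I) (module.fields (\<lambda>c Y. \<Union>x\<in>Y. I +>\<^bsub>A\<^esub> (c \<odot>\<^bsub>A\<^esub> x)))"

text \<open>The space \<open>V / W\<close>, for an ideal \<open>W\<close> and a subspace \<open>V\<close> of \<open>A\<close> containing it.\<close>

definition quotient_space ::
  "('k, 'a, 'c) module_scheme \<Rightarrow> 'a set \<Rightarrow> 'a set \<Rightarrow> ('k, 'a set) module" where
  "quotient_space A V W = (quotient_algebra A W)\<lparr>carrier := (\<lambda>x. W +>\<^bsub>A\<^esub> x) ` V\<rparr>"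

definition hilbert_function :: "('k::field, 'a, 'c) module_scheme \<Rightarrow> 'a set \<Rightarrow> nat \<Rightarrow> nat" where
  "hilbert_function A m i =
     vectorspace.dim ground (quotient_space A (ideal_power A m i) (ideal_power A m (Suc i)))"

definition has_socle_degree :: "('a, 'b) ring_scheme \<Rightarrow> 'a set \<Rightarrow> nat \<Rightarrow> bool" where
  "has_socle_degree A m s \<longleftrightarrow>
     ideal_power A m s \<noteq> {\<zero>\<^bsub>A\<^esub>} \<and> ideal_power A m (Suc s) = {\<zero>\<^bsub>A\<^esub>}"

definition socle :: "('a, 'b) ring_scheme \<Rightarrow> 'a set \<Rightarrow> 'a set" where
  "socle A m = {x \<in> carrier A. \<forall>y\<in>m. y \<otimes>\<^bsub>A\<^esub> x = \<zero>\<^bsub>A\<^esub>}"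

text \<open>
  The Gorenstein property of an Artinian local algebra whose residue field is the ground field:
  the socle \<open>(0 : m)\<close> is one-dimensional.
\<close>

definition gorenstein :: "('k::field, 'a, 'c) module_scheme \<Rightarrow> 'a set \<Rightarrow> bool" where
  "gorenstein A m \<longleftrightarrow> vectorspace.dim ground (A\<lparr>carrier := socle A m\<rparr>) = 1"

definition algebra_isomorphic ::
  "('k::field, 'a, 'c) module_scheme \<Rightarrow> ('k, 'b, 'd) module_scheme \<Rightarrow> bool" where
  "algebra_isomorphic A B \<longleftrightarrow>
     (\<exists>\<phi> \<in> ring_iso A B. \<forall>c. \<forall>x\<in>carrier A. \<phi> (c \<odot>\<^bsub>A\<^esub> x) = c \<odot>\<^bsub>B\<^esub> \<phi> x)"


section \<open>Power series, polynomials and the differentiation action\<close>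

text \<open>
  A monomial is its exponent vector, indexed by all natural numbers; the monomials in the first
  \<open>j\<close> variables are those supported in \<open>{1..j}\<close>. Hence, for \<open>i \<le> j\<close>, the
  elements of \<open>power_series i\<close> and \<open>polynomials i\<close> literally belong to
  \<open>power_series j\<close> and \<open>polynomials j\<close>.
\<close>

type_synonym exponent = "nat \<Rightarrow>\<^sub>0 nat"

definition total_degree :: "exponent \<Rightarrow> nat" where
  "total_degree a = (\<Sum>i\<in>Poly_Mapping.keys a. Poly_Mapping.lookup a i)"

text \<open>The algebra \<open>R\<^sub>j\<close>: a power series is its coefficient function, multiplied by convolution.\<close>

definition power_series :: "nat \<Rightarrow> ('k::field, exponent \<Rightarrow> 'k) module" where
  "power_series j =
     \<lparr>carrier = {f. \<forall>a. f a \<noteq> 0 \<longrightarrow> Poly_Mapping.keys a \<subseteq> {1..j}},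
      monoid.mult = (\<lambda>f g a. \<Sum>(b, c) \<in> {(b, c). b + c = a}. f b * g c),
      one = (\<lambda>a. if a = 0 then 1 else 0),
      zero = (\<lambda>a. 0),
      add = (\<lambda>f g a. f a + g a),
      module.smult = (\<lambda>c f a. c * f a)\<rparr>"

definition indet :: "nat \<Rightarrow> exponent \<Rightarrow> 'k::field" where
  "indet i = (\<lambda>a. if a = Poly_Mapping.single i 1 then 1 else 0)"

type_synonym 'k mpoly = "exponent \<Rightarrow>\<^sub>0 'k"

abbreviation scale :: "'k::field \<Rightarrow> 'k mpoly \<Rightarrow> 'k mpoly" where
  "scale c \<equiv> Poly_Mapping.map ((*) c)"

text \<open>The algebra \<open>S\<^sub>j\<close>.\<close>

definition polynomials :: "nat \<Rightarrow> ('k::field, 'k mpoly) module" where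
  "polynomials j =
     \<lparr>carrier = {p. \<forall>a\<in>Poly_Mapping.keys p. Poly_Mapping.keys a \<subseteq> {1..j}},
      monoid.mult = (*), one = 1, zero = 0, add = (+), module.smult = scale\<rparr>"

text \<open>If \<open>y\<^sub>i\<close> does not occur in a monomial, the subtraction truncates but the coefficient is zero.\<close>

definition partial_deriv :: "nat \<Rightarrow> 'k::field mpoly \<Rightarrow> 'k mpoly" where
  "partial_deriv i p =
     (\<Sum>a\<in>Poly_Mapping.keys p. Poly_Mapping.single (a - Poly_Mapping.single i 1)
                     (of_nat (Poly_Mapping.lookup a i) * Poly_Mapping.lookup p a))"

definition monomial_deriv :: "exponent \<Rightarrow> 'k::field mpoly \<Rightarrow> 'k mpoly" where
  "monomial_deriv a =
     fold (\<lambda>i. partial_deriv i ^^ Poly_Mapping.lookup a i)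
       (sorted_list_of_set (Poly_Mapping.keys a))"

text \<open>
  The action \<open>f \<circ> p\<close>. Only finitely many iterated derivatives of a polynomial are nonzero, so the
  sum is over a finite set.
\<close>

definition act :: "(exponent \<Rightarrow> 'k::field) \<Rightarrow> 'k mpoly \<Rightarrow> 'k mpoly" where
  "act f p = (\<Sum>a | monomial_deriv a p \<noteq> 0. scale (f a) (monomial_deriv a p))"

definition Ann :: "nat \<Rightarrow> 'k::field mpoly \<Rightarrow> (exponent \<Rightarrow> 'k) set" where
  "Ann j p = {g \<in> carrier (power_series j). act g p = 0}"

definition poly_form :: "nat \<Rightarrow> nat \<Rightarrow> 'k::field mpoly \<Rightarrow> bool" where
  "poly_form n d p \<longleftrightarrow>
     p \<in> carrier (polynomials n) \<and> (\<forall>a\<in>Poly_Mapping.keys p. total_degree a = d)"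

definition series_form :: "nat \<Rightarrow> nat \<Rightarrow> (exponent \<Rightarrow> 'k::field) \<Rightarrow> bool" where
  "series_form n d f \<longleftrightarrow>
     f \<in> carrier (power_series n) \<and> (\<forall>a. f a \<noteq> 0 \<longrightarrow> total_degree a = d)"

definition nondegenerate_form :: "nat \<Rightarrow> nat \<Rightarrow> 'k::field mpoly \<Rightarrow> bool" where
  "nondegenerate_form n d p \<longleftrightarrow>
     poly_form n d p \<and>
     vectorspace.dim ground
       ((polynomials n)\<lparr>carrier := LinearCombinations.module.span ground (polynomials n)
          {monomial_deriv a p | a. Poly_Mapping.keys a \<subseteq> {1..n} \<and> total_degree a = d - 1}\<rparr>) = n"

definition cubic_ideal ::
  "nat \<Rightarrow> nat \<Rightarrow> 'k::field mpoly \<Rightarrow> (exponent \<Rightarrow> 'k) \<Rightarrow> (exponent \<Rightarrow> 'k) set" where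
  "cubic_ideal h n F \<sigma> =
     (let R = power_series h in
      if n < h then
        Idl\<^bsub>R\<^esub> (Ann n F) <+>\<^bsub>R\<^esub>
        Idl\<^bsub>R\<^esub> ({indet i \<otimes>\<^bsub>R\<^esub> indet j | i j. 1 \<le> i \<and> i < j \<and> n + 1 \<le> j \<and> j \<le> h} \<union>
              {(indet j [^]\<^bsub>R\<^esub> (2::nat)) \<ominus>\<^bsub>R\<^esub> (2 \<odot>\<^bsub>R\<^esub> \<sigma>) | j. n + 1 \<le> j \<and> j \<le> h})
      else Ann h F)"

end

theory Submission
  imports Defs
begin

text \<open>
  Both directions rest on describing an ideal by the functional that vanishes on it. For a
  polynomial \<open>G\<close> put \<open>\<mu>(a) = (x\<^sup>a \<circ> G)(0)\<close>, that is, \<open>a!\<close> times the coefficient of \<open>y\<^sup>a\<close> in \<open>G\<close>.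
  A power series \<open>f\<close> kills \<open>G\<close> exactly when \<open>\<Sum>\<^sub>a f(a) \<mu>(a + b) = 0\<close> for all exponents \<open>b\<close>
  (\<open>Ann_eq_annihilator\<close>), so \<open>Ann(G)\<close> is determined by \<open>\<mu>\<close> alone. The ideal of the theorem is
  \<open>Ann(G)\<close> for \<open>G = F + y\<^sub>n\<^sub>+\<^sub>1\<^sup>2 + \<dots> + y\<^sub>h\<^sup>2\<close>, whichever \<open>\<sigma>\<close> with \<open>\<sigma> \<circ> F = 1\<close> is taken
  (\<open>cubic_ideal_eq_annihilator\<close>). Hence the choice of \<open>\<sigma>\<close> is immaterial.

  A quotient of the power series ring by such an annihilator is Gorenstein: a series \<open>f\<close>
  representing a socle element pairs to zero with every monomial except \<open>1\<close>, hence differs by an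
  element of the ideal from a multiple of a fixed monomial of top degree
  (locale \<open>presentation\<close>).

  Conversely, let \<open>A\<close> be Gorenstein with \<open>m\<^sup>4 = 0 \<noteq> m\<^sup>3\<close>. The socle is \<open>m\<^sup>3 = K w\<close>, and for a linear
  functional \<open>l\<close> with \<open>l(w) = 1\<close> the form \<open>(a, b) \<mapsto> l(a b)\<close> on \<open>A\<close> is nondegenerate
  (locale \<open>gorenstein_functional\<close>). It puts \<open>m\<^sup>2/m\<^sup>3\<close> in duality with \<open>m/W\<close>, where
  \<open>W = m \<inter> (0 : m\<^sup>2)\<close>, and it induces a nondegenerate form on \<open>W/m\<^sup>2\<close>. So \<open>m/m\<^sup>2\<close> has a basis
  made of \<open>n\<close> elements \<open>x\<^sub>i\<close> dual to a basis \<open>q\<^sub>i\<close> of \<open>m\<^sup>2/m\<^sup>3\<close> and of an orthogonal basis \<open>z\<^sub>j\<close> of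
  \<open>W/m\<^sup>2\<close>, scaled to \<open>l(z\<^sub>j\<^sup>2) = 2\<close>; in particular \<open>n \<le> h\<close>. Three corrections bring these
  generators into a position where all values of \<open>l\<close> on monomials are known
  (\<open>adapted_generators_exist\<close>): adding elements of \<open>W\<close> to the \<open>x\<^sub>i\<close> makes them orthogonal to the
  \<open>z\<^sub>j\<close>; adding elements of \<open>m\<^sup>2\<close> changes the products \<open>l(x\<^sub>i x\<^sub>j)\<close> by an arbitrary symmetric
  matrix, by duality with the \<open>q\<^sub>i\<close>, and so makes all of them zero; adding multiples of \<open>w\<close>
  makes \<open>l\<close> vanish on the generators. The second correction is what makes the dual
  polynomial a cubic form in \<open>y\<^sub>1, \<dots>, y\<^sub>n\<close> plus squares, with no mixed quadratic part.

  Evaluation at the adapted generators maps the power series ring onto \<open>A\<close>. By nondegeneracy of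
  the form its kernel is the annihilator of the functional \<open>a \<mapsto> l(\<xi>\<^sup>a)\<close>, and this functional is
  the one that belongs to \<open>F + y\<^sub>n\<^sub>+\<^sub>1\<^sup>2 + \<dots> + y\<^sub>h\<^sup>2\<close>. The second derivatives of \<open>F\<close> contain all
  variables \<open>y\<^sub>k\<close> in their span because \<open>q\<^sub>k\<close> is the image of some power series.
\<close>

abbreviation (input) lookup :: "('i \<Rightarrow>\<^sub>0 'b::zero) \<Rightarrow> 'i \<Rightarrow> 'b" where
  "lookup \<equiv> Poly_Mapping.lookup"

abbreviation (input) keys :: "('i \<Rightarrow>\<^sub>0 'b::zero) \<Rightarrow> 'i set" where
  "keys \<equiv> Poly_Mapping.keys"

abbreviation (input) single :: "'i \<Rightarrow> 'b \<Rightarrow> ('i \<Rightarrow>\<^sub>0 'b::zero)" where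
  "single \<equiv> Poly_Mapping.single"

section \<open>Exponents\<close>

lemma keys_add_exponent: "keys (a + b :: exponent) = keys a \<union> keys b"
  by (auto simp: in_keys_iff lookup_add)

lemma total_degree_superset:
  assumes "finite S" "keys a \<subseteq> S"
  shows "total_degree a = (\<Sum>i\<in>S. lookup a i)"
  unfolding total_degree_def by (rule sum.mono_neutral_left) (use assms in \<open>auto simp: in_keys_iff\<close>)

lemma total_degree_add [simp]: "total_degree (a + b) = total_degree a + total_degree b"
proof -
  let ?S = "keys a \<union> keys b"
  have "total_degree (a + b) = (\<Sum>i\<in>?S. lookup (a + b) i)"
    by (rule total_degree_superset) (auto simp: keys_add_exponent)
  also have "\<dots> = (\<Sum>i\<in>?S. lookup a i) + (\<Sum>i\<in>?S. lookup b i)"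
    by (simp add: lookup_add sum.distrib)
  also have "\<dots> = total_degree a + total_degree b"
    by (simp add: total_degree_superset[of ?S])
  finally show ?thesis .
qed

lemma total_degree_single [simp]: "total_degree (single i k) = k"
  by (simp add: total_degree_def)

lemma total_degree_zero_exponent [simp]: "total_degree 0 = 0"
  by (simp add: total_degree_def)

lemma total_degree_eq_0 [simp]: "total_degree a = 0 \<longleftrightarrow> a = 0"
  by (auto simp: total_degree_def in_keys_iff intro!: poly_mapping_eqI)

lemma lookup_le_total_degree: "lookup a i \<le> total_degree a"
proof (cases "i \<in> keys a")
  case True
  then show ?thesis unfolding total_degree_def by (intro member_le_sum) auto
qed (simp add: in_keys_iff)

lemma exponent_split:
  assumes "lookup (a::exponent) i \<noteq> 0"
  obtains b where "a = single i 1 + b"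
proof
  show "a = single i 1 + (a - single i 1)"
    by (rule poly_mapping_eqI) (use assms in \<open>auto simp: lookup_add lookup_minus lookup_single when_def\<close>)
qed

lemma exponent_nonzero_split:
  assumes "(a::exponent) \<noteq> 0"
  obtains i b where "i \<in> keys a" "a = single i 1 + b"
proof -
  obtain i where "i \<in> keys a" using assms by (metis keys_eq_empty equals0I)
  thus ?thesis using exponent_split[of a i] that by (auto simp: in_keys_iff)
qed

lemma finite_bounded_exponents:
  assumes "finite S"
  shows "finite {a::exponent. keys a \<subseteq> S \<and> (\<forall>i. lookup a i \<le> d)}"
proof (rule finite_imageD)
  let ?F = "{f::nat \<Rightarrow> nat. \<forall>x. (x \<in> S \<longrightarrow> f x \<in> {..d}) \<and> (x \<notin> S \<longrightarrow> f x = 0)}"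
  have "finite ?F" using assms by (intro finite_set_of_finite_funs) auto
  moreover have "lookup ` {a. keys a \<subseteq> S \<and> (\<forall>i. lookup a i \<le> d)} \<subseteq> ?F"
    by (auto simp: in_keys_iff subset_iff)
  ultimately show "finite (lookup ` {a. keys a \<subseteq> S \<and> (\<forall>i. lookup a i \<le> d)})"
    by (rule rev_finite_subset)
  show "inj_on lookup {a::exponent. keys a \<subseteq> S \<and> (\<forall>i. lookup a i \<le> d)}"
    by (auto intro!: inj_onI poly_mapping_eqI)
qed

lemma finite_splittings: "finite {(b, c). b + c = (a::exponent)}"
proof -
  let ?B = "{b::exponent. keys b \<subseteq> keys a \<and> (\<forall>i. lookup b i \<le> total_degree a)}"
  have "b \<in> ?B \<and> c \<in> ?B" if "b + c = a" for b c
    using that trans_le_add1[OF lookup_le_total_degree[of b]] trans_le_add2[OF lookup_le_total_degree[of c]]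
    by (auto simp: keys_add_exponent)
  hence "{(b, c). b + c = a} \<subseteq> ?B \<times> ?B" by blast
  thus ?thesis by (rule finite_subset) (intro finite_cartesian_product finite_bounded_exponents finite_keys)
qed

definition low_exponents :: "nat \<Rightarrow> nat \<Rightarrow> exponent set" where
  "low_exponents h d = {a. keys a \<subseteq> {1..h} \<and> total_degree a \<le> d}"

lemma finite_low_exponents [simp]: "finite (low_exponents h d)"
proof (rule finite_subset)
  show "low_exponents h d \<subseteq> {a. keys a \<subseteq> {1..h} \<and> (\<forall>i. lookup a i \<le> d)}"
    by (auto simp: low_exponents_def intro: order.trans[OF lookup_le_total_degree])
qed (rule finite_bounded_exponents, simp)

section \<open>Iterated derivatives and moments\<close>

definition exponent_fact :: "exponent \<Rightarrow> 'k::field_char_0" where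
  "exponent_fact a = (\<Prod>i\<in>keys a. fact (lookup a i))"

lemma exponent_fact_superset:
  assumes "finite S" "keys a \<subseteq> S"
  shows "exponent_fact a = (\<Prod>i\<in>S. fact (lookup a i))"
  unfolding exponent_fact_def by (rule prod.mono_neutral_left) (use assms in \<open>auto simp: in_keys_iff\<close>)

lemma exponent_fact_nonzero [simp]: "exponent_fact a \<noteq> 0"
  by (simp add: exponent_fact_def)

lemma exponent_fact_zero [simp]: "exponent_fact 0 = 1"
  by (simp add: exponent_fact_def)

lemma exponent_fact_single [simp]: "exponent_fact (single i 1) = 1"
  by (simp add: exponent_fact_def)

lemma lookup_partial_deriv:
  "lookup (partial_deriv i p) b =
     of_nat (Suc (lookup b i)) * lookup p (b + single i 1)"
proof -
  let ?e = "single i 1 :: exponent"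
  let ?c = "\<lambda>a. of_nat (lookup a i) * lookup p a"
  have "lookup (partial_deriv i p) b = (\<Sum>a\<in>keys p. (?c a when a - ?e = b))"
    by (simp add: partial_deriv_def lookup_sum lookup_single)
  also have "\<dots> = (\<Sum>a\<in>keys p. if a = b + ?e then ?c a else 0)"
  proof (rule sum.cong[OF refl])
    fix a
    show "(?c a when a - ?e = b) = (if a = b + ?e then ?c a else 0)"
    proof (cases "lookup a i = 0")
      case False
      then obtain d where "a = ?e + d" by (rule exponent_split)
      thus ?thesis by (auto simp: when_def add.commute)
    qed (auto simp: when_def)
  qed
  also have "\<dots> = ?c (b + ?e)"
    by (auto simp: in_keys_iff)
  finally show ?thesis by (simp add: lookup_add)
qed

text \<open>
  Multiplying by the factorial of the exponent clears the falling factorial that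
  differentiation produces, so the relation becomes symmetric and composes well.
\<close>

lemma lookup_partial_deriv_power:
  fixes p :: "'k::field_char_0 mpoly"
  shows "fact (lookup b i) * lookup ((partial_deriv i ^^ k) p) b =
     fact (lookup b i + k) * lookup p (b + single i k)"
proof (induction k arbitrary: b)
  case (Suc k)
  let ?b = "b + single i 1"
  have "fact (lookup b i) * lookup ((partial_deriv i ^^ Suc k) p) b =
      fact (lookup ?b i) * lookup ((partial_deriv i ^^ k) p) ?b"
    by (simp add: lookup_partial_deriv lookup_add fact_Suc mult_ac del: of_nat_Suc)
  also have "\<dots> = fact (lookup ?b i + k) * lookup p (?b + single i k)"
    by (rule Suc.IH)
  also have "lookup ?b i + k = lookup b i + Suc k"
    by (simp add: lookup_add)
  also have "?b + single i k = b + single i (Suc k)"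
    by (simp add: add.assoc flip: single_add)
  finally show ?case .
qed simp

lemma lookup_fold_partial_deriv:
  fixes p :: "'k::field_char_0 mpoly"
  assumes "distinct xs"
  shows "(\<Prod>i\<in>set xs. fact (lookup b i)) *
       lookup (fold (\<lambda>i. partial_deriv i ^^ lookup a i) xs p) b =
     (\<Prod>i\<in>set xs. fact (lookup b i + lookup a i)) *
       lookup p (b + (\<Sum>i\<in>set xs. single i (lookup a i)))"
  using assms
proof (induction xs arbitrary: p)
  case (Cons x xs)
  let ?k = "lookup a x"
  let ?s = "\<Sum>i\<in>set xs. single i (lookup a i)"
  let ?q = "(partial_deriv x ^^ ?k) p"
  have x: "x \<notin> set xs" and d: "distinct xs" using Cons.prems by auto
  have "lookup ?s x = 0"
    using x by (auto simp: lookup_sum lookup_single when_def intro!: sum.neutral)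
  hence bx: "lookup (b + ?s) x = lookup b x" by (simp add: lookup_add)
  have "(\<Prod>i\<in>set (x#xs). fact (lookup b i)) *
       lookup (fold (\<lambda>i. partial_deriv i ^^ lookup a i) (x#xs) p) b
     = fact (lookup b x) * ((\<Prod>i\<in>set xs. fact (lookup b i + lookup a i)) *
       lookup ?q (b + ?s))"
    using x by (simp add: Cons.IH[OF d, of ?q, symmetric] mult.assoc)
  also have "\<dots> = (\<Prod>i\<in>set xs. fact (lookup b i + lookup a i)) *
       (fact (lookup (b + ?s) x) * lookup ?q (b + ?s))"
    unfolding bx by (simp add: mult_ac)
  also have "\<dots> = (\<Prod>i\<in>set xs. fact (lookup b i + lookup a i)) *
       (fact (lookup b x + ?k) * lookup p (b + ?s + single x ?k))"
    by (simp only: lookup_partial_deriv_power[of "b + ?s" x ?k p, unfolded bx] bx)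
  finally show ?case using x by (simp add: mult_ac add_ac)
qed simp

lemma exponent_eq_sum_single:
  "(\<Sum>i\<in>keys a. single i (lookup a i)) = (a::exponent)"
  by (rule poly_mapping_eqI)
     (auto simp: lookup_sum lookup_single when_def in_keys_iff)

text \<open>
  The value at the origin of \<open>x\<^sup>a \<circ> p\<close>. Coefficients in this normalisation turn differentiation
  into a shift of the index.
\<close>

definition moment :: "'k::field_char_0 mpoly \<Rightarrow> exponent \<Rightarrow> 'k" where
  "moment p a = exponent_fact a * lookup p a"

text \<open>
  Only the variables occurring in \<open>a\<close> are differentiated; for the others the same factorial
  stands on both sides.
\<close>

lemma lookup_monomial_deriv:
  fixes p :: "'k::field_char_0 mpoly"
  shows "exponent_fact b * lookup (monomial_deriv a p) b = moment p (a + b)"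
proof -
  let ?A = "keys a" and ?B = "keys b"
  have *: "(\<Prod>i\<in>?A. fact (lookup b i)) * lookup (monomial_deriv a p) b =
    (\<Prod>i\<in>?A. fact (lookup b i + lookup a i)) * lookup p (b + a)"
    unfolding monomial_deriv_def
    using lookup_fold_partial_deriv[of "sorted_list_of_set ?A" b a p]
    by (simp add: exponent_eq_sum_single)
  have "exponent_fact b = (\<Prod>i\<in>?A. fact (lookup b i)) * (\<Prod>i\<in>?B - ?A. fact (lookup b i) :: 'k)"
    by (subst exponent_fact_superset[of "?A \<union> ?B"])
       (auto simp: prod.union_disjoint[symmetric] intro!: prod.cong)
  moreover have "exponent_fact (a + b) = (\<Prod>i\<in>?A. fact (lookup b i + lookup a i)) * (\<Prod>i\<in>?B - ?A. fact (lookup b i) :: 'k)"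
  proof -
    have "exponent_fact (a + b) = (\<Prod>i\<in>?A \<union> (?B - ?A). fact (lookup (a + b) i) :: 'k)"
      by (rule exponent_fact_superset) (auto simp: keys_add_exponent)
    also have "\<dots> = (\<Prod>i\<in>?A. fact (lookup (a + b) i)) * (\<Prod>i\<in>?B - ?A. fact (lookup (a + b) i))"
      by (rule prod.union_disjoint) auto
    also have "(\<Prod>i\<in>?B - ?A. fact (lookup (a + b) i)) = (\<Prod>i\<in>?B - ?A. fact (lookup b i) :: 'k)"
      by (rule prod.cong) (auto simp: lookup_add in_keys_iff)
    finally show ?thesis by (simp add: lookup_add add.commute)
  qed
  ultimately show ?thesis using * by (simp add: moment_def add.commute mult_ac)
qed

lemma monomial_deriv_eq_0:
  fixes p :: "'k::field_char_0 mpoly"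
  assumes "monomial_deriv a p \<noteq> 0"
  obtains b where "moment p (a + b) \<noteq> 0"
proof -
  obtain b where "lookup (monomial_deriv a p) b \<noteq> 0"
    using assms by (metis poly_mapping_eqI lookup_zero)
  hence "moment p (a + b) \<noteq> 0" using lookup_monomial_deriv[of b a p] by auto
  thus ?thesis by (rule that)
qed

lemma finite_nonzero_derivs: "finite {a. monomial_deriv a (p::'k::field_char_0 mpoly) \<noteq> 0}"
proof (rule finite_subset)
  show "{a. monomial_deriv a p \<noteq> 0} \<subseteq> (\<Union>d\<in>keys p. fst ` {(a, b). a + b = d})"
  proof
    fix a assume "a \<in> {a. monomial_deriv a p \<noteq> 0}"
    then obtain b where "moment p (a + b) \<noteq> 0" using monomial_deriv_eq_0 by blast
    hence "a + b \<in> keys p" by (auto simp: moment_def in_keys_iff)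
    thus "a \<in> (\<Union>d\<in>keys p. fst ` {(a, b). a + b = d})" by force
  qed
qed (auto intro!: finite_imageI finite_splittings)

lemma lookup_scale [simp]: "lookup (scale c p) a = c * lookup p a"
  by (simp add: map.rep_eq when_def)

definition vanishes_above :: "nat \<Rightarrow> (exponent \<Rightarrow> 'k::zero) \<Rightarrow> bool" where
  "vanishes_above d \<mu> \<longleftrightarrow> (\<forall>a. total_degree a > d \<longrightarrow> \<mu> a = 0)"

lemma lookup_act:
  fixes p :: "'k::field_char_0 mpoly"
  assumes f: "f \<in> carrier (power_series h)" and p: "vanishes_above d (moment p)"
  shows "exponent_fact b * lookup (act f p) b =
     (\<Sum>a\<in>low_exponents h d. f a * moment p (a + b))"
proof -
  have "exponent_fact b * lookup (act f p) b =
      (\<Sum>a | monomial_deriv a p \<noteq> 0. f a * moment p (a + b))"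
    by (simp add: act_def lookup_sum sum_distrib_left mult.left_commute flip: lookup_monomial_deriv)
  also have "\<dots> = (\<Sum>a\<in>low_exponents h d. f a * moment p (a + b))"
  proof (rule sum.mono_neutral_cong)
    fix a assume "a \<in> low_exponents h d - {a. monomial_deriv a p \<noteq> 0}"
    thus "f a * moment p (a + b) = 0" using lookup_monomial_deriv[of b a p] by auto
  next
    fix a assume "a \<in> {a. monomial_deriv a p \<noteq> 0} - low_exponents h d"
    hence "f a = 0 \<or> total_degree (a + b) > d"
      using f by (auto simp: low_exponents_def power_series_def)
    thus "f a * moment p (a + b) = 0" using p by (auto simp: vanishes_above_def)
  qed (auto intro: finite_nonzero_derivs)
  finally show ?thesis .
qed

text \<open>
  For a function \<open>\<mu>\<close> that is supported in the first \<open>h\<close> variables and vanishes above degree \<open>d\<close>, this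
  is the largest ideal on which the functional \<open>f \<mapsto> \<Sum>\<^sub>a f(a) \<mu>(a)\<close> vanishes: shifting the index by
  \<open>b\<close> amounts to multiplying \<open>f\<close> by \<open>x\<^sup>b\<close>.
\<close>

definition annihilator :: "nat \<Rightarrow> nat \<Rightarrow> (exponent \<Rightarrow> 'k::field) \<Rightarrow> (exponent \<Rightarrow> 'k) set" where
  "annihilator h d \<mu> =
     {f \<in> carrier (power_series h). \<forall>b. (\<Sum>a\<in>low_exponents h d. f a * \<mu> (a + b)) = 0}"

lemma Ann_eq_annihilator:
  fixes p :: "'k::field_char_0 mpoly"
  assumes "vanishes_above d (moment p)"
  shows "Ann h p = annihilator h d (moment p)"
proof -
  have "act f p = 0 \<longleftrightarrow> (\<forall>b. (\<Sum>a\<in>low_exponents h d. f a * moment p (a + b)) = 0)"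
    if "f \<in> carrier (power_series h)" for f
    unfolding lookup_act[OF that assms, symmetric] by (auto simp: poly_mapping_eq_iff fun_eq_iff)
  thus ?thesis by (auto simp: Ann_def annihilator_def)
qed

section \<open>The algebra of power series\<close>

lemma power_series_simps:
  "carrier (power_series h) = {f. \<forall>a. f a \<noteq> 0 \<longrightarrow> keys a \<subseteq> {1..h}}"
  "\<zero>\<^bsub>power_series h\<^esub> = (\<lambda>a. 0)"
  "\<one>\<^bsub>power_series h\<^esub> = (\<lambda>a. if a = 0 then 1 else 0)"
  "f \<oplus>\<^bsub>power_series h\<^esub> g = (\<lambda>a. f a + g a)"
  "f \<otimes>\<^bsub>power_series h\<^esub> g = (\<lambda>a. \<Sum>(b, c) \<in> {(b, c). b + c = a}. f b * g c)"
  "c \<odot>\<^bsub>power_series h\<^esub> f = (\<lambda>a. c * f a)"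
  by (simp_all add: power_series_def)

lemma conv_commute:
  "(\<Sum>(b, c) \<in> {(b, c). b + c = (a::exponent)}. f b * g c :: 'k::comm_ring) = (\<Sum>(b, c) \<in> {(b, c). b + c = a}. g b * f c)"
  by (rule sum.reindex_bij_witness[of _ prod.swap prod.swap]) (auto simp: add.commute mult.commute)

lemma conv_assoc:
  fixes f g k :: "exponent \<Rightarrow> 'k::comm_ring"
  shows "(\<Sum>(b, c) \<in> {(b, c). b + c = a}. (\<Sum>(d, e) \<in> {(d, e). d + e = b}. f d * g e) * k c) =
    (\<Sum>(b, c) \<in> {(b, c). b + c = a}. f b * (\<Sum>(d, e) \<in> {(d, e). d + e = c}. g d * k e))"
proof -
  let ?T = "\<lambda>a. {(b, c). b + c = (a::exponent)}"
  have "(\<Sum>(b, c) \<in> ?T a. (\<Sum>(d, e) \<in> ?T b. f d * g e) * k c) =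
     (\<Sum>x\<in>?T a. \<Sum>y\<in>?T (fst x). f (fst y) * g (snd y) * k (snd x))"
    by (simp add: case_prod_beta sum_distrib_right)
  also have "\<dots> = (\<Sum>(x, y)\<in>(SIGMA x:?T a. ?T (fst x)). f (fst y) * g (snd y) * k (snd x))"
    by (rule sum.Sigma) (auto simp: finite_splittings)
  also have "\<dots> = (\<Sum>(x, y)\<in>(SIGMA x:?T a. ?T (snd x)). f (fst x) * (g (fst y) * k (snd y)))"
    by (rule sum.reindex_bij_witness[of _
        "\<lambda>((b, c), (d, e)). ((b + d, e), (b, d))" "\<lambda>((b, c), (d, e)). ((d, e + c), (e, c))"])
       (auto simp: add.assoc mult.assoc)
  also have "\<dots> = (\<Sum>x\<in>?T a. \<Sum>y\<in>?T (snd x). f (fst x) * (g (fst y) * k (snd y)))"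
    by (rule sum.Sigma[symmetric]) (auto simp: finite_splittings)
  also have "\<dots> = (\<Sum>(b, c) \<in> ?T a. f b * (\<Sum>(d, e) \<in> ?T c. g d * k e))"
    by (simp add: case_prod_beta sum_distrib_left)
  finally show ?thesis .
qed

text \<open>
  The subtraction of exponents truncates when \<open>e\<close> does not divide \<open>a\<close>; the guard excludes
  that case.
\<close>

lemma conv_monomial:
  fixes g :: "exponent \<Rightarrow> 'k::field"
  shows "(\<Sum>(b, c) \<in> {(b, c). b + c = a}. (if b = e then s else 0) * g c) =
     (if \<exists>c. a = e + c then s * g (a - e) else 0)"
proof (cases "\<exists>c. a = e + c")
  case True
  then obtain d where d: "a = e + d" by blast
  have "(\<Sum>(b, c) \<in> {(b, c). b + c = a}. (if b = e then s else 0) * g c) =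
    (\<Sum>x \<in> {(b, c). b + c = a}. if x = (e, d) then s * g d else 0)"
    by (rule sum.cong) (auto simp: d split: if_splits)
  thus ?thesis by (simp add: d finite_splittings)
next
  case False
  thus ?thesis by (auto intro!: sum.neutral)
qed

lemma conv_closed:
  assumes "f \<in> carrier (power_series h)" "g \<in> carrier (power_series h)"
  shows "f \<otimes>\<^bsub>power_series h\<^esub> g \<in> carrier (power_series h)"
proof -
  have "keys a \<subseteq> {1..h}" if nz: "(f \<otimes>\<^bsub>power_series h\<^esub> g) a \<noteq> 0" for a
  proof -
    have "\<exists>x\<in>{(b, c). b + c = a}. (case x of (b, c) \<Rightarrow> f b * g c) \<noteq> 0"
      using nz unfolding power_series_simps by (meson sum.neutral)
    then obtain b c where "b + c = a" "f b \<noteq> 0" "g c \<noteq> 0" by auto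
    moreover from this have "keys b \<subseteq> {1..h}" "keys c \<subseteq> {1..h}"
      using assms by (simp_all add: power_series_simps)
    ultimately show ?thesis by (metis keys_add_exponent Un_subset_iff)
  qed
  thus ?thesis by (auto simp: power_series_simps(1))
qed

lemma ground_simps [simp]:
  "carrier (ground :: 'k::field ring) = UNIV" "\<zero>\<^bsub>ground\<^esub> = (0::'k)" "\<one>\<^bsub>ground\<^esub> = (1::'k)"
  "c \<oplus>\<^bsub>ground\<^esub> d = c + (d::'k)" "c \<otimes>\<^bsub>ground\<^esub> d = c * (d::'k)"
  by (simp_all add: ring_of_type_algebra_def)

lemma algebra_power_series: "algebra ground (power_series h :: ('k::field, _) module)"
proof (rule algebraI)
  let ?R = "power_series h :: ('k, _) module"
  note ps = power_series_simps
  have add: "f \<oplus>\<^bsub>?R\<^esub> g \<in> carrier ?R" if "f \<in> carrier ?R" "g \<in> carrier ?R" for f g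
    using that by (simp add: ps) (metis add.right_neutral)
  have smult: "c \<odot>\<^bsub>?R\<^esub> f \<in> carrier ?R" if "f \<in> carrier ?R" for c f
    using that by (simp add: ps)
  show "cring (ground :: 'k ring)" ..
  show "cring ?R"
  proof (rule cringI)
    show "abelian_group ?R"
    proof (rule abelian_groupI)
      fix f assume f: "f \<in> carrier ?R"
      show "\<exists>y\<in>carrier ?R. y \<oplus>\<^bsub>?R\<^esub> f = \<zero>\<^bsub>?R\<^esub>"
        by (rule bexI[OF _ smult[OF f, of "-1"]]) (simp add: ps)
    next
      fix f g k assume *: "f \<in> carrier ?R" "g \<in> carrier ?R" "k \<in> carrier ?R"
      show "f \<oplus>\<^bsub>?R\<^esub> g \<in> carrier ?R" by (rule add) fact+
      show "f \<oplus>\<^bsub>?R\<^esub> g \<oplus>\<^bsub>?R\<^esub> k = f \<oplus>\<^bsub>?R\<^esub> (g \<oplus>\<^bsub>?R\<^esub> k)" by (simp add: ps add.assoc)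
      show "f \<oplus>\<^bsub>?R\<^esub> g = g \<oplus>\<^bsub>?R\<^esub> f" by (simp add: ps add.commute)
      show "\<zero>\<^bsub>?R\<^esub> \<oplus>\<^bsub>?R\<^esub> f = f" by (simp add: ps)
    qed (simp add: ps)
    show "comm_monoid ?R"
    proof (rule comm_monoidI)
      fix f g k assume *: "f \<in> carrier ?R" "g \<in> carrier ?R" "k \<in> carrier ?R"
      show "f \<otimes>\<^bsub>?R\<^esub> g \<in> carrier ?R" using * by (intro conv_closed)
      show "f \<otimes>\<^bsub>?R\<^esub> g \<otimes>\<^bsub>?R\<^esub> k = f \<otimes>\<^bsub>?R\<^esub> (g \<otimes>\<^bsub>?R\<^esub> k)"
        unfolding power_series_simps by (rule ext) (rule conv_assoc)
      show "f \<otimes>\<^bsub>?R\<^esub> g = g \<otimes>\<^bsub>?R\<^esub> f"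
        unfolding power_series_simps by (rule ext) (rule conv_commute)
      show "\<one>\<^bsub>?R\<^esub> \<otimes>\<^bsub>?R\<^esub> f = f"
        unfolding power_series_simps by (rule ext) (subst conv_monomial, simp)
    qed (simp add: ps)
    fix f g k assume "f \<in> carrier ?R" "g \<in> carrier ?R" "k \<in> carrier ?R"
    show "(f \<oplus>\<^bsub>?R\<^esub> g) \<otimes>\<^bsub>?R\<^esub> k = (f \<otimes>\<^bsub>?R\<^esub> k) \<oplus>\<^bsub>?R\<^esub> (g \<otimes>\<^bsub>?R\<^esub> k)"
      by (simp add: ps case_prod_beta distrib_right sum.distrib)
  qed
  fix f g and c d :: 'k assume *: "f \<in> carrier ?R" "g \<in> carrier ?R"
  show "c \<odot>\<^bsub>?R\<^esub> f \<in> carrier ?R" by (rule smult) fact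
  show "(c \<oplus>\<^bsub>ground\<^esub> d) \<odot>\<^bsub>?R\<^esub> f = c \<odot>\<^bsub>?R\<^esub> f \<oplus>\<^bsub>?R\<^esub> d \<odot>\<^bsub>?R\<^esub> f" by (simp add: ps distrib_right)
  show "c \<odot>\<^bsub>?R\<^esub> (f \<oplus>\<^bsub>?R\<^esub> g) = c \<odot>\<^bsub>?R\<^esub> f \<oplus>\<^bsub>?R\<^esub> c \<odot>\<^bsub>?R\<^esub> g" by (simp add: ps distrib_left)
  show "(c \<otimes>\<^bsub>ground\<^esub> d) \<odot>\<^bsub>?R\<^esub> f = c \<odot>\<^bsub>?R\<^esub> (d \<odot>\<^bsub>?R\<^esub> f)" by (simp add: ps mult.assoc)
  show "\<one>\<^bsub>ground\<^esub> \<odot>\<^bsub>?R\<^esub> f = f" by (simp add: ps)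
  show "c \<odot>\<^bsub>?R\<^esub> f \<otimes>\<^bsub>?R\<^esub> g = c \<odot>\<^bsub>?R\<^esub> (f \<otimes>\<^bsub>?R\<^esub> g)"
    by (simp add: ps case_prod_beta sum_distrib_left mult.assoc)
qed

section \<open>Algebras over the ground field\<close>

locale kalgebra =
  fixes A :: "('k::field, 'a, 'c) module_scheme" (structure)
  assumes algebra_ground: "algebra ground A"

sublocale kalgebra \<subseteq> cring A
  by (rule algebra.M_cring[OF algebra_ground])

context kalgebra
begin

lemma
  assumes "x \<in> carrier A"
  shows smult_closed [simp, intro]: "c \<odot> x \<in> carrier A"
    and smult_add_left: "(c + d) \<odot> x = c \<odot> x \<oplus> d \<odot> x"
    and smult_smult: "c \<odot> (d \<odot> x) = (c * d) \<odot> x"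
    and smult_one [simp]: "1 \<odot> x = x"
  using assms algebra.axioms(1)[OF algebra_ground, THEN module.smult_closed, of c x]
    algebra.axioms(1)[OF algebra_ground, THEN module.smult_l_distr, of c d x]
    algebra.axioms(1)[OF algebra_ground, THEN module.smult_assoc1, of c d x]
    algebra.axioms(1)[OF algebra_ground, THEN module.smult_one, of x]
  by simp_all

lemma smult_add_right:
  "x \<in> carrier A \<Longrightarrow> y \<in> carrier A \<Longrightarrow> c \<odot> (x \<oplus> y) = c \<odot> x \<oplus> c \<odot> y"
  using algebra.axioms(1)[OF algebra_ground, THEN module.smult_r_distr, of c x y] by simp

lemma smult_mult_left:
  "x \<in> carrier A \<Longrightarrow> y \<in> carrier A \<Longrightarrow> c \<odot> x \<otimes> y = c \<odot> (x \<otimes> y)"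
  using algebra.smult_assoc2[OF algebra_ground, of c x y] by simp

lemma smult_mult_right:
  "x \<in> carrier A \<Longrightarrow> y \<in> carrier A \<Longrightarrow> x \<otimes> (c \<odot> y) = c \<odot> (x \<otimes> y)"
  using smult_mult_left[of y x c] by (simp add: m_comm)

lemma smult_zero_left [simp]: "x \<in> carrier A \<Longrightarrow> 0 \<odot> x = \<zero>"
  using smult_add_left[of x 0 0] by (simp add: add.l_cancel_one')

lemma smult_zero_right [simp]: "c \<odot> \<zero> = \<zero>"
  using smult_add_right[of \<zero> \<zero> c] by (simp add: add.l_cancel_one')

lemma smult_minus_one: "x \<in> carrier A \<Longrightarrow> (- 1) \<odot> x = \<ominus> x"
  using smult_add_left[of x "-1" 1] by (intro minus_equality[symmetric]) auto

lemma smult_eq_mult: "x \<in> carrier A \<Longrightarrow> c \<odot> x = (c \<odot> \<one>) \<otimes> x"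
  by (simp add: smult_mult_left)

lemma ideal_smult_closed:
  assumes "ideal J A" "x \<in> J"
  shows "c \<odot> x \<in> J"
  using assms by (subst smult_eq_mult) (auto intro: ideal.I_l_closed ideal.Icarr)

lemma ideal_add_closed: "ideal J A \<Longrightarrow> x \<in> J \<Longrightarrow> y \<in> J \<Longrightarrow> x \<oplus> y \<in> J"
  by (intro additive_subgroup.a_closed ideal.axioms(1))

lemma ideal_zero_closed: "ideal J A \<Longrightarrow> \<zero> \<in> J"
  by (intro additive_subgroup.zero_closed ideal.axioms(1))

text \<open>
  As \<open>- x = (- 1) x\<close>, closure under multiplication gives closure under negation.
\<close>

lemma idealI_closed:
  assumes "J \<subseteq> carrier A" "\<zero> \<in> J"
    and add: "\<And>x y. x \<in> J \<Longrightarrow> y \<in> J \<Longrightarrow> x \<oplus> y \<in> J"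
    and mult: "\<And>x y. x \<in> carrier A \<Longrightarrow> y \<in> J \<Longrightarrow> x \<otimes> y \<in> J"
  shows "ideal J A"
proof (rule idealI)
  have neg: "\<ominus> x \<in> J" if "x \<in> J" for x
  proof -
    have "\<ominus> x = (\<ominus> \<one>) \<otimes> x" using that assms(1) by (auto simp: l_minus)
    thus ?thesis using mult[of "\<ominus> \<one>" x] that by simp
  qed
  show "subgroup J (add_monoid A)"
    using assms neg by (intro add.subgroupI) (auto simp flip: a_inv_def)
  show "x \<otimes> a \<in> J" "a \<otimes> x \<in> J" if "a \<in> J" "x \<in> carrier A" for a x
    using mult[OF that(2,1)] that assms(1) by (auto simp: m_comm)
qed (rule ring_axioms)

end

section \<open>Monomials and annihilators in the power series ring\<close>

lemma kalgebra_power_series: "kalgebra (power_series h)"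
  by (rule kalgebra.intro) (rule algebra_power_series)

lemma power_series_minus:
  assumes "f \<in> carrier (power_series h)" "g \<in> carrier (power_series h)"
  shows "f \<ominus>\<^bsub>power_series h\<^esub> g = (\<lambda>a. f a - g a)"
proof -
  interpret kalgebra "power_series h" by (rule kalgebra_power_series)
  show ?thesis using assms by (simp add: a_minus_def power_series_simps flip: smult_minus_one)
qed

definition monomial :: "exponent \<Rightarrow> exponent \<Rightarrow> 'k::field" where
  "monomial e = (\<lambda>a. if a = e then 1 else 0)"

lemma monomial_closed: "keys e \<subseteq> {1..h} \<Longrightarrow> monomial e \<in> carrier (power_series h)"
  by (simp add: power_series_simps monomial_def)

lemma indet_eq_monomial: "indet i = monomial (single i 1)"
  by (simp add: indet_def monomial_def)

lemma monomial_conv: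
  "monomial e \<otimes>\<^bsub>power_series h\<^esub> g = (\<lambda>a. if \<exists>c. a = e + c then g (a - e) else 0)"
  unfolding power_series_simps monomial_def by (rule ext, subst conv_monomial) simp

lemma monomial_mult: "monomial d \<otimes>\<^bsub>power_series h\<^esub> monomial e = monomial (d + e)"
  unfolding monomial_conv by (auto simp: monomial_def fun_eq_iff)

lemma indet_square: 
  assumes "1 \<le> j" "j \<le> h"
  shows "indet j [^]\<^bsub>power_series h :: ('k::field, _) module\<^esub> (2::nat) = monomial (single j 2)"
proof -
  interpret kalgebra "power_series h :: ('k, _) module" by (rule kalgebra_power_series)
  have "indet j \<in> carrier (power_series h :: ('k, _) module)" unfolding indet_eq_monomial
    by (rule monomial_closed) (use assms in simp)
  thus ?thesis 
    by (simp add: numeral_2_eq_2 indet_eq_monomial monomial_mult flip: single_add)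
qed

lemma power_series_keys: "f \<in> carrier (power_series h) \<Longrightarrow> f a \<noteq> 0 \<Longrightarrow> keys a \<subseteq> {1..h}"
  by (simp add: power_series_simps)

text \<open>
  A power series has infinitely many terms, while ideals are closed under finite sums only. If
  finitely many monomials \<open>e\<close> divide all terms, the terms can be collected as \<open>x\<^sup>e g\<close> with a
  single series \<open>g\<close> for each \<open>e\<close>, taking care that no term is collected twice.
\<close>

lemma mem_ideal_if_terms_divisible:
  assumes J: "ideal J (power_series h)" and "finite M"
    and M: "\<And>e. e \<in> M \<Longrightarrow> monomial e \<in> J"
    and f: "f \<in> carrier (power_series h)"
    and div: "\<And>a. f a \<noteq> 0 \<Longrightarrow> \<exists>e\<in>M. \<exists>c. a = e + c"
  shows "f \<in> J"
  using assms(2-)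
proof (induction M arbitrary: f)
  case empty
  hence "f = \<zero>\<^bsub>power_series h\<^esub>" by (auto simp: power_series_simps)
  thus ?case using kalgebra.ideal_zero_closed[OF kalgebra_power_series J] by simp
next
  case (insert e M)
  let ?R = "power_series h"
  define g where "g = (\<lambda>c. f (e + c))"
  define k where "k = (\<lambda>a. if \<exists>c. a = e + c then 0 else f a)"
  have g: "g \<in> carrier ?R" and k: "k \<in> carrier ?R"
    using insert.prems(2) power_series_keys[OF insert.prems(2), of "e + _"]
    by (auto simp add: g_def k_def power_series_simps(1) keys_add_exponent simp del: One_nat_def)
  have 1: "monomial e \<otimes>\<^bsub>?R\<^esub> g \<in> J"
    by (rule ideal.I_r_closed[OF J]) (use insert.prems(1) g in auto)
  have 2: "k \<in> J"
  proof (rule insert.IH)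
    fix a assume "k a \<noteq> 0"
    thus "\<exists>e\<in>M. \<exists>c. a = e + c" using insert.prems(3)[of a] by (auto simp: k_def split: if_splits)
  qed (use insert.prems(1) k in auto)
  have "f = (monomial e \<otimes>\<^bsub>?R\<^esub> g) \<oplus>\<^bsub>?R\<^esub> k"
    unfolding monomial_conv by (auto simp: power_series_simps(4) g_def k_def fun_eq_iff)
  thus ?case using kalgebra.ideal_add_closed[OF kalgebra_power_series J 1 2] by simp
qed

text \<open>
  For \<open>k = 4\<close> this brings the tail of a power series under finitely many monomials.
\<close>

lemma exponent_split_degree:
  assumes "k \<le> total_degree a"
  obtains e c where "a = e + c" "total_degree e = k"
proof -
  have "\<exists>e c. a = e + c \<and> total_degree e = k" using assms
  proof (induction k)
    case (Suc k)
    then obtain e c where ec: "a = e + c" "total_degree e = k" by auto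
    hence "c \<noteq> 0" using Suc.prems by auto
    then obtain i b where "c = single i 1 + b" by (rule exponent_nonzero_split)
    with ec show ?case
      by (intro exI[of _ "e + single i 1"] exI[of _ b]) (simp add: add.assoc)
  qed auto
  thus ?thesis using that by blast
qed

lemma low_exponents_add_iff:
  "a + b \<in> low_exponents h d \<longleftrightarrow>
     a \<in> low_exponents h d \<and> b \<in> low_exponents h d \<and> total_degree a + total_degree b \<le> d"
  by (auto simp: low_exponents_def keys_add_exponent)

text \<open>
  The functional \<open>f \<mapsto> \<Sum>\<^sub>a f(a) \<mu>(a)\<close> of a product, expanded in both factors. A pair of exponents
  whose sum leaves the range of summation contributes nothing, as \<open>\<mu>\<close> vanishes there.
\<close>

lemma moment_conv:
  assumes f: "f \<in> carrier (power_series h)" and g: "g \<in> carrier (power_series h)"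
    and \<mu>: "vanishes_above d \<mu>"
  shows "(\<Sum>a\<in>low_exponents h d. (f \<otimes>\<^bsub>power_series h\<^esub> g) a * \<mu> (a + b)) =
    (\<Sum>c\<in>low_exponents h d. f c * (\<Sum>e\<in>low_exponents h d. g e * \<mu> (e + (c + b))))"
proof -
  let ?L = "low_exponents h d"
  let ?t = "\<lambda>(c, e). f c * (g e * \<mu> (c + e + b))"
  have "(\<Sum>a\<in>?L. (f \<otimes>\<^bsub>power_series h\<^esub> g) a * \<mu> (a + b)) =
     (\<Sum>a\<in>?L. \<Sum>x\<in>{(c, e). c + e = a}. ?t x)"
    unfolding power_series_simps by (auto simp: sum_distrib_right case_prod_beta mult.assoc intro!: sum.cong)
  also have "\<dots> = (\<Sum>(a, x)\<in>(SIGMA a:?L. {(c, e). c + e = a}). ?t x)"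
    by (rule sum.Sigma) (auto simp: finite_splittings)
  also have "\<dots> = (\<Sum>x\<in>{x \<in> ?L \<times> ?L. fst x + snd x \<in> ?L}. ?t x)"
    by (rule sum.reindex_bij_witness[of _ "\<lambda>x. (fst x + snd x, x)" snd])
       (auto simp: low_exponents_add_iff)
  also have "\<dots> = (\<Sum>x\<in>?L \<times> ?L. ?t x)"
  proof (rule sum.mono_neutral_left)
    show "\<forall>x\<in>?L \<times> ?L - {x \<in> ?L \<times> ?L. fst x + snd x \<in> ?L}. ?t x = 0"
    proof
      fix x assume x: "x \<in> ?L \<times> ?L - {x \<in> ?L \<times> ?L. fst x + snd x \<in> ?L}"
      obtain c e where [simp]: "x = (c, e)" by (cases x)
      have "total_degree (c + e + b) > d" using x by (auto simp: low_exponents_add_iff)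
      thus "?t x = 0" using \<mu> by (simp add: vanishes_above_def)
    qed
  qed auto
  also have "\<dots> = (\<Sum>c\<in>?L. f c * (\<Sum>e\<in>?L. g e * \<mu> (e + (c + b))))"
    by (simp add: sum.cartesian_product[symmetric] sum_distrib_left add_ac)
  finally show ?thesis .
qed

lemma ideal_annihilator:
  assumes "vanishes_above d \<mu>"
  shows "ideal (annihilator h d \<mu>) (power_series h)"
proof -
  let ?R = "power_series h"
  interpret R: kalgebra ?R by (rule kalgebra_power_series)
  show ?thesis
  proof (rule R.idealI_closed)
    show "\<zero>\<^bsub>?R\<^esub> \<in> annihilator h d \<mu>"
      using R.zero_closed by (simp add: annihilator_def power_series_simps(2))
    show "f \<oplus>\<^bsub>?R\<^esub> g \<in> annihilator h d \<mu>" if "f \<in> annihilator h d \<mu>" "g \<in> annihilator h d \<mu>" for f g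
      using that R.a_closed[of f g]
      by (simp add: annihilator_def power_series_simps(4) distrib_right sum.distrib)
    show "f \<otimes>\<^bsub>?R\<^esub> g \<in> annihilator h d \<mu>" if "f \<in> carrier ?R" "g \<in> annihilator h d \<mu>" for f g
      using that R.m_closed[of f g] assms by (simp add: annihilator_def moment_conv)
  qed (auto simp: annihilator_def)
qed

lemma sum_monomial:
  assumes "finite S"
  shows "(\<Sum>a\<in>S. monomial e a * \<mu> a) = (if e \<in> S then \<mu> e else 0)"
  using assms by (simp add: monomial_def if_distrib[of "\<lambda>x. x * _"] cong: if_cong)

section \<open>The ideal of a cubic form as an annihilator\<close>

text \<open>
  The moments of \<open>F + y\<^sub>n\<^sub>+\<^sub>1\<^sup>2 + \<dots> + y\<^sub>h\<^sup>2\<close>: the entry \<open>2\<close> is the second derivative of a square.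
\<close>

definition cubic_moment :: "nat \<Rightarrow> nat \<Rightarrow> 'k::field_char_0 mpoly \<Rightarrow> exponent \<Rightarrow> 'k" where
  "cubic_moment h n F a = moment F a + (if \<exists>j\<in>{n+1..h}. a = single j 2 then 2 else 0)"

lemma moment_form:
  assumes "poly_form n d F" "moment F a \<noteq> 0"
  shows "keys a \<subseteq> {1..n}" "total_degree a = d"
  using assms by (auto simp: poly_form_def moment_def polynomials_def in_keys_iff)

lemma moment_form_eq_0:
  assumes "poly_form n d F" "\<not> keys a \<subseteq> {1..n} \<or> total_degree a \<noteq> d"
  shows "moment F a = 0"
  using moment_form[OF assms(1), of a] assms(2) by auto

lemma vanishes_above_moment: "poly_form n d F \<Longrightarrow> vanishes_above d (moment F)"
  by (auto simp: vanishes_above_def dest: moment_form(2))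

lemma vanishes_above_cubic_moment: "poly_form n 3 F \<Longrightarrow> vanishes_above 3 (cubic_moment h n F)"
  by (auto simp: vanishes_above_def cubic_moment_def dest: moment_form(2))

text \<open>
  By degree reasons \<open>\<sigma> \<circ> F\<close> is a constant, namely the sum on the right.
\<close>

lemma act_eq_1_iff:
  assumes F: "poly_form n d F" and \<sigma>: "series_form n d \<sigma>"
  shows "act \<sigma> F = 1 \<longleftrightarrow> (\<Sum>a\<in>low_exponents n d. \<sigma> a * moment F a) = 1"
proof -
  have l: "exponent_fact b * lookup (act \<sigma> F) b = (\<Sum>a\<in>low_exponents n d. \<sigma> a * moment F (a + b))" for b
    by (rule lookup_act) (use assms vanishes_above_moment in \<open>auto simp: series_form_def\<close>)
  have "(\<Sum>a\<in>low_exponents n d. \<sigma> a * moment F (a + b)) = 0" if "b \<noteq> 0" for b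
  proof (rule sum.neutral, rule ballI)
    fix a
    show "\<sigma> a * moment F (a + b) = 0"
      using \<sigma> that moment_form_eq_0[OF F, of "a + b"] by (cases "\<sigma> a = 0") (auto simp: series_form_def)
  qed
  hence b: "lookup (act \<sigma> F) b = 0" if "b \<noteq> 0" for b
    using l[of b] that by simp
  have "act \<sigma> F = 1 \<longleftrightarrow> lookup (act \<sigma> F) 0 = 1"
    using b by (auto intro!: poly_mapping_eqI simp: lookup_one when_def)
  thus ?thesis using l[of 0] by simp
qed

lemma exponent_sum_single_double:
  assumes "single i (1::nat) + single j 1 + b = single l 2"
  shows "i = j" "b = 0" "l = j"
proof -
  have eq: "(if i = k then 1 else 0) + (if j = k then 1 else 0) + lookup b k = (if l = k then 2 else 0)" for k
    using arg_cong[OF assms, of "\<lambda>e. lookup e k"] by (simp only: lookup_add lookup_single when_def)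
  show "i = j" "l = j" using eq[of i] eq[of j] by (auto split: if_splits)
  show "b = 0"
  proof (rule poly_mapping_eqI)
    fix k show "lookup b k = lookup 0 k"
      using eq[of k] \<open>i = j\<close> \<open>l = j\<close> by (auto split: if_splits)
  qed
qed

text \<open>
  If \<open>g\<close> had a nonzero constant term, the component of degree \<open>d\<close> of \<open>g \<circ> F\<close> would be a nonzero
  multiple of \<open>F\<close>.
\<close>

lemma constant_coeff_of_Ann:
  fixes F :: "'k::field_char_0 mpoly"
  assumes F: "poly_form n d F" "F \<noteq> 0" and g: "g \<in> Ann n F"
  shows "g 0 = 0"
proof -
  obtain b where b: "lookup F b \<noteq> 0" using F(2) by (metis poly_mapping_eqI lookup_zero)
  have mb: "moment F b \<noteq> 0" using b by (simp add: moment_def)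
  have db: "total_degree b = d" using moment_form(2)[OF F(1) mb] .
  have "0 = (\<Sum>a\<in>low_exponents n d. g a * moment F (a + b))"
    using g Ann_eq_annihilator[OF vanishes_above_moment[OF F(1)], of n] by (simp add: annihilator_def)
  also have "\<dots> = (\<Sum>a\<in>{0}. g a * moment F (a + b))"
  proof (rule sum.mono_neutral_right)
    show "\<forall>a\<in>low_exponents n d - {0}. g a * moment F (a + b) = 0"
      using db moment_form_eq_0[OF F(1)] by simp
  qed (simp_all add: low_exponents_def[of n d, THEN eqset_imp_iff])
  finally show ?thesis using mb by simp
qed

lemma single_one_add_one: "single j 1 + single j 1 = single j (2::nat)"
  unfolding single_add[symmetric] by (rule arg_cong[of _ _ "single j"]) simp

text \<open>
  The three kinds of generators kill \<open>G = F + y\<^sub>n\<^sub>+\<^sub>1\<^sup>2 + \<dots> + y\<^sub>h\<^sup>2\<close>: a series in \<open>Ann\<^sub>n(F)\<close> has no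
  constant term, so it also kills the squares; no monomial of \<open>G\<close> is divisible by \<open>y\<^sub>i y\<^sub>j\<close>; and
  \<open>x\<^sub>j\<^sup>2\<close> and \<open>2\<sigma>\<close> both send \<open>G\<close> to the constant \<open>2\<close>.
\<close>

lemma generators_in_annihilator:
  fixes F :: "'k::field_char_0 mpoly"
  assumes nh: "n < h" and F: "poly_form n 3 F" "F \<noteq> 0"
    and \<sigma>: "series_form n 3 \<sigma>" "(\<Sum>a\<in>low_exponents n 3. \<sigma> a * moment F a) = 1"
  shows "Ann n F \<subseteq> annihilator h 3 (cubic_moment h n F)"
    and "1 \<le> i \<Longrightarrow> i < j \<Longrightarrow> n + 1 \<le> j \<Longrightarrow> j \<le> h \<Longrightarrow>
       monomial (single i 1 + single j 1) \<in> annihilator h 3 (cubic_moment h n F)"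
    and "n + 1 \<le> j \<Longrightarrow> j \<le> h \<Longrightarrow>
       (\<lambda>a. monomial (single j 2) a - 2 * \<sigma> a) \<in> annihilator h 3 (cubic_moment h n F)"
proof -
  let ?cm = "cubic_moment h n F"
  have low_sub: "low_exponents n 3 \<subseteq> low_exponents h 3" using nh by (auto simp: low_exponents_def)
  have supp: "(\<Sum>a\<in>low_exponents h 3. g a * \<mu> a) = (\<Sum>a\<in>low_exponents n 3. g a * \<mu> a)"
    if g: "g \<in> carrier (power_series n)" for g \<mu> :: "exponent \<Rightarrow> 'k"
  proof (rule sum.mono_neutral_right[OF finite_low_exponents low_sub])
    show "\<forall>a\<in>low_exponents h 3 - low_exponents n 3. g a * \<mu> a = 0"
      using power_series_keys[OF g] by (auto simp: low_exponents_def)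
  qed
  have closed: "g \<in> carrier (power_series h)" if "g \<in> carrier (power_series n)" for g :: "exponent \<Rightarrow> 'k"
    using power_series_keys[OF that] nh by (fastforce simp: power_series_simps(1))
  show "Ann n F \<subseteq> annihilator h 3 ?cm"
  proof
    fix g assume g: "g \<in> Ann n F"
    have gn: "g \<in> carrier (power_series n)" using g by (simp add: Ann_def)
    have g0: "g 0 = 0" by (rule constant_coeff_of_Ann[OF F g])
    have "(\<Sum>a\<in>low_exponents h 3. g a * ?cm (a + b)) = 0" for b
    proof -
      have "g a * ?cm (a + b) = g a * moment F (a + b)" for a
      proof (cases "g a = 0")
        case False
        then obtain i where i: "i \<in> keys a" "i \<le> n"
          using g0 power_series_keys[OF gn False] by (metis atLeastAtMost_iff equals0I keys_eq_empty subsetD)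
        have "a + b \<noteq> single j 2" if "j \<in> {n+1..h}" for j
        proof
          assume "a + b = single j 2"
          hence "keys a \<union> keys b = {j}"
            by (metis keys_add_exponent keys_single zero_neq_numeral)
          hence "i = j" using i(1) by blast
        thus False using i(2) that by auto
        qed
        thus ?thesis by (auto simp: cubic_moment_def)
      qed simp
      hence "(\<Sum>a\<in>low_exponents h 3. g a * ?cm (a + b)) = (\<Sum>a\<in>low_exponents n 3. g a * moment F (a + b))"
        using supp[OF gn, of "\<lambda>a. moment F (a + b)"] by (simp only:)
      also have "\<dots> = 0"
        using g Ann_eq_annihilator[OF vanishes_above_moment[OF F(1)], of n] by (simp add: annihilator_def)
      finally show ?thesis .
    qed
    thus "g \<in> annihilator h 3 ?cm" using closed[OF gn] by (simp add: annihilator_def)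
  qed
  have out: "moment F a = 0" if "j \<in> keys a" "n + 1 \<le> j" for a j
    by (rule moment_form_eq_0[OF F(1)]) (use that in auto)
  show "monomial (single i 1 + single j 1) \<in> annihilator h 3 ?cm"
    if ij: "1 \<le> i" "i < j" "n + 1 \<le> j" "j \<le> h"
  proof -
    let ?e = "single i (1::nat) + single j 1"
    have "?cm (?e + b) = 0" for b
    proof -
      have "j \<in> keys (?e + b)" by (simp add: keys_add_exponent)
      moreover have "?e + b \<noteq> single l 2" for l
        using exponent_sum_single_double(1)[of i j b l] ij by auto
      ultimately show ?thesis using ij out by (auto simp: cubic_moment_def)
    qed
    moreover have "monomial ?e \<in> carrier (power_series h :: ('k, _) module)"
      by (rule monomial_closed) (use ij in \<open>auto simp: keys_add_exponent\<close>)
    ultimately show ?thesis by (simp add: annihilator_def sum_monomial)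
  qed
  show "(\<lambda>a. monomial (single j 2) a - 2 * \<sigma> a) \<in> annihilator h 3 ?cm"
    if j: "n + 1 \<le> j" "j \<le> h"
  proof -
    let ?e = "single j (2::nat)"
    let ?f = "\<lambda>a. monomial ?e a - 2 * \<sigma> a"
    have \<sigma>n: "\<sigma> \<in> carrier (power_series n)" using \<sigma>(1) by (simp add: series_form_def)
    have "?f \<in> carrier (power_series h)"
      using power_series_keys[OF closed[OF \<sigma>n]] monomial_closed[of ?e h] j
      by (auto simp: power_series_simps(1) monomial_def)
    moreover have "(\<Sum>a\<in>low_exponents h 3. ?f a * ?cm (a + b)) = 0" for b
    proof -
      have "?e \<in> low_exponents h 3" using j by (simp add: low_exponents_def)
      hence 1: "(\<Sum>a\<in>low_exponents h 3. monomial ?e a * ?cm (a + b)) = ?cm (?e + b)"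
        using sum_monomial[of "low_exponents h 3" ?e "\<lambda>a. ?cm (a + b)"] by simp
      have jk: "j \<in> keys (?e + b)" by (simp add: keys_add_exponent)
      have e0: "?cm (?e + b) = (if b = 0 then 2 else 0)"
      proof -
        have "b = 0" if "?e + b = single l 2" for l
          using exponent_sum_single_double(2)[of j j b l] that by (simp only: single_one_add_one)
        thus ?thesis using out[OF jk j(1)] j by (auto simp: cubic_moment_def)
      qed
      have s0: "(\<Sum>a\<in>low_exponents h 3. \<sigma> a * ?cm (a + b)) = (if b = 0 then 1 else 0)"
      proof (cases "b = 0")
        case True
        have "\<sigma> a * ?cm a = \<sigma> a * moment F a" for a
          using \<sigma>(1) by (auto simp: series_form_def cubic_moment_def)
        hence "(\<Sum>a\<in>low_exponents h 3. \<sigma> a * ?cm a) = 1"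
          by (simp only: supp[OF \<sigma>n, of "moment F"] \<sigma>(2))
        thus ?thesis using True by simp
      next
        case False
        have "\<sigma> a * ?cm (a + b) = 0" for a
        proof (cases "\<sigma> a = 0")
          case nz: False
          hence "total_degree a = 3" using \<sigma>(1) by (simp add: series_form_def)
          moreover have "total_degree b \<noteq> 0" using False by simp
          ultimately have "total_degree (a + b) > 3" unfolding total_degree_add by linarith
          thus ?thesis using vanishes_above_cubic_moment[OF F(1), of h] by (simp add: vanishes_above_def)
        qed simp
        thus ?thesis using False by (simp only: sum.neutral_const if_False)
      qed
      have "(\<Sum>a\<in>low_exponents h 3. ?f a * ?cm (a + b)) =
          (\<Sum>a\<in>low_exponents h 3. monomial ?e a * ?cm (a + b)) - 2 * (\<Sum>a\<in>low_exponents h 3. \<sigma> a * ?cm (a + b))"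
        by (simp add: left_diff_distrib sum_subtractf sum_distrib_left mult.assoc)
      thus ?thesis by (simp add: 1 e0 s0)
    qed
    ultimately show ?thesis by (simp add: annihilator_def)
  qed
qed

lemma series_form_closed:
  assumes "series_form n d \<sigma>" "n \<le> h"
  shows "\<sigma> \<in> carrier (power_series h)"
  using assms by (fastforce simp: series_form_def power_series_simps(1))

text \<open>
  Reduction to a normal form. The ideal \<open>J\<close> contains the monomials \<open>x\<^sub>i x\<^sub>j\<close> with \<open>i < j\<close>, \<open>n < j\<close>,
  the monomials of degree four in the first \<open>n\<close> variables, and also \<open>x\<^sub>j\<^sup>3\<close>, because
  \<open>x\<^sub>j\<^sup>3 = x\<^sub>j (x\<^sub>j\<^sup>2 - 2\<sigma>) + 2 x\<^sub>j \<sigma>\<close> and each term of \<open>x\<^sub>j \<sigma>\<close> is divisible by some \<open>x\<^sub>i x\<^sub>j\<close>. Modulo these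
  and \<open>x\<^sub>j\<^sup>2 - 2\<sigma>\<close>, an element of the annihilator becomes a series \<open>p'\<close> in the first \<open>n\<close> variables,
  since its coefficient at \<open>x\<^sub>j\<close> is zero. The equations that define the annihilator then say
  that \<open>p'\<close> kills \<open>F\<close>.
\<close>

lemma annihilator_subset_ideal:
  fixes F :: "'k::field_char_0 mpoly"
  assumes nh: "n < h" and F: "poly_form n 3 F"
    and \<sigma>: "series_form n 3 \<sigma>" "(\<Sum>a\<in>low_exponents n 3. \<sigma> a * moment F a) = 1"
    and J: "ideal J (power_series h)"
    and Ann: "Ann n F \<subseteq> J"
    and mixed: "\<And>i j. 1 \<le> i \<Longrightarrow> i < j \<Longrightarrow> n + 1 \<le> j \<Longrightarrow> j \<le> h \<Longrightarrow>
       monomial (single i 1 + single j 1) \<in> J"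
    and square: "\<And>j. n + 1 \<le> j \<Longrightarrow> j \<le> h \<Longrightarrow>
       (\<lambda>a. monomial (single j 2) a - 2 * \<sigma> a) \<in> J"
  shows "annihilator h 3 (cubic_moment h n F) \<subseteq> J"
proof
  let ?R = "power_series h :: ('k, exponent \<Rightarrow> 'k) module"
  interpret R: kalgebra ?R by (rule kalgebra_power_series)
  let ?cm = "cubic_moment h n F"
  define M1 where "M1 = (\<lambda>(i, j). single i (1::nat) + single j 1) `
      {(i, j). 1 \<le> i \<and> i < j \<and> n + 1 \<le> j \<and> j \<le> h}"
  define M2 where "M2 = (\<lambda>j. single j (3::nat)) ` {n+1..h}"
  define M3 where "M3 = {a \<in> low_exponents n 4. total_degree a = 4}"
  have "{(i, j). 1 \<le> i \<and> i < j \<and> n + 1 \<le> j \<and> j \<le> h} \<subseteq> {..h} \<times> {..h}" by auto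
  hence fin1: "finite M1" unfolding M1_def by (intro finite_imageI) (rule finite_subset, auto)
  have J1: "monomial e \<in> J" if "e \<in> M1" for e using that mixed by (auto simp: M1_def)
  have J3: "monomial e \<in> J" if e: "e \<in> M3" for e
  proof -
    have "monomial e \<in> carrier (power_series n :: ('k, _) module)"
      by (rule monomial_closed) (use e in \<open>simp add: M3_def low_exponents_def\<close>)
    moreover have "e \<notin> low_exponents n 3" using e by (simp add: M3_def low_exponents_def)
    ultimately have "monomial e \<in> annihilator n 3 (moment F)"
      by (simp add: annihilator_def sum_monomial)
    thus ?thesis using Ann Ann_eq_annihilator[OF vanishes_above_moment[OF F], of n] by blast
  qed
  have \<sigma>R: "\<sigma> \<in> carrier ?R" by (rule series_form_closed[OF \<sigma>(1)]) (use nh in simp)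
  have J2: "monomial e \<in> J" if eM: "e \<in> M2" for e
  proof -
    obtain j where j: "n + 1 \<le> j" "j \<le> h" and e: "e = single j 3"
      using eM by (auto simp: M2_def)
    let ?x = "monomial (single j 1) :: exponent \<Rightarrow> 'k"
    let ?q = "\<lambda>a. monomial (single j 2) a - 2 * \<sigma> a"
    have x: "?x \<in> carrier ?R" by (rule monomial_closed) (use j in auto)
    have 1: "?x \<otimes>\<^bsub>?R\<^esub> ?q \<in> J" by (rule ideal.I_l_closed[OF J square[OF j] x])
    have 2: "?x \<otimes>\<^bsub>?R\<^esub> \<sigma> \<in> J"
    proof (rule mem_ideal_if_terms_divisible[OF J fin1 J1])
      show "?x \<otimes>\<^bsub>?R\<^esub> \<sigma> \<in> carrier ?R" using x \<sigma>R by (rule R.m_closed)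
      fix a assume "(?x \<otimes>\<^bsub>?R\<^esub> \<sigma>) a \<noteq> 0"
      then obtain c where c: "a = single j 1 + c" "\<sigma> c \<noteq> 0"
        by (auto simp: monomial_conv split: if_splits)
      hence c': "total_degree c = 3" "keys c \<subseteq> {1..n}"
        using \<sigma>(1) by (auto simp: series_form_def power_series_simps(1) simp del: One_nat_def)
      hence "c \<noteq> 0" by auto
      then obtain i b where i: "i \<in> keys c" "c = single i 1 + b"
        by (rule exponent_nonzero_split)
      have "i \<in> {1..n}" using i(1) c'(2) by blast
      hence "single i (1::nat) + single j 1 \<in> M1"
        unfolding M1_def using j by (intro image_eqI[of _ _ "(i, j)"]) auto
      moreover have "a = single i 1 + single j 1 + b"
        using c(1) i(2) by (simp add: add_ac)
      ultimately show "\<exists>e\<in>M1. \<exists>c. a = e + c" by blast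
    qed
    have 3: "2 \<odot>\<^bsub>?R\<^esub> (?x \<otimes>\<^bsub>?R\<^esub> \<sigma>) \<in> J" by (rule R.ideal_smult_closed[OF J 2])
    have "monomial e = (?x \<otimes>\<^bsub>?R\<^esub> ?q) \<oplus>\<^bsub>?R\<^esub> (2 \<odot>\<^bsub>?R\<^esub> (?x \<otimes>\<^bsub>?R\<^esub> \<sigma>))"
    proof -
      have s3: "single j (3::nat) = single j 1 + single j 2"
        unfolding single_add[symmetric] by (rule arg_cong[of _ _ "single j"]) simp
      show ?thesis unfolding monomial_conv e s3
        by (auto simp: power_series_simps(4,6) monomial_def fun_eq_iff)
    qed
    thus ?thesis using R.ideal_add_closed[OF J 1 3] by simp
  qed
  fix f assume f: "f \<in> annihilator h 3 ?cm"
  have fR: "f \<in> carrier ?R" using f by (simp add: annihilator_def)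
  have ann: "(\<Sum>a\<in>low_exponents h 3. f a * ?cm (a + b)) = 0" for b
    using f by (simp add: annihilator_def)
  let ?D = "{n+1..h}"
  let ?s = "\<lambda>j. single j (2::nat)"
  \<comment> \<open>the contribution of the squares \<open>y\<^sub>j\<^sup>2\<close> to the defining equation at \<open>b\<close>\<close>
  have two: "(\<Sum>a\<in>low_exponents h 3. f a * (if \<exists>j\<in>?D. a + b = ?s j then 2 else 0)) =
     (if b = 0 then 2 * (\<Sum>j\<in>?D. f (?s j)) else 0)" if b: "b = 0 \<or> keys b \<inter> ?D = {}" for b
  proof (cases "b = 0")
    case True
    have inj: "inj_on ?s ?D" by (auto intro!: inj_onI dest: arg_cong[of _ _ keys])
    have "(\<Sum>a\<in>low_exponents h 3. f a * (if \<exists>j\<in>?D. a = ?s j then 2 else 0)) =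
       (\<Sum>a\<in>?s ` ?D. 2 * f a)"
      by (rule sum.mono_neutral_cong_right[OF finite_low_exponents]) (auto simp: low_exponents_def)
    also have "\<dots> = 2 * (\<Sum>j\<in>?D. f (?s j))" using inj by (simp add: sum.reindex sum_distrib_left)
    finally show ?thesis using True by simp
  next
    case False
    have "a + b \<noteq> ?s j" if "j \<in> ?D" for a j
    proof
      assume "a + b = ?s j"
      hence "keys a \<union> keys b = {j}"
        by (metis keys_add_exponent keys_single zero_neq_numeral)
      moreover have "keys b \<noteq> {}" using False by simp
      ultimately have "j \<in> keys b" by (metis Un_upper2 subset_singletonD singletonI)
      thus False using b False that by auto
    qed
    thus ?thesis using False by (auto intro!: sum.neutral)
  qed
  \<comment> \<open>at \<open>b = e\<^sub>j\<close> only the coefficient of \<open>x\<^sub>j\<close> meets a monomial of the dual polynomial\<close>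
  have lin: "f (single j 1) = 0" if j: "j \<in> ?D" for j
  proof -
    let ?e = "single j (1::nat)"
    have "f a * ?cm (a + ?e) = (if a = ?e then 2 * f ?e else 0)" for a
    proof -
      have "j \<in> keys (a + ?e)" by (simp add: keys_add_exponent)
      hence "moment F (a + ?e) = 0" using j by (intro moment_form_eq_0[OF F]) auto
      moreover have "a + ?e = ?s l \<longleftrightarrow> a = ?e \<and> l = j" for l
      proof
        assume l: "a + ?e = ?s l"
        have "keys a \<union> keys ?e = {l}"
          using l by (metis keys_add_exponent keys_single zero_neq_numeral)
        hence "l = j" by auto
        moreover have "?s j = ?e + ?e" by (simp only: single_one_add_one)
        ultimately show "a = ?e \<and> l = j" using l by simp
      qed (simp only: single_one_add_one)
      ultimately show ?thesis using j by (auto simp: cubic_moment_def)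
    qed
    moreover have "?e \<in> low_exponents h 3" using j by (auto simp: low_exponents_def)
    ultimately show ?thesis using ann[of ?e] by simp
  qed
  \<comment> \<open>\<open>p'\<close> is the normal form: low terms in the first \<open>n\<close> variables, and \<open>2\<sigma>\<close> for each \<open>x\<^sub>j\<^sup>2\<close>\<close>
  define S where "S = (\<Sum>j\<in>?D. f (?s j))"
  define p where "p = (\<lambda>a. if a \<in> low_exponents n 3 then f a else 0)"
  define p' where "p' = (\<lambda>a. p a + 2 * S * \<sigma> a)"
  have low_sub: "low_exponents n 3 \<subseteq> low_exponents h 3" using nh by (auto simp: low_exponents_def)
  have \<sigma>n: "\<sigma> \<in> carrier (power_series n)" using \<sigma>(1) by (simp add: series_form_def)
  have p'n: "p' \<in> carrier (power_series n)"
    using power_series_keys[OF \<sigma>n]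
    by (auto simp: power_series_simps(1) p'_def p_def low_exponents_def simp del: One_nat_def split: if_splits)
  have "(\<Sum>a\<in>low_exponents n 3. p' a * moment F (a + b)) = 0" for b
  proof (cases "b = 0 \<or> keys b \<inter> ?D = {}")
    case True
    have "0 = (\<Sum>a\<in>low_exponents h 3. f a * moment F (a + b)) +
       (\<Sum>a\<in>low_exponents h 3. f a * (if \<exists>j\<in>?D. a + b = ?s j then 2 else 0))"
      using ann[of b] unfolding cubic_moment_def by (simp add: distrib_left sum.distrib)
    also have "(\<Sum>a\<in>low_exponents h 3. f a * moment F (a + b)) = (\<Sum>a\<in>low_exponents n 3. p a * moment F (a + b))"
    proof (rule sum.mono_neutral_cong_right[OF finite_low_exponents low_sub])
      show "\<forall>a\<in>low_exponents h 3 - low_exponents n 3. f a * moment F (a + b) = 0"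
      proof
        fix a assume a: "a \<in> low_exponents h 3 - low_exponents n 3"
        hence "\<not> keys (a + b) \<subseteq> {1..n}" by (auto simp: low_exponents_def keys_add_exponent)
        thus "f a * moment F (a + b) = 0" using moment_form_eq_0[OF F, of "a + b"] by simp
      qed
    qed (simp add: p_def)
    also note two[OF True, folded S_def]
    finally have eq: "(\<Sum>a\<in>low_exponents n 3. p a * moment F (a + b)) + (if b = 0 then 2 * S else 0) = 0" by simp
    have "(\<Sum>a\<in>low_exponents n 3. \<sigma> a * moment F (a + b)) = (if b = 0 then 1 else 0)"
    proof (cases "b = 0")
      case False
      have "\<sigma> a * moment F (a + b) = 0" for a
        using \<sigma>(1) False moment_form_eq_0[OF F, of "a + b"]
        by (cases "\<sigma> a = 0") (auto simp: series_form_def)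
      thus ?thesis using False by (simp only: sum.neutral_const if_False)
    qed (use \<sigma>(2) in simp)
    moreover have "(\<Sum>a\<in>low_exponents n 3. p' a * moment F (a + b)) =
      (\<Sum>a\<in>low_exponents n 3. p a * moment F (a + b)) + 2 * S * (\<Sum>a\<in>low_exponents n 3. \<sigma> a * moment F (a + b))"
      by (simp add: p'_def distrib_right sum.distrib sum_distrib_left mult.assoc)
    ultimately show ?thesis using eq by (auto split: if_splits)
  next
    case False
    then obtain j where "j \<in> keys b \<inter> ?D" by blast
    hence "\<not> keys (a + b) \<subseteq> {1..n}" for a by (auto simp: keys_add_exponent)
    thus ?thesis using moment_form_eq_0[OF F] by simp
  qed
  hence "p' \<in> Ann n F"
    using p'n Ann_eq_annihilator[OF vanishes_above_moment[OF F], of n] by (simp add: annihilator_def)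
  hence p'J: "p' \<in> J" using Ann by blast
  define t where "t T = (\<lambda>a. \<Sum>j\<in>T. f (?s j) * (monomial (?s j) a - 2 * \<sigma> a))" for T
  have tJ: "t T \<in> J" if "finite T" "T \<subseteq> ?D" for T
    using that
  proof (induction T)
    case empty
    thus ?case using R.ideal_zero_closed[OF J] by (simp add: t_def power_series_simps)
  next
    case (insert j T)
    have "f (?s j) \<odot>\<^bsub>?R\<^esub> (\<lambda>a. monomial (?s j) a - 2 * \<sigma> a) \<oplus>\<^bsub>?R\<^esub> t T \<in> J"
      using insert square[of j] by (intro R.ideal_add_closed[OF J] R.ideal_smult_closed[OF J]) auto
    moreover have "t (insert j T) = f (?s j) \<odot>\<^bsub>?R\<^esub> (\<lambda>a. monomial (?s j) a - 2 * \<sigma> a) \<oplus>\<^bsub>?R\<^esub> t T"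
      using insert.hyps by (simp add: t_def power_series_simps)
    ultimately show ?case by simp
  qed
  \<comment> \<open>the remainder has only terms divisible by one of the monomials known to lie in \<open>J\<close>\<close>
  define r where "r = (\<lambda>a. f a - p' a - t ?D a)"
  have "r \<in> J"
  proof (rule mem_ideal_if_terms_divisible[OF J])
    show "finite (M1 \<union> M2 \<union> M3)" using fin1 by (simp add: M2_def M3_def)
    show "monomial e \<in> J" if "e \<in> M1 \<union> M2 \<union> M3" for e using that J1 J2 J3 by blast
    have tR: "t ?D \<in> carrier ?R" by (rule ideal.Icarr[OF J tJ]) auto
    have p'R: "p' \<in> carrier ?R" by (rule ideal.Icarr[OF J p'J])
    show "r \<in> carrier ?R"
      using R.minus_closed[OF R.minus_closed[OF fR p'R] tR] power_series_minus[OF fR p'R]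
        power_series_minus[OF R.minus_closed[OF fR p'R] tR] by (simp add: r_def)
  next
    fix a assume ra: "r a \<noteq> 0"
    have r_eq: "r a = f a - p a - (\<Sum>j\<in>?D. f (?s j) * monomial (?s j) a)"
      by (simp add: r_def p'_def t_def S_def right_diff_distrib sum_subtractf sum_distrib_left
          sum_distrib_right mult_ac)
    have ns: "a \<noteq> ?s l" if "l \<in> ?D" for l
    proof
      assume a: "a = ?s l"
      have "(\<Sum>j\<in>?D. f (?s j) * monomial (?s j) a) = (\<Sum>j\<in>?D. if j = l then f (?s l) else 0)"
        by (rule sum.cong) (auto simp: a monomial_def dest: arg_cong[of _ _ keys])
      hence "(\<Sum>j\<in>?D. f (?s j) * monomial (?s j) a) = f a" using that by (simp add: a)
      moreover have "p a = 0" using that by (simp add: p_def a low_exponents_def)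
      ultimately show False using ra r_eq by simp
    qed
    hence "(\<Sum>j\<in>?D. f (?s j) * monomial (?s j) a) = 0" by (auto intro!: sum.neutral simp: monomial_def)
    hence nl: "a \<notin> low_exponents n 3" and fa: "f a \<noteq> 0" using ra r_eq by (auto simp: p_def split: if_splits)
    have ah: "keys a \<subseteq> {1..h}" by (rule power_series_keys[OF fR fa])
    show "\<exists>e\<in>M1 \<union> M2 \<union> M3. \<exists>c. a = e + c"
    proof (cases "keys a \<subseteq> {1..n}")
      case True
      hence "4 \<le> total_degree a" using nl by (auto simp: low_exponents_def)
      then obtain e c where ec: "a = e + c" "total_degree e = 4" by (rule exponent_split_degree)
      hence "e \<in> M3" using True by (simp add: M3_def low_exponents_def keys_add_exponent)
      thus ?thesis using ec by blast
    next
      case False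
      then obtain j where j: "j \<in> keys a" "j \<in> ?D" using ah by fastforce
      then obtain b where b: "a = single j 1 + b"
        using exponent_split[of a j] by (auto simp: in_keys_iff)
      have "b \<noteq> 0" using b fa lin[OF j(2)] by auto
      show ?thesis
      proof (cases "keys b \<subseteq> {j}")
        case True
        hence "b = single j (lookup b j)"
          by (intro poly_mapping_eqI) (auto simp: lookup_single when_def in_keys_iff subset_iff)
        then obtain k where b': "b = single j k" by blast
        have a': "a = single j (1 + k)" unfolding b b' single_add ..
        have "k \<noteq> 0"
        proof
          assume "k = 0"
          thus False using \<open>b \<noteq> 0\<close> by (simp add: b')
        qed
        moreover have "k \<noteq> 1"
        proof
          assume "k = 1"
          hence "a = ?s j" by (simp only: a' one_add_one)
          thus False using ns j(2) by blast
        qed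
        ultimately have "1 + k = 3 + (k - 2)" by simp
        hence "a = single j 3 + single j (k - 2)"
          unfolding a' single_add[symmetric] by simp
        moreover have "single j 3 \<in> M2" using j(2) by (simp add: M2_def)
        ultimately show ?thesis by blast
      next
        case False
        then obtain i where i: "i \<in> keys b" "i \<noteq> j" by auto
        then obtain c where c: "b = single i 1 + c"
          using exponent_split[of b i] by (auto simp: in_keys_iff)
        have "i \<in> {1..h}" using ah b i(1) by (auto simp: keys_add_exponent)
        hence "(min i j, max i j) \<in> {(i, j). 1 \<le> i \<and> i < j \<and> n + 1 \<le> j \<and> j \<le> h}"
          using j(2) i(2) by auto
        hence "single (min i j) (1::nat) + single (max i j) 1 \<in> M1"
          unfolding M1_def by (rule image_eqI[rotated]) simp
        moreover have "single (min i j) (1::nat) + single (max i j) 1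
           = single i 1 + single j 1"
          by (cases "i \<le> j") (auto simp: min_def max_def add.commute)
        moreover have "a = single i 1 + single j 1 + c"
          using b c by (simp add: add_ac)
        ultimately show ?thesis by (metis UnI1)
      qed
    qed
  qed
  have "f = r \<oplus>\<^bsub>?R\<^esub> (p' \<oplus>\<^bsub>?R\<^esub> t ?D)" by (simp add: r_def power_series_simps)
  moreover have "r \<oplus>\<^bsub>?R\<^esub> (p' \<oplus>\<^bsub>?R\<^esub> t ?D) \<in> J"
    using \<open>r \<in> J\<close> p'J tJ[of ?D] by (intro R.ideal_add_closed[OF J]) auto
  ultimately show "f \<in> J" by simp
qed

text \<open>
  The right-hand side does not mention \<open>\<sigma>\<close>, and it covers the cases \<open>n < h\<close> and \<open>n = h\<close> alike.
\<close>

theorem cubic_ideal_eq_annihilator: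
  fixes F :: "'k::field_char_0 mpoly"
  assumes nh: "n \<le> h" and F: "poly_form n 3 F"
    and \<sigma>: "series_form n 3 \<sigma>" "act \<sigma> F = 1"
  shows "cubic_ideal h n F \<sigma> = annihilator h 3 (cubic_moment h n F)"
proof (cases "n < h")
  case False
  hence [simp]: "h = n" using nh by simp
  have "cubic_moment n n F = moment F" by (auto simp: cubic_moment_def fun_eq_iff)
  thus ?thesis using Ann_eq_annihilator[OF vanishes_above_moment[OF F], of n]
    by (simp add: cubic_ideal_def)
next
  case True
  let ?R = "power_series h :: ('k, exponent \<Rightarrow> 'k) module"
  interpret R: kalgebra ?R by (rule kalgebra_power_series)
  have \<sigma>1: "(\<Sum>a\<in>low_exponents n 3. \<sigma> a * moment F a) = 1" using \<sigma> act_eq_1_iff[OF F] by blast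
  have F0: "F \<noteq> 0"
  proof
    assume "F = 0"
    thus False using \<sigma>1 by (simp add: moment_def)
  qed
  note sub = generators_in_annihilator[OF True F F0 \<sigma>(1) \<sigma>1]
  let ?G = "{indet i \<otimes>\<^bsub>?R\<^esub> indet j | i j. 1 \<le> i \<and> i < j \<and> n + 1 \<le> j \<and> j \<le> h} \<union>
              {(indet j [^]\<^bsub>?R\<^esub> (2::nat)) \<ominus>\<^bsub>?R\<^esub> (2 \<odot>\<^bsub>?R\<^esub> \<sigma>) | j. n + 1 \<le> j \<and> j \<le> h}"
  let ?ann = "annihilator h 3 (cubic_moment h n F)"
  have ci: "cubic_ideal h n F \<sigma> = Idl\<^bsub>?R\<^esub> (Ann n F) <+>\<^bsub>?R\<^esub> Idl\<^bsub>?R\<^esub> ?G"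
    using True by (simp add: cubic_ideal_def Let_def)
  have idann: "ideal ?ann ?R" by (rule ideal_annihilator[OF vanishes_above_cubic_moment[OF F]])
  have mixed: "indet i \<otimes>\<^bsub>?R\<^esub> indet j = monomial (single i 1 + single j 1)" for i j
    by (simp only: indet_eq_monomial monomial_mult)
  have \<sigma>R: "\<sigma> \<in> carrier ?R" by (rule series_form_closed[OF \<sigma>(1) nh])
  have square: "(indet j [^]\<^bsub>?R\<^esub> (2::nat)) \<ominus>\<^bsub>?R\<^esub> (2 \<odot>\<^bsub>?R\<^esub> \<sigma>) =
     (\<lambda>a. monomial (single j 2) a - 2 * \<sigma> a)" if j: "n + 1 \<le> j" "j \<le> h" for j
  proof -
    have "monomial (single j 2) \<in> carrier ?R" by (rule monomial_closed) (use j in auto)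
    moreover have "indet j [^]\<^bsub>?R\<^esub> (2::nat) = monomial (single j 2)"
      by (rule indet_square) (use j in auto)
    moreover have "2 \<odot>\<^bsub>?R\<^esub> \<sigma> \<in> carrier ?R" using \<sigma>R by (rule R.smult_closed)
    ultimately show ?thesis by (simp add: power_series_minus power_series_simps(6))
  qed
  have Gann: "?G \<subseteq> ?ann" using sub(2,3) mixed square by auto
  have Gcarr: "?G \<subseteq> carrier ?R" using Gann ideal.Icarr[OF idann] by blast
  have Acarr: "Ann n F \<subseteq> carrier ?R" using sub(1) ideal.Icarr[OF idann] by blast
  have id1: "ideal (Idl\<^bsub>?R\<^esub> (Ann n F)) ?R" by (rule R.genideal_ideal[OF Acarr])
  have id2: "ideal (Idl\<^bsub>?R\<^esub> ?G) ?R" by (rule R.genideal_ideal[OF Gcarr])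
  have idJ: "ideal (cubic_ideal h n F \<sigma>) ?R" unfolding ci by (rule R.add_ideals[OF id1 id2])
  have mem: "x \<oplus>\<^bsub>?R\<^esub> y \<in> cubic_ideal h n F \<sigma>" if "x \<in> Idl\<^bsub>?R\<^esub> (Ann n F)" "y \<in> Idl\<^bsub>?R\<^esub> ?G" for x y
    unfolding ci set_add_def' using that by blast
  have mem1: "x \<in> cubic_ideal h n F \<sigma>" if "x \<in> Ann n F" for x
    using mem[OF subsetD[OF R.genideal_self[OF Acarr] that] R.ideal_zero_closed[OF id2]]
    unfolding R.r_zero[OF subsetD[OF Acarr that]] .
  have mem2: "x \<in> cubic_ideal h n F \<sigma>" if "x \<in> ?G" for x
    using mem[OF R.ideal_zero_closed[OF id1] subsetD[OF R.genideal_self[OF Gcarr] that]]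
    unfolding R.l_zero[OF subsetD[OF Gcarr that]] .
  show ?thesis
  proof
    show "cubic_ideal h n F \<sigma> \<subseteq> ?ann"
    proof
      fix x assume "x \<in> cubic_ideal h n F \<sigma>"
      then obtain y z where "x = y \<oplus>\<^bsub>?R\<^esub> z" "y \<in> Idl\<^bsub>?R\<^esub> (Ann n F)" "z \<in> Idl\<^bsub>?R\<^esub> ?G"
        unfolding ci set_add_def' by blast
      thus "x \<in> ?ann"
        using R.genideal_minimal[OF idann sub(1)] R.genideal_minimal[OF idann Gann]
          R.ideal_add_closed[OF idann, of y z] by blast
    qed
    show "?ann \<subseteq> cubic_ideal h n F \<sigma>"
    proof (rule annihilator_subset_ideal[OF True F \<sigma>(1) \<sigma>1 idJ])
      show "Ann n F \<subseteq> cubic_ideal h n F \<sigma>" using mem1 by blast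
      fix j assume j: "n + 1 \<le> j" "j \<le> h"
      show "(\<lambda>a. monomial (single j 2) a - 2 * \<sigma> a) \<in> cubic_ideal h n F \<sigma>"
        using j by (intro mem2) (auto simp: square[symmetric] simp del: One_nat_def)
      fix i assume "1 \<le> i" "i < j"
      thus "monomial (single i 1 + single j 1) \<in> cubic_ideal h n F \<sigma>"
        using j by (intro mem2) (auto simp: mixed[symmetric] simp del: One_nat_def)
    qed
  qed
qed

section \<open>Ideal powers, quotients and subspaces\<close>

context kalgebra
begin

lemma ideal_power_is_ideal:
  assumes "ideal m A"
  shows "ideal (ideal_power A m k) A"
proof (induction k)
  case (Suc k)
  thus ?case using ideal_prod_is_ideal[OF assms] by simp
qed (simp add: oneideal)

lemma carrier_quotient_algebra: "carrier (quotient_algebra A I) = (\<lambda>x. I +> x) ` carrier A"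
  by (auto simp: quotient_algebra_def ring.defs module.defs FactRing_def A_RCOSETS_def' )

lemma quotient_algebra_simps:
  assumes "ideal I A"
  shows "\<zero>\<^bsub>quotient_algebra A I\<^esub> = I" "\<one>\<^bsub>quotient_algebra A I\<^esub> = I +> \<one>"
    and "x \<in> carrier A \<Longrightarrow> y \<in> carrier A \<Longrightarrow> (I +> x) \<otimes>\<^bsub>quotient_algebra A I\<^esub> (I +> y) = I +> (x \<otimes> y)"
    and "x \<in> carrier A \<Longrightarrow> y \<in> carrier A \<Longrightarrow> (I +> x) \<oplus>\<^bsub>quotient_algebra A I\<^esub> (I +> y) = I +> (x \<oplus> y)"
  using ideal.rcoset_mult_add[OF assms, of x y] ideal.a_rcos_sum[OF assms, of x y]
  by (simp_all add: quotient_algebra_def ring.defs module.defs FactRing_def)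

text \<open>
  The union over the coset in the definition of the scalar multiplication is a union of equal
  sets.
\<close>

lemma quotient_algebra_smult:
  assumes I: "ideal I A" and x: "x \<in> carrier A"
  shows "c \<odot>\<^bsub>quotient_algebra A I\<^esub> (I +> x) = I +> (c \<odot> x)"
proof -
  interpret I: ideal I A by fact
  have "I +> (c \<odot> y) = I +> (c \<odot> x)" if y: "y \<in> I +> x" for y
  proof -
    obtain i where i: "i \<in> I" "y = i \<oplus> x" using y by (auto simp: a_r_coset_def')
    have iA: "i \<in> carrier A" using i(1) by (rule I.Icarr)
    have "c \<odot> y \<ominus> c \<odot> x = c \<odot> i"
      using iA x by (simp add: i(2) smult_add_right a_minus_def a_assoc r_neg)
    hence "c \<odot> y \<ominus> c \<odot> x \<in> I" using ideal_smult_closed[OF I i(1)] by simp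
    thus ?thesis using quotient_eq_iff_same_a_r_cos[OF I, of "c \<odot> y" "c \<odot> x"] iA x by (simp add: i(2))
  qed
  moreover have "x \<in> I +> x" using x by (rule I.a_rcos_self)
  moreover have "c \<odot>\<^bsub>quotient_algebra A I\<^esub> (I +> x) = (\<Union>y\<in>I +> x. I +> (c \<odot> y))"
    by (simp add: quotient_algebra_def ring.defs module.defs)
  ultimately show ?thesis by blast
qed

lemma vectorspace_subspace:
  assumes "W \<subseteq> carrier A" "\<zero> \<in> W" "\<And>x y. x \<in> W \<Longrightarrow> y \<in> W \<Longrightarrow> x \<oplus> y \<in> W"
    "\<And>c x. x \<in> W \<Longrightarrow> c \<odot> x \<in> W"
  shows "vectorspace ground (A\<lparr>carrier := W\<rparr>)"
proof (rule vs_criteria)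
  show "field (ground :: 'k ring)" ..
  show "\<forall>v\<in>carrier (A\<lparr>carrier := W\<rparr>). \<exists>neg_v\<in>carrier (A\<lparr>carrier := W\<rparr>). v \<oplus>\<^bsub>A\<lparr>carrier := W\<rparr>\<^esub> neg_v = \<zero>\<^bsub>A\<lparr>carrier := W\<rparr>\<^esub>"
  proof
    fix v assume "v \<in> carrier (A\<lparr>carrier := W\<rparr>)"
    hence v: "v \<in> W" "v \<in> carrier A" using assms(1) by auto
    have "v \<oplus> (- 1) \<odot> v = \<zero>" using v(2) by (simp add: smult_minus_one r_neg)
    thus "\<exists>neg_v\<in>carrier (A\<lparr>carrier := W\<rparr>). v \<oplus>\<^bsub>A\<lparr>carrier := W\<rparr>\<^esub> neg_v = \<zero>\<^bsub>A\<lparr>carrier := W\<rparr>\<^esub>"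
      by (intro bexI[of _ "(- 1) \<odot> v"]) (simp_all add: assms(4)[OF v(1)])
  qed
qed (use assms in \<open>auto simp: subset_iff a_ac smult_add_left smult_add_right smult_smult\<close>)

end

section \<open>Quotients by annihilators are Gorenstein\<close>

text \<open>
  Membership in the \<open>k\<close>-th power of the maximal ideal of the power series ring.
\<close>

definition order_ge :: "nat \<Rightarrow> (exponent \<Rightarrow> 'k::zero) \<Rightarrow> bool" where
  "order_ge k f \<longleftrightarrow> (\<forall>a. f a \<noteq> 0 \<longrightarrow> k \<le> total_degree a)"

lemma order_ge_conv:
  assumes "order_ge i f" "order_ge j g"
  shows "order_ge (i + j) (f \<otimes>\<^bsub>power_series h\<^esub> g)"
  unfolding order_ge_def
proof (intro allI impI)
  fix a assume "(f \<otimes>\<^bsub>power_series h\<^esub> g) a \<noteq> 0"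
  hence "\<exists>x\<in>{(b, c). b + c = a}. (case x of (b, c) \<Rightarrow> f b * g c) \<noteq> 0"
    unfolding power_series_simps by (meson sum.neutral)
  then obtain b c where "b + c = a" "f b \<noteq> 0" "g c \<noteq> 0" by auto
  thus "i + j \<le> total_degree a" using assms unfolding order_ge_def by (metis add_mono total_degree_add)
qed

lemma order_ge_annihilator:
  "f \<in> carrier (power_series h) \<Longrightarrow> order_ge (Suc d) f \<Longrightarrow> f \<in> annihilator h d \<mu>"
  by (auto simp: annihilator_def order_ge_def low_exponents_def intro!: sum.neutral)

text \<open>
  A surjection \<open>\<psi>\<close> from the power series ring whose kernel is an annihilator, with a monomial
  \<open>x\<^sup>e\<close> of top degree on which the functional does not vanish.
\<close>

locale presentation = kalgebra A for A :: "('k::field_char_0, 'a, 'c) module_scheme" (structure) +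
  fixes m :: "'a set" and h d :: nat and \<mu> :: "exponent \<Rightarrow> 'k" and \<psi> :: "(exponent \<Rightarrow> 'k) \<Rightarrow> 'a" and e :: exponent
  assumes maximal: "maximalideal m A"
    and hom: "\<psi> \<in> ring_hom (power_series h) A"
    and smult: "f \<in> carrier (power_series h) \<Longrightarrow> \<psi> (c \<odot>\<^bsub>power_series h\<^esub> f) = c \<odot> \<psi> f"
    and surj: "\<psi> ` carrier (power_series h) = carrier A"
    and kernel: "f \<in> carrier (power_series h) \<Longrightarrow> \<psi> f = \<zero> \<longleftrightarrow> f \<in> annihilator h d \<mu>"
    and vanish: "vanishes_above d \<mu>"
    and support: "\<mu> a \<noteq> 0 \<Longrightarrow> keys a \<subseteq> {1..h}"
    and top: "total_degree e = d" "\<mu> e \<noteq> 0" and d_pos: "d > 0"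
begin

abbreviation "R \<equiv> power_series h :: ('k, exponent \<Rightarrow> 'k) module"

sublocale R: kalgebra R by (rule kalgebra_power_series)

sublocale m: maximalideal m A by (rule maximal)

lemma m_ideal: "ideal m A" by (rule m.is_ideal)

lemma \<psi>_closed: "f \<in> carrier R \<Longrightarrow> \<psi> f \<in> carrier A"
  unfolding surj[symmetric] by (rule imageI)

lemma \<psi>_mult: "f \<in> carrier R \<Longrightarrow> g \<in> carrier R \<Longrightarrow> \<psi> (f \<otimes>\<^bsub>R\<^esub> g) = \<psi> f \<otimes> \<psi> g"
  by (rule ring_hom_mult[OF hom])

lemma \<psi>_add: "f \<in> carrier R \<Longrightarrow> g \<in> carrier R \<Longrightarrow> \<psi> (f \<oplus>\<^bsub>R\<^esub> g) = \<psi> f \<oplus> \<psi> g"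
  by (rule ring_hom_add[OF hom])

lemma \<psi>_one: "\<psi> \<one>\<^bsub>R\<^esub> = \<one>"
  by (rule ring_hom_one[OF hom])

lemma prime: "x \<in> carrier A \<Longrightarrow> y \<in> carrier A \<Longrightarrow> x \<otimes> y \<in> m \<Longrightarrow> x \<in> m \<or> y \<in> m"
  by (rule primeideal.I_prime[OF maximalideal_prime[OF maximal]])

text \<open>
  Squaring doubles the order, and a series of order greater than \<open>d\<close> is sent to zero. So the
  image is nilpotent, hence lies in the prime ideal \<open>m\<close>.
\<close>

lemma nilpotent_image:
  assumes "f \<in> carrier R" "order_ge (Suc k) f"
  shows "\<psi> f \<in> m"
  using assms
proof (induction "d - k" arbitrary: f k rule: less_induct)
  case less
  show ?case
  proof (cases "d \<le> k")
    case True
    hence "order_ge (Suc d) f" using less.prems(2) by (auto simp: order_ge_def)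
    hence "\<psi> f = \<zero>" using order_ge_annihilator less.prems(1) kernel by blast
    thus ?thesis using ideal_zero_closed[OF m_ideal] by simp
  next
    case False
    have "order_ge (Suc (Suc (2 * k))) (f \<otimes>\<^bsub>R\<^esub> f)"
      using order_ge_conv[OF less.prems(2) less.prems(2), of h] by (simp add: mult_2)
    hence "\<psi> (f \<otimes>\<^bsub>R\<^esub> f) \<in> m"
      using False less.prems(1) by (intro less.hyps[of "Suc (2 * k)"]) auto
    thus ?thesis using prime[of "\<psi> f" "\<psi> f"] \<psi>_mult \<psi>_closed less.prems(1) by auto
  qed
qed

lemma image_in_m_iff:
  assumes f: "f \<in> carrier R"
  shows "\<psi> f \<in> m \<longleftrightarrow> order_ge 1 f"
proof
  assume "order_ge 1 f"
  thus "\<psi> f \<in> m" by (rule nilpotent_image[OF f, of 0, folded One_nat_def])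
next
  assume fm: "\<psi> f \<in> m"
  let ?g = "f \<oplus>\<^bsub>R\<^esub> ((- f 0) \<odot>\<^bsub>R\<^esub> \<one>\<^bsub>R\<^esub>)"
  have g: "?g \<in> carrier R" using f by simp
  have "order_ge 1 ?g"
    by (auto simp: order_ge_def power_series_simps Suc_le_eq simp flip: neq0_conv split: if_splits)
  hence "\<psi> ?g \<in> m" by (rule nilpotent_image[OF g, of 0, folded One_nat_def])
  hence gm: "\<psi> f \<oplus> (- f 0) \<odot> \<one> \<in> m"
    using f by (simp add: \<psi>_add smult \<psi>_one)
  have "(\<psi> f \<oplus> (- f 0) \<odot> \<one>) \<oplus> (-1) \<odot> \<psi> f \<in> m"
    by (intro ideal_add_closed[OF m_ideal] ideal_smult_closed[OF m_ideal] gm fm)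
  moreover have "(\<psi> f \<oplus> (- f 0) \<odot> \<one>) \<oplus> (-1) \<odot> \<psi> f = (- f 0) \<odot> \<one>"
    using \<psi>_closed[OF f] by (simp add: smult_minus_one a_comm[of "\<psi> f"] a_assoc r_neg)
  ultimately have "(- f 0) \<odot> \<one> \<in> m" by simp
  have "f 0 = 0"
  proof (rule ccontr)
    assume "f 0 \<noteq> 0"
    have "(- 1 / f 0) \<odot> ((- f 0) \<odot> \<one>) \<in> m" by (rule ideal_smult_closed[OF m_ideal]) fact
    hence "\<one> \<in> m" using \<open>f 0 \<noteq> 0\<close> by (simp add: smult_smult)
    thus False using m.one_imp_carrier m.I_notcarr by blast
  qed
  thus "order_ge 1 f" by (auto simp: order_ge_def Suc_le_eq simp flip: neq0_conv)
qed

lemma ideal_power_order: "ideal_power A m k \<subseteq> \<psi> ` {f \<in> carrier R. order_ge k f}"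
proof (induction k)
  case 0
  show ?case using surj by (auto simp: order_ge_def)
next
  case (Suc k)
  show ?case
  proof
    fix x assume "x \<in> ideal_power A m (Suc k)"
    hence "x \<in> ideal_prod A m (ideal_power A m k)" by simp
    thus "x \<in> \<psi> ` {f \<in> carrier R. order_ge (Suc k) f}"
    proof (induction rule: ideal_prod.induct)
      case (prod i j)
      obtain f where f: "f \<in> carrier R" "i = \<psi> f" using prod(1) surj m.Icarr by blast
      obtain g where g: "g \<in> carrier R" "order_ge k g" "j = \<psi> g" using prod(2) Suc.IH by blast
      have "order_ge 1 f" using prod(1) f image_in_m_iff by blast
      hence "order_ge (Suc k) (f \<otimes>\<^bsub>R\<^esub> g)" using order_ge_conv[OF _ g(2), of 1 f h] by simp
      thus ?case using f g \<psi>_mult by (intro image_eqI[of _ _ "f \<otimes>\<^bsub>R\<^esub> g"]) auto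
    next
      case (sum s1 s2)
      then obtain f g where *: "f \<in> carrier R" "order_ge (Suc k) f" "s1 = \<psi> f"
         "g \<in> carrier R" "order_ge (Suc k) g" "s2 = \<psi> g" by blast
      have "order_ge (Suc k) (f \<oplus>\<^bsub>R\<^esub> g)"
        using *(2,5) by (auto simp: order_ge_def power_series_simps) (metis add.right_neutral)
      thus ?case using * \<psi>_add by (intro image_eqI[of _ _ "f \<oplus>\<^bsub>R\<^esub> g"]) auto
    qed
  qed
qed

lemma monomial_in_ideal_power:
  assumes "keys a \<subseteq> {1..h}" "total_degree a = k"
  shows "\<psi> (monomial a) \<in> ideal_power A m k"
  using assms
proof (induction k arbitrary: a)
  case 0
  thus ?case by (simp add: \<psi>_closed monomial_closed)
next
  case (Suc k)
  have "a \<noteq> 0" using Suc.prems(2) by auto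
  then obtain i b where i: "i \<in> keys a" and b: "a = single i 1 + b"
    by (rule exponent_nonzero_split)
  have keys: "keys (single i (1::nat)) \<subseteq> {1..h}" "keys b \<subseteq> {1..h}"
    using Suc.prems(1) by (auto simp: b keys_add_exponent simp del: One_nat_def)
  have "\<psi> (monomial b) \<in> ideal_power A m k" using Suc.prems(2) keys by (intro Suc.IH) (auto simp: b)
  moreover have "\<psi> (monomial (single i 1)) \<in> m"
    using image_in_m_iff[OF monomial_closed[OF keys(1)]] by (auto simp: order_ge_def monomial_def)
  ultimately have "\<psi> (monomial (single i 1)) \<otimes> \<psi> (monomial b) \<in> ideal_power A m (Suc k)"
    by (simp add: ideal_prod.prod)
  thus ?case using \<psi>_mult[OF monomial_closed[OF keys(1)] monomial_closed[OF keys(2)]]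
    unfolding monomial_mult b by simp
qed

lemma e_keys: "keys e \<subseteq> {1..h}"
  using support top(2) by blast

lemma pair_monomial_e: "(\<Sum>a\<in>low_exponents h d. monomial e a * \<mu> (a + b)) = (if b = 0 then \<mu> e else 0)"
proof -
  have "e \<in> low_exponents h d" using e_keys top by (simp add: low_exponents_def)
  moreover have "\<mu> (e + b) = 0" if "b \<noteq> 0"
  proof -
    have "total_degree b \<noteq> 0" using that by simp
    hence "total_degree (e + b) > d" unfolding total_degree_add using top(1) by linarith
    thus ?thesis using vanish by (simp add: vanishes_above_def)
  qed
  ultimately show ?thesis using sum_monomial[of "low_exponents h d" e "\<lambda>a. \<mu> (a + b)"] by simp
qed

lemma image_monomial_e: "\<psi> (monomial e) \<noteq> \<zero>"
proof
  assume "\<psi> (monomial e) = \<zero>"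
  hence "monomial e \<in> annihilator h d \<mu>" using kernel[OF monomial_closed[OF e_keys]] by simp
  hence "(\<Sum>a\<in>low_exponents h d. monomial e a * \<mu> (a + 0)) = 0" unfolding annihilator_def by blast
  thus False unfolding pair_monomial_e using top(2) by simp
qed

lemma has_socle_degree_d: "has_socle_degree A m d"
proof -
  have "\<psi> (monomial e) \<noteq> \<zero>" by (rule image_monomial_e)
  moreover have "\<psi> (monomial e) \<in> ideal_power A m d"
    by (rule monomial_in_ideal_power[OF e_keys top(1)])
  moreover have "ideal_power A m (Suc d) = {\<zero>}"
  proof
    show "ideal_power A m (Suc d) \<subseteq> {\<zero>}"
      using ideal_power_order[of "Suc d"] order_ge_annihilator kernel by blast
    show "{\<zero>} \<subseteq> ideal_power A m (Suc d)" using ideal_zero_closed[OF ideal_power_is_ideal[OF m_ideal]] by blast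
  qed
  ultimately show ?thesis unfolding has_socle_degree_def by blast
qed

definition \<tau> where "\<tau> = \<psi> (monomial e)"

text \<open>
  Let \<open>f\<close> represent a socle element. Then \<open>x\<^sub>i f\<close> lies in the kernel for every \<open>i\<close>, so \<open>f\<close> pairs to
  zero with each monomial \<open>x\<^sup>b\<close>, \<open>b \<noteq> 0\<close>. Subtracting the multiple of \<open>x\<^sup>e\<close> that has the same
  pairing with \<open>1\<close> leaves an element of the annihilator.
\<close>

lemma socle_eq: "socle A m = {c \<odot> \<tau> | c. True}"
proof (intro subset_antisym subsetI)
  have eR: "monomial e \<in> carrier R" by (rule monomial_closed[OF e_keys])
  have eord: "order_ge d (monomial e)" using top(1) by (auto simp: order_ge_def monomial_def)
  fix x
  { assume "x \<in> {c \<odot> \<tau> | c. True}"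
    then obtain c where x: "x = c \<odot> \<tau>" by blast
    have \<tau>: "\<tau> \<in> carrier A" unfolding \<tau>_def by (rule \<psi>_closed[OF eR])
    have "y \<otimes> x = \<zero>" if y: "y \<in> m" for y
    proof -
      obtain f where f: "f \<in> carrier R" "y = \<psi> f" using y surj m.Icarr by blast
      have "order_ge 1 f" using y f image_in_m_iff by blast
      hence "order_ge (Suc d) (f \<otimes>\<^bsub>R\<^esub> monomial e)" using order_ge_conv[OF _ eord, of 1 f h] by simp
      hence "\<psi> (f \<otimes>\<^bsub>R\<^esub> monomial e) = \<zero>"
        using kernel order_ge_annihilator R.m_closed[OF f(1) eR] by blast
      hence "y \<otimes> \<tau> = \<zero>" unfolding \<tau>_def f(2) using \<psi>_mult[OF f(1) eR] by simp
      thus ?thesis using \<tau> m.Icarr[OF y] by (simp add: x smult_mult_right)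
    qed
    thus "x \<in> socle A m" using \<tau> x by (simp add: socle_def) }
  { assume x: "x \<in> socle A m"
    then obtain f where f: "f \<in> carrier R" "x = \<psi> f" using surj unfolding socle_def by blast
    have pair0: "(\<Sum>a\<in>low_exponents h d. f a * \<mu> (a + b)) = 0" if bnz: "b \<noteq> 0" for b
    proof (cases "keys b \<subseteq> {1..h}")
      case True
      obtain i b' where i: "i \<in> keys b" and b: "b = single i 1 + b'"
        by (rule exponent_nonzero_split[OF bnz])
      have ih: "keys (single i (1::nat)) \<subseteq> {1..h}" using i True by auto
      let ?X = "monomial (single i 1)"
      have XR: "?X \<in> carrier R" by (rule monomial_closed[OF ih])
      have "\<psi> ?X \<in> m" using image_in_m_iff[OF XR] by (auto simp: order_ge_def monomial_def)
      hence "\<psi> ?X \<otimes> \<psi> f = \<zero>" using x f(2) by (simp add: socle_def)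
      hence "\<psi> (?X \<otimes>\<^bsub>R\<^esub> f) = \<zero>" using \<psi>_mult[OF XR f(1)] by simp
      hence "?X \<otimes>\<^bsub>R\<^esub> f \<in> annihilator h d \<mu>" using kernel[OF R.m_closed[OF XR f(1)]] by blast
      hence "(\<Sum>a\<in>low_exponents h d. (?X \<otimes>\<^bsub>R\<^esub> f) a * \<mu> (a + b')) = 0" by (simp add: annihilator_def)
      hence "(\<Sum>c\<in>low_exponents h d. ?X c * (\<Sum>a\<in>low_exponents h d. f a * \<mu> (a + (c + b')))) = 0"
        unfolding moment_conv[OF XR f(1) vanish] .
      moreover have "single i 1 \<in> low_exponents h d"
        using ih d_pos by (simp add: low_exponents_def)
      ultimately show ?thesis 
        using sum_monomial[of "low_exponents h d" "single i 1"
            "\<lambda>c. \<Sum>a\<in>low_exponents h d. f a * \<mu> (a + (c + b'))"]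
        by (simp add: b)
    next
      case False
      have "\<mu> (a + b) = 0" for a
        using support[of "a + b"] False by (auto simp: keys_add_exponent)
      thus ?thesis by simp
    qed
    \<comment> \<open>the multiple of \<open>x\<^sup>e\<close> with the same pairing with \<open>1\<close> as \<open>f\<close>\<close>
    define c where "c = (\<Sum>a\<in>low_exponents h d. f a * \<mu> a) / \<mu> e"
    let ?g = "f \<oplus>\<^bsub>R\<^esub> ((- c) \<odot>\<^bsub>R\<^esub> monomial e)"
    have gR: "?g \<in> carrier R" using f(1) eR by simp
    have "(\<Sum>a\<in>low_exponents h d. ?g a * \<mu> (a + b)) = 0" for b
    proof -
      have "(\<Sum>a\<in>low_exponents h d. ?g a * \<mu> (a + b)) =
         (\<Sum>a\<in>low_exponents h d. f a * \<mu> (a + b)) - c * (\<Sum>a\<in>low_exponents h d. monomial e a * \<mu> (a + b))"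
        unfolding power_series_simps by (simp add: algebra_simps sum.distrib sum_distrib_left sum_subtractf)
      thus ?thesis using pair0[of b] top(2) unfolding pair_monomial_e by (cases "b = 0") (simp_all add: c_def)
    qed
    hence "?g \<in> annihilator h d \<mu>" using gR by (simp add: annihilator_def)
    hence "\<psi> ?g = \<zero>" using kernel[OF gR] by blast
    hence z: "\<psi> f \<oplus> (- c) \<odot> \<tau> = \<zero>" using f(1) eR by (simp add: \<psi>_add smult \<tau>_def)
    have \<tau>: "\<tau> \<in> carrier A" unfolding \<tau>_def by (rule \<psi>_closed[OF eR])
    have "x = x \<oplus> ((- c) \<odot> \<tau> \<oplus> c \<odot> \<tau>)"
      using smult_add_left[OF \<tau>, of "- c" c] \<tau> \<psi>_closed[OF f(1)] f(2) by simp
    also have "\<dots> = (\<psi> f \<oplus> (- c) \<odot> \<tau>) \<oplus> c \<odot> \<tau>"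
      using \<tau> \<psi>_closed[OF f(1)] f(2) by (simp add: a_assoc)
    also have "\<dots> = c \<odot> \<tau>" using z \<tau> by simp
    finally show "x \<in> {c \<odot> \<tau> | c. True}" by blast }
qed

end

lemma (in kalgebra) dim_line:
  assumes t: "t \<in> carrier A" "t \<noteq> \<zero>"
  shows "vectorspace.dim ground (A\<lparr>carrier := {c \<odot> t | c. True}\<rparr>) = 1"
proof -
  define W where "W = range (\<lambda>c. c \<odot> t)"
  have W: "{c \<odot> t | c. True} = W" by (auto simp: W_def)
  have memW: "c \<odot> t \<in> W" for c by (auto simp: W_def)
  have zW: "\<zero> \<in> W" using memW[of 0] t(1) by simp
  have tW: "t \<in> W" using memW[of 1] t(1) by simp
  interpret V: vectorspace ground "A\<lparr>carrier := W\<rparr>"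
  proof (rule vectorspace_subspace)
    show "W \<subseteq> carrier A" using t(1) by (auto simp: W_def)
    show "x \<oplus> y \<in> W" if "x \<in> W" "y \<in> W" for x y
      using that smult_add_left[OF t(1), symmetric] memW by (auto simp: W_def)
    show "c \<odot> x \<in> W" if "x \<in> W" for c x
      using that smult_smult[OF t(1)] memW by (auto simp: W_def)
  qed (rule zW)
  have lin_comb: "V.lincomb a {t} = a t \<odot> t" for a
    unfolding V.lincomb_def using memW[of "a t"] tW by (subst V.M.finsum_insert) (auto simp: t(1) zW)
  have "V.span {t} = {V.lincomb a {t} | a. a \<in> {t} \<rightarrow> UNIV}"
    using V.finite_span[of "{t}"] tW by simp
  also have "\<dots> = W"
  proof (intro subset_antisym subsetI)
    fix x assume "x \<in> W"
    then obtain c where "x = (\<lambda>_. c) t \<odot> t" by (auto simp: W_def)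
    hence "x = V.lincomb (\<lambda>_. c) {t}" by (simp only: lin_comb)
    thus "x \<in> {V.lincomb a {t} | a. a \<in> {t} \<rightarrow> UNIV}" by blast
  qed (auto simp: lin_comb memW)
  finally have "V.span {t} = W" .
  thus ?thesis unfolding W using V.dim1I[of t] t(2) tW by simp
qed

lemma (in presentation) gorenstein_A: "gorenstein A m"
proof -
  have "\<tau> \<noteq> \<zero>" "\<tau> \<in> carrier A"
    unfolding \<tau>_def by (rule image_monomial_e, rule \<psi>_closed[OF monomial_closed[OF e_keys]])
  thus ?thesis unfolding gorenstein_def socle_eq by (intro dim_line)
qed

text \<open>
  The projection onto the quotient followed by the inverse of the isomorphism.
\<close>

lemma presentation_of_isomorphism:
  fixes A :: "('k::field_char_0, 'a, 'c) module_scheme"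
  assumes A: "kalgebra A" and max: "maximalideal m A"
    and iso: "algebra_isomorphic A (quotient_algebra (power_series h) (annihilator h d \<mu>))"
    and \<mu>: "vanishes_above d \<mu>" "\<And>a. \<mu> a \<noteq> 0 \<Longrightarrow> keys a \<subseteq> {1..h}"
    and e: "total_degree e = d" "\<mu> e \<noteq> 0" "d > 0"
  obtains \<psi> where "presentation A m h d \<mu> \<psi> e"
proof -
  interpret kalgebra A by fact
  let ?R = "power_series h :: ('k, exponent \<Rightarrow> 'k) module"
  let ?I = "annihilator h d \<mu>"
  let ?Q = "quotient_algebra ?R ?I"
  interpret R: kalgebra ?R by (rule kalgebra_power_series)
  have I: "ideal ?I ?R" by (rule ideal_annihilator[OF \<mu>(1)])
  note Q = R.quotient_algebra_simps[OF I] R.quotient_algebra_smult[OF I]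
  obtain \<phi> where \<phi>: "\<phi> \<in> ring_iso A ?Q"
    and \<phi>s: "\<And>c x. x \<in> carrier A \<Longrightarrow> \<phi> (c \<odot>\<^bsub>A\<^esub> x) = c \<odot>\<^bsub>?Q\<^esub> \<phi> x"
    using iso unfolding algebra_isomorphic_def by blast
  have bij: "bij_betw \<phi> (carrier A) (carrier ?Q)" and \<phi>h: "\<phi> \<in> ring_hom A ?Q"
    using \<phi> by (auto simp: ring_iso_def)
  have inj: "x = y" if "\<phi> x = \<phi> y" "x \<in> carrier A" "y \<in> carrier A" for x y
    using that bij by (auto simp: bij_betw_def inj_on_def)
  define \<psi> where "\<psi> f = inv_into (carrier A) \<phi> (?I +>\<^bsub>?R\<^esub> f)" for f
  have cQ: "?I +>\<^bsub>?R\<^esub> f \<in> \<phi> ` carrier A" if "f \<in> carrier ?R" for f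
    using bij that by (simp add: bij_betw_def R.carrier_quotient_algebra)
  have \<psi>c: "\<psi> f \<in> carrier A" if "f \<in> carrier ?R" for f
    unfolding \<psi>_def by (rule inv_into_into[OF cQ[OF that]])
  have \<phi>\<psi>: "\<phi> (\<psi> f) = ?I +>\<^bsub>?R\<^esub> f" if "f \<in> carrier ?R" for f
    unfolding \<psi>_def by (rule f_inv_into_f[OF cQ[OF that]])
  have mult: "\<psi> (f \<otimes>\<^bsub>?R\<^esub> g) = \<psi> f \<otimes>\<^bsub>A\<^esub> \<psi> g" if "f \<in> carrier ?R" "g \<in> carrier ?R" for f g
    by (rule inj) (simp_all add: that \<psi>c \<phi>\<psi> Q ring_hom_mult[OF \<phi>h])
  have add: "\<psi> (f \<oplus>\<^bsub>?R\<^esub> g) = \<psi> f \<oplus>\<^bsub>A\<^esub> \<psi> g" if "f \<in> carrier ?R" "g \<in> carrier ?R" for f g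
    by (rule inj) (simp_all add: that \<psi>c \<phi>\<psi> Q ring_hom_add[OF \<phi>h])
  have zero: "\<psi> \<zero>\<^bsub>?R\<^esub> = \<zero>\<^bsub>A\<^esub>"
    using add[of "\<zero>\<^bsub>?R\<^esub>" "\<zero>\<^bsub>?R\<^esub>"] \<psi>c[of "\<zero>\<^bsub>?R\<^esub>"] by (simp add: add.l_cancel_one')
  have "presentation A m h d \<mu> \<psi> e"
  proof (intro presentation.intro presentation_axioms.intro)
    show "\<psi> \<in> ring_hom ?R A"
    proof (rule ring_hom_memI)
      show "\<psi> \<one>\<^bsub>?R\<^esub> = \<one>\<^bsub>A\<^esub>"
        by (rule inj) (simp_all add: \<psi>c \<phi>\<psi> Q ring_hom_one[OF \<phi>h])
    qed (simp_all add: \<psi>c mult add)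
    show "\<psi> (c \<odot>\<^bsub>?R\<^esub> f) = c \<odot>\<^bsub>A\<^esub> \<psi> f" if "f \<in> carrier ?R" for c f
      by (rule inj) (simp_all add: that \<psi>c \<phi>\<psi> Q \<phi>s)
    show "\<psi> ` carrier ?R = carrier A"
    proof (intro subset_antisym subsetI)
      fix x assume x: "x \<in> carrier A"
      hence "\<phi> x \<in> carrier ?Q" by (rule ring_hom_closed[OF \<phi>h])
      then obtain f where f: "f \<in> carrier ?R" "\<phi> x = ?I +>\<^bsub>?R\<^esub> f"
        by (auto simp: R.carrier_quotient_algebra)
      have "x = \<psi> f" by (rule inj) (simp_all add: f x \<psi>c \<phi>\<psi>)
      thus "x \<in> \<psi> ` carrier ?R" using f(1) by blast
    qed (use \<psi>c in blast)
    show "\<psi> f = \<zero>\<^bsub>A\<^esub> \<longleftrightarrow> f \<in> ?I" if f: "f \<in> carrier ?R" for f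
    proof -
      have "\<psi> f = \<zero>\<^bsub>A\<^esub> \<longleftrightarrow> \<phi> (\<psi> f) = \<phi> (\<psi> \<zero>\<^bsub>?R\<^esub>)"
        using inj[of "\<psi> f" "\<psi> \<zero>\<^bsub>?R\<^esub>"] \<psi>c[OF f] \<psi>c[OF R.zero_closed] by (auto simp: zero)
      also have "\<dots> \<longleftrightarrow> ?I +>\<^bsub>?R\<^esub> f = ?I +>\<^bsub>?R\<^esub> \<zero>\<^bsub>?R\<^esub>"
        using f by (simp only: \<phi>\<psi> R.zero_closed)
      also have "\<dots> \<longleftrightarrow> f \<ominus>\<^bsub>?R\<^esub> \<zero>\<^bsub>?R\<^esub> \<in> ?I"
        by (rule R.quotient_eq_iff_same_a_r_cos[OF I f R.zero_closed, symmetric])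
      also have "f \<ominus>\<^bsub>?R\<^esub> \<zero>\<^bsub>?R\<^esub> = f" using f by (simp add: a_minus_def)
      finally show ?thesis .
    qed
  qed (fact assms)+
  thus ?thesis by (rule that)
qed

lemma support_cubic_moment:
  fixes F :: "'k::field_char_0 mpoly"
  assumes "poly_form n 3 F" "n \<le> h" "cubic_moment h n F a \<noteq> 0"
  shows "keys a \<subseteq> {1..h}"
proof (cases "moment F a = 0")
  case False
  hence "keys a \<subseteq> {1..n}" by (rule moment_form(1)[OF assms(1)])
  thus ?thesis using assms(2) by auto
next
  case True
  hence "\<exists>j\<in>{n+1..h}. a = single j 2"
    using assms(3) by (simp add: cubic_moment_def split: if_splits)
  thus ?thesis by auto
qed

text \<open>
  It suffices that \<open>F\<close> has one nonzero coefficient, which \<open>\<sigma> \<circ> F = 1\<close> guarantees: it provides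
  the monomial of top degree.
\<close>

theorem gorenstein_of_cubic_presentation:
  fixes A :: "('k::field_char_0, 'a, 'c) module_scheme"
  assumes A: "kalgebra A" and max: "maximalideal m A" and nh: "n \<le> h"
    and F: "poly_form n 3 F" and \<sigma>: "series_form n 3 \<sigma>" "act \<sigma> F = 1"
    and iso: "algebra_isomorphic A (quotient_algebra (power_series h) (cubic_ideal h n F \<sigma>))"
  shows "gorenstein A m \<and> has_socle_degree A m 3"
proof -
  have sum1: "(\<Sum>a\<in>low_exponents n 3. \<sigma> a * moment F a) = 1" using \<sigma> act_eq_1_iff[OF F] by blast
  obtain e where e: "moment F e \<noteq> 0"
  proof (rule ccontr)
    assume "\<not> thesis"
    hence "moment F a = 0" for a using that by blast
    thus False using sum1 by simp
  qed
  have deg: "total_degree e = 3" by (rule moment_form(2)[OF F e])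
  have "e \<noteq> single j 2" for j using deg by auto
  hence e': "cubic_moment h n F e \<noteq> 0" using e by (simp add: cubic_moment_def)
  obtain \<psi> where "presentation A m h 3 (cubic_moment h n F) \<psi> e"
    by (rule presentation_of_isomorphism[OF A max iso[unfolded cubic_ideal_eq_annihilator[OF nh F \<sigma>]]
        vanishes_above_cubic_moment[OF F] support_cubic_moment[OF F nh] deg e' zero_less_numeral])
  then interpret presentation A m h 3 "cubic_moment h n F" \<psi> e .
  show ?thesis using gorenstein_A has_socle_degree_d by blast
qed

section \<open>Dimension through families of vectors\<close>

text \<open>
  Combinations of families instead of sets. Repeated vectors are allowed, so that nothing has
  to be shown distinct before it is shown independent.
\<close>

definition lin_comb :: "('k::field, 'v, 'c) module_scheme \<Rightarrow> 'i set \<Rightarrow> ('i \<Rightarrow> 'k) \<Rightarrow> ('i \<Rightarrow> 'v) \<Rightarrow> 'v" where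
  "lin_comb V I c x = finsum V (\<lambda>i. c i \<odot>\<^bsub>V\<^esub> x i) I"

definition independent_family :: "('k::field, 'v, 'c) module_scheme \<Rightarrow> 'i set \<Rightarrow> ('i \<Rightarrow> 'v) \<Rightarrow> bool" where
  "independent_family V I x \<longleftrightarrow> (\<forall>c. lin_comb V I c x = \<zero>\<^bsub>V\<^esub> \<longrightarrow> (\<forall>i\<in>I. c i = 0))"

definition spanning_family :: "('k::field, 'v, 'c) module_scheme \<Rightarrow> 'i set \<Rightarrow> ('i \<Rightarrow> 'v) \<Rightarrow> bool" where
  "spanning_family V I x \<longleftrightarrow> (\<forall>v\<in>carrier V. \<exists>c. v = lin_comb V I c x)"

locale kvectorspace = vectorspace ground V for V :: "('k::field, 'v, 'c) module_scheme" (structure)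
begin

lemma scalar_closed: "x \<in> carrier V \<Longrightarrow> c \<odot> x \<in> carrier V"
  using smult_closed[of c x] by simp

lemma lin_comb_empty [simp]: "lin_comb V {} c x = \<zero>"
  by (simp add: lin_comb_def)

lemma lin_comb_insert:
  assumes "finite I" "i \<notin> I" "x \<in> insert i I \<rightarrow> carrier V"
  shows "lin_comb V (insert i I) c x = c i \<odot> x i \<oplus> lin_comb V I c x"
  unfolding lin_comb_def using assms by (intro M.finsum_insert) (auto intro: scalar_closed)

lemma lin_comb_closed: "x \<in> I \<rightarrow> carrier V \<Longrightarrow> lin_comb V I c x \<in> carrier V"
  unfolding lin_comb_def by (intro M.finsum_closed) (auto intro: scalar_closed)

lemma lin_comb_cong:
  assumes "x \<in> I \<rightarrow> carrier V" "\<And>i. i \<in> I \<Longrightarrow> c i = d i"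
  shows "lin_comb V I c x = lin_comb V I d x"
  unfolding lin_comb_def by (intro M.finsum_cong') (use assms in \<open>auto intro: scalar_closed\<close>)

lemma lin_comb_zero: 
  assumes "x \<in> I \<rightarrow> carrier V" "\<And>i. i \<in> I \<Longrightarrow> c i = 0"
  shows "lin_comb V I c x = \<zero>"
proof -
  have "lin_comb V I c x = finsum V (\<lambda>i. \<zero>) I"
    unfolding lin_comb_def by (rule M.finsum_cong') (use assms smult_l_null in auto)
  thus ?thesis by simp
qed

lemma lincomb_image_eq_lin_comb:
  assumes "inj_on x I" "x \<in> I \<rightarrow> carrier V"
  shows "lincomb a (x ` I) = lin_comb V I (\<lambda>i. a (x i)) x"
  unfolding lin_comb_def lincomb_def
  by (rule M.finsum_reindex) (use assms in \<open>auto intro: scalar_closed\<close>)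

lemma independent_family_inj:
  assumes I: "finite I" and x: "x \<in> I \<rightarrow> carrier V" and ind: "independent_family V I x"
  shows "inj_on x I"
proof (rule inj_onI, rule ccontr)
  fix i j assume ij: "i \<in> I" "j \<in> I" "x i = x j" "i \<noteq> j"
  let ?J = "I - {i, j}"
  let ?c = "\<lambda>k. if k = i then 1 else if k = j then -1 else (0::'k)"
  have I_eq: "I = insert i (insert j ?J)" using ij by auto
  have xi: "x i \<in> carrier V" using x ij by auto
  have "lin_comb V I ?c x = lin_comb V (insert i (insert j ?J)) ?c x" using I_eq by simp
  also have "\<dots> = ?c i \<odot> x i \<oplus> (?c j \<odot> x j \<oplus> lin_comb V ?J ?c x)"
    using I x ij by (subst lin_comb_insert, simp, simp, blast, subst lin_comb_insert) auto
  also have "lin_comb V ?J ?c x = \<zero>" using x by (intro lin_comb_zero) auto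
  also have "?c i \<odot> x i \<oplus> (?c j \<odot> x j \<oplus> \<zero>) = (1 + - 1) \<odot> x i"
    using ij(3,4) smult_l_distr[of 1 "-1" "x i"] xi scalar_closed[OF xi] by simp
  also have "\<dots> = \<zero>" using smult_l_null[OF xi] by simp
  finally have "lin_comb V I ?c x = \<zero>" .
  hence "?c i = 0" using ind ij(1) unfolding independent_family_def by blast
  thus False by simp
qed

lemma lin_indpt_image:
  assumes I: "finite I" and x: "x \<in> I \<rightarrow> carrier V" and ind: "independent_family V I x"
  shows "lin_indpt (x ` I)"
proof (rule finite_lin_indpt2)
  show "finite (x ` I)" "x ` I \<subseteq> carrier V" using I x by auto
  fix a assume "lincomb a (x ` I) = \<zero>"
  hence "lin_comb V I (\<lambda>i. a (x i)) x = \<zero>"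
    using lincomb_image_eq_lin_comb[OF independent_family_inj[OF assms] x] by simp
  thus "\<forall>v\<in>x ` I. a v = \<zero>\<^bsub>ground\<^esub>" using ind unfolding independent_family_def by auto
qed

lemma independent_family_card_le:
  assumes "fin_dim" "finite I" "x \<in> I \<rightarrow> carrier V" "independent_family V I x"
  shows "card I \<le> dim"
  using li_le_dim(2)[OF assms(1) _ lin_indpt_image[OF assms(2-)]] assms(3)
    card_image[OF independent_family_inj[OF assms(2-)]] by auto

lemma dim_eq_card_family:
  assumes I: "finite I" and x: "x \<in> I \<rightarrow> carrier V" and ind: "independent_family V I x"
    and span: "spanning_family V I x"
  shows "dim = card I"
proof -
  have inj: "inj_on x I" by (rule independent_family_inj[OF I x ind])
  have "span (x ` I) = carrier V"
  proof (intro subset_antisym subsetI)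
    fix v assume "v \<in> carrier V"
    then obtain c where c: "v = lin_comb V I c x" using span unfolding spanning_family_def by blast
    have "v = lincomb (\<lambda>u. c (the_inv_into I x u)) (x ` I)"
      unfolding c lincomb_image_eq_lin_comb[OF inj x]
      by (rule lin_comb_cong[OF x]) (simp add: the_inv_into_f_f[OF inj])
    moreover have "finite (x ` I)" using I by simp
    ultimately show "v \<in> span (x ` I)" unfolding span_def by auto
  next
    fix v assume "v \<in> span (x ` I)"
    thus "v \<in> carrier V" using x by (intro span_closed[of "x ` I"]) auto
  qed
  hence "basis (x ` I)" using lin_indpt_image[OF I x ind] x by (auto simp: basis_def)
  thus ?thesis using dim_basis[of "x ` I"] I card_image[OF inj] by simp
qed

lemma basis_family_exists:
  assumes fin_dim
  obtains x where "x \<in> {1..dim} \<rightarrow> carrier V" "independent_family V {1..dim} x" "spanning_family V {1..dim} x"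
proof -
  obtain B where B: "finite B" "basis B" using finite_basis_exists[OF assms] by blast
  have d: "dim = card B" by (rule dim_basis[OF B])
  obtain x where bij: "bij_betw x {1..dim} B"
    unfolding d using ex_bij_betw_nat_finite_1[OF B(1)] by blast
  have inj: "inj_on x {1..dim}" and im: "x ` {1..dim} = B" using bij by (auto simp: bij_betw_def)
  have BV: "B \<subseteq> carrier V" and li: "lin_indpt B" and gen: "span B = carrier V"
    using B(2) by (auto simp: basis_def)
  have x: "x \<in> {1..dim} \<rightarrow> carrier V" using im BV by auto
  have lin_comb: "lincomb a B = lin_comb V {1..dim} (\<lambda>i. a (x i)) x" for a
    using lincomb_image_eq_lin_comb[OF inj x] im by simp
  show ?thesis
  proof (rule that[OF x])
    show "independent_family V {1..dim} x" unfolding independent_family_def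
    proof (intro allI impI ballI)
      fix c i assume c: "lin_comb V {1..dim} c x = \<zero>" and i: "i \<in> {1..dim}"
      let ?a = "\<lambda>u. c (the_inv_into {1..dim} x u)"
      have "lincomb ?a B = lin_comb V {1..dim} c x"
        unfolding lin_comb by (rule lin_comb_cong[OF x]) (simp only: the_inv_into_f_f[OF inj])
      hence "lincomb ?a B = \<zero>" using c by simp
      hence "?a (x i) = 0"
        using li B(1) i im unfolding lin_dep_def by (metis (no_types, lifting) Pi_I UNIV_I ground_simps(1,2) imageI subset_refl)
      thus "c i = 0" using i by (simp only: the_inv_into_f_f[OF inj])
    qed
    show "spanning_family V {1..dim} x" unfolding spanning_family_def
    proof
      fix v assume "v \<in> carrier V"
      then obtain a where "v = lincomb a B"
        using finite_in_span[OF B(1) BV] gen by blast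
      thus "\<exists>c. v = lin_comb V {1..dim} c x" using lin_comb by blast
    qed
  qed
qed

text \<open>
  An independent set of the largest possible size spans, as any vector outside its span could
  be added to it.
\<close>

lemma fin_dim_if_bounded:
  assumes "\<And>T. finite T \<Longrightarrow> T \<subseteq> carrier V \<Longrightarrow> lin_indpt T \<Longrightarrow> card T \<le> N"
  shows fin_dim
proof -
  let ?P = "\<lambda>n. \<exists>T. finite T \<and> T \<subseteq> carrier V \<and> lin_indpt T \<and> card T = n"
  have P0: "?P 0"
    by (rule exI[of _ "{}"]) (auto simp: lin_dep_def)
  have bound: "n \<le> N" if "?P n" for n using that assms by auto
  obtain T where T: "finite T" "T \<subseteq> carrier V" "lin_indpt T" "card T = (GREATEST n. ?P n)"
    using GreatestI_nat[of ?P 0 N, OF P0] bound by blast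
  have "span T = carrier V"
  proof (rule ccontr)
    assume "span T \<noteq> carrier V"
    then obtain v where v: "v \<in> carrier V" "v \<notin> span T" using span_closed[OF T(2)] by blast
    hence "lin_indpt (T \<union> {v})" using lin_dep_iff_in_span[OF T(2,3) v(1)] in_own_span[OF T(2)] by blast
    moreover have "v \<notin> T" using v(2) in_own_span[OF T(2)] by blast
    ultimately have "?P (Suc (card T))" using T v by (intro exI[of _ "T \<union> {v}"]) auto
    hence "Suc (card T) \<le> (GREATEST n. ?P n)" by (rule Greatest_le_nat) (use bound in blast)
    thus False using T(4) by simp
  qed
  thus ?thesis using T unfolding fin_dim_def by blast
qed

end

context kalgebra
begin

lemma kvectorspace_A: "kvectorspace A"
proof -
  have "vectorspace ground (A\<lparr>carrier := carrier A\<rparr>)"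
    by (rule vectorspace_subspace) auto
  thus ?thesis by (simp add: kvectorspace_def)
qed

lemma lin_comb_subspace:
  assumes S: "S \<subseteq> carrier A" "\<zero> \<in> S" "\<And>u v. u \<in> S \<Longrightarrow> v \<in> S \<Longrightarrow> u \<oplus> v \<in> S" "\<And>c u. u \<in> S \<Longrightarrow> c \<odot> u \<in> S"
    and x: "x \<in> I \<rightarrow> S"
  shows "lin_comb A I c x \<in> S"
proof (cases "finite I")
  case True
  interpret V: kvectorspace A by (rule kvectorspace_A)
  show ?thesis using True x
  proof (induction I)
    case empty
    show ?case using S(2) by simp
  next
    case (insert i I)
    have "lin_comb A (insert i I) c x = c i \<odot> x i \<oplus> lin_comb A I c x"
      using insert S(1) by (intro V.lin_comb_insert) auto
    thus ?case using insert S(3,4) by auto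
  qed
next
  case False
  thus ?thesis using S(2) by (simp add: lin_comb_def finsum_infinite)
qed

lemma ideal_subset: "ideal J A \<Longrightarrow> J \<subseteq> carrier A"
  by (rule subsetI) (rule ideal.Icarr)

lemma lin_comb_ideal:
  assumes J: "ideal J A" and x: "x \<in> I \<rightarrow> J"
  shows "lin_comb A I c x \<in> J"
  by (rule lin_comb_subspace[OF ideal_subset[OF J] ideal_zero_closed[OF J] ideal_add_closed[OF J]
        ideal_smult_closed[OF J] x])

definition linear_functional :: "('a \<Rightarrow> 'k) \<Rightarrow> bool" where
  "linear_functional l \<longleftrightarrow>
     (\<forall>x\<in>carrier A. \<forall>y\<in>carrier A. l (x \<oplus> y) = l x + l y) \<and> (\<forall>c. \<forall>x\<in>carrier A. l (c \<odot> x) = c * l x)"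

lemma
  assumes "linear_functional l" "x \<in> carrier A"
  shows functional_add: "y \<in> carrier A \<Longrightarrow> l (x \<oplus> y) = l x + l y"
    and functional_smult: "l (c \<odot> x) = c * l x"
  using assms by (auto simp: linear_functional_def)

lemma functional_zero: "linear_functional l \<Longrightarrow> l \<zero> = 0"
  using functional_smult[of l \<zero> 0] by simp

lemma functional_lin_comb:
  assumes l: "linear_functional l" and x: "x \<in> I \<rightarrow> carrier A"
  shows "l (lin_comb A I c x) = (\<Sum>i\<in>I. c i * l (x i))"
proof -
  interpret V: kvectorspace A by (rule kvectorspace_A)
  show ?thesis
  proof (cases "finite I")
    case True
    thus ?thesis using x
    proof (induction I)
      case empty
      thus ?case using functional_zero[OF l] by simp
    next
      case (insert i I)
      have xi: "x i \<in> carrier A" and xI: "x \<in> I \<rightarrow> carrier A" using insert.prems by auto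
      have "l (lin_comb A (insert i I) c x) = l (c i \<odot> x i \<oplus> lin_comb A I c x)"
        using insert V.lin_comb_insert[of I i x c] by simp
      also have "\<dots> = c i * l (x i) + l (lin_comb A I c x)"
        using functional_add[OF l smult_closed[OF xi] V.lin_comb_closed[OF xI]] functional_smult[OF l xi] by simp
      finally show ?case using insert.hyps insert.IH[OF xI] by simp
    qed
  next
    case False
    thus ?thesis using functional_zero[OF l] by (simp add: lin_comb_def finsum_infinite)
  qed
qed

lemma functional_mult:
  assumes l: "linear_functional l" and y: "y \<in> carrier A"
  shows "linear_functional (\<lambda>a. l (y \<otimes> a))"
  unfolding linear_functional_def
  using y by (auto simp: r_distr smult_mult_right functional_add[OF l] functional_smult[OF l])

lemma functional_mult_lin_comb:
  assumes "linear_functional l" "y \<in> carrier A" "x \<in> I \<rightarrow> carrier A"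
  shows "l (y \<otimes> lin_comb A I c x) = (\<Sum>i\<in>I. c i * l (y \<otimes> x i))"
  using functional_lin_comb[OF functional_mult[OF assms(1,2)] assms(3)] .

text \<open>
  Independent functionals have a dual family of vectors. In the inductive step, the new
  functional is not a combination of the old ones, so some \<open>y\<close> detects the difference
  \<open>g = f\<^sub>k - \<Sum>\<^sub>j f\<^sub>k(x\<^sub>j) f\<^sub>j\<close>. Removing the components of \<open>y\<close> along the old dual vectors gives the new
  dual vector \<open>u\<close>, and then the old ones are corrected by multiples of \<open>u\<close>.
\<close>

lemma dual_family_exists:
  assumes J: "ideal J A" and "finite N"
    and "\<And>j. j \<in> N \<Longrightarrow> linear_functional (f j)"
    and "\<And>c. (\<And>a. a \<in> J \<Longrightarrow> (\<Sum>j\<in>N. c j * f j a) = 0) \<Longrightarrow> \<forall>j\<in>N. c j = 0"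
  shows "\<exists>x. x \<in> N \<rightarrow> J \<and> (\<forall>i\<in>N. \<forall>j\<in>N. f j (x i) = (if i = j then 1 else 0))"
  using assms(2-)
proof (induction N)
  case empty
  show ?case by simp
next
  case (insert k N)
  interpret V: kvectorspace A by (rule kvectorspace_A)
  have lin: "linear_functional (f j)" if "j \<in> insert k N" for j using insert.prems(1) that .
  have "\<exists>x. x \<in> N \<rightarrow> J \<and> (\<forall>i\<in>N. \<forall>j\<in>N. f j (x i) = (if i = j then 1 else 0))"
  proof (rule insert.IH)
    fix c assume c: "\<And>a. a \<in> J \<Longrightarrow> (\<Sum>j\<in>N. c j * f j a) = 0"
    let ?c = "c(k := 0)"
    have "(\<Sum>j\<in>insert k N. ?c j * f j a) = (\<Sum>j\<in>N. c j * f j a)" for a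
      using insert.hyps by (simp, intro sum.cong) auto
    hence "\<forall>j\<in>insert k N. ?c j = 0" using c by (intro insert.prems(2)) simp
    thus "\<forall>j\<in>N. c j = 0" using insert.hyps by (auto split: if_splits)
  qed (use lin in auto)
  then obtain x where x: "x \<in> N \<rightarrow> J" "\<And>i j. i \<in> N \<Longrightarrow> j \<in> N \<Longrightarrow> f j (x i) = (if i = j then 1 else 0)" by blast
  have xA: "x \<in> N \<rightarrow> carrier A" using x(1) ideal.Icarr[OF J] by blast
  let ?g = "\<lambda>a. f k a - (\<Sum>j\<in>N. f k (x j) * f j a)"
  have "\<exists>y\<in>J. ?g y \<noteq> 0"
  proof (rule ccontr)
    assume "\<not> ?thesis"
    hence g0: "?g y = 0" if "y \<in> J" for y using that by blast
    let ?c = "\<lambda>j. if j = k then 1 else - f k (x j)"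
    have "(\<Sum>j\<in>insert k N. ?c j * f j a) = ?g a" for a
    proof -
      have "(\<Sum>j\<in>N. ?c j * f j a) = (\<Sum>j\<in>N. - (f k (x j) * f j a))"
        using insert.hyps by (intro sum.cong) auto
      thus ?thesis using insert.hyps by (simp add: sum_negf)
    qed
    hence "\<forall>j\<in>insert k N. ?c j = 0" using g0 by (intro insert.prems(2)) simp
    thus False by auto
  qed
  then obtain y where y: "y \<in> J" "?g y \<noteq> 0" by blast
  have yA: "y \<in> carrier A" using y(1) ideal.Icarr[OF J] by blast
  define u where "u = (1 / ?g y) \<odot> (y \<oplus> lin_comb A N (\<lambda>j. - f j y) x)"
  have s: "y \<oplus> lin_comb A N (\<lambda>j. - f j y) x \<in> carrier A" using yA V.lin_comb_closed[OF xA] by simp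
  have uJ: "u \<in> J" unfolding u_def
    by (intro ideal_smult_closed[OF J] ideal_add_closed[OF J] y(1) lin_comb_ideal[OF J x(1)])
  have fu: "f j u = (1 / ?g y) * (f j y - (\<Sum>i\<in>N. f i y * f j (x i)))" if "j \<in> insert k N" for j
    using functional_smult[OF lin[OF that] s] functional_add[OF lin[OF that] yA V.lin_comb_closed[OF xA]]
      functional_lin_comb[OF lin[OF that] xA] by (simp add: u_def sum_negf)
  have fuj: "f j u = 0" if "j \<in> N" for j
  proof -
    have "(\<Sum>i\<in>N. f i y * f j (x i)) = (\<Sum>i\<in>N. if i = j then f j y else 0)"
      using that x(2) by (intro sum.cong) auto
    thus ?thesis using fu[of j] that insert.hyps(1) by simp
  qed
  have fuk: "f k u = 1" using fu[of k] y(2) by (simp add: mult.commute)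
  define x' where "x' = (\<lambda>i. if i = k then u else x i \<oplus> (- f k (x i)) \<odot> u)"
  have uA: "u \<in> carrier A" using uJ ideal.Icarr[OF J] by blast
  show ?case
  proof (intro exI[of _ x'] conjI ballI)
    show "x' \<in> insert k N \<rightarrow> J"
      using x(1) uJ by (auto simp: x'_def intro!: ideal_add_closed[OF J] ideal_smult_closed[OF J])
    fix i j assume i: "i \<in> insert k N" and j: "j \<in> insert k N"
    show "f j (x' i) = (if i = j then 1 else 0)"
    proof (cases "i = k")
      case True
      thus ?thesis using j fuj fuk by (auto simp: x'_def)
    next
      case False
      hence iN: "i \<in> N" and xi: "x i \<in> carrier A" using i xA by auto
      have "f j (x' i) = f j (x i) + - f k (x i) * f j u"
        using False functional_add[OF lin[OF j] xi smult_closed[OF uA]] functional_smult[OF lin[OF j] uA]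
        by (simp add: x'_def)
      thus ?thesis using j fuj fuk x(2)[OF iN] False by auto
    qed
  qed
qed

text \<open>
  A coordinate function of some basis that does not vanish at \<open>w\<close>, rescaled.
\<close>

lemma functional_exists:
  assumes fd: "vectorspace.fin_dim ground A" and w: "w \<in> carrier A" "w \<noteq> \<zero>"
  obtains l where "linear_functional l" "l w = 1"
proof -
  interpret V: kvectorspace A by (rule kvectorspace_A)
  obtain x where x: "x \<in> {1..V.dim} \<rightarrow> carrier A" "independent_family A {1..V.dim} x" "spanning_family A {1..V.dim} x"
    using V.basis_family_exists[OF fd] by blast
  let ?I = "{1..V.dim}"
  have xA: "x i \<in> carrier A" if "i \<in> ?I" for i using x(1) that by blast
  define co where "co v = (SOME c. v = lin_comb A ?I c x)" for v
  have co: "v = lin_comb A ?I (co v) x" if "v \<in> carrier A" for v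
    unfolding co_def by (rule someI_ex[of "\<lambda>c. v = lin_comb A ?I c x"]) (use that x(3)[unfolded spanning_family_def] in blast)
  have add: "lin_comb A ?I c x \<oplus> lin_comb A ?I d x = lin_comb A ?I (\<lambda>i. c i + d i) x" for c d
  proof -
    have "lin_comb A ?I c x \<oplus> lin_comb A ?I d x = finsum A (\<lambda>i. c i \<odot> x i \<oplus> d i \<odot> x i) ?I"
      unfolding lin_comb_def by (rule finsum_addf[symmetric]) (auto simp: xA simp del: One_nat_def)
    also have "\<dots> = lin_comb A ?I (\<lambda>i. c i + d i) x"
      unfolding lin_comb_def by (rule finsum_cong') (auto simp: xA smult_add_left simp del: One_nat_def)
    finally show ?thesis .
  qed
  have smult: "b \<odot> lin_comb A ?I c x = lin_comb A ?I (\<lambda>i. b * c i) x" for b c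
  proof -
    have "b \<odot> lin_comb A ?I c x = finsum A (\<lambda>i. b \<odot> (c i \<odot> x i)) ?I"
      unfolding lin_comb_def using V.finsum_smult_ldistr[of ?I b "\<lambda>i. c i \<odot> x i"]
      by (auto simp: xA simp del: One_nat_def)
    also have "\<dots> = lin_comb A ?I (\<lambda>i. b * c i) x"
      unfolding lin_comb_def by (rule finsum_cong') (auto simp: xA smult_smult simp del: One_nat_def)
    finally show ?thesis .
  qed
  have unique: "\<forall>i\<in>?I. c i = d i" if "lin_comb A ?I c x = lin_comb A ?I d x" for c d
  proof -
    have "lin_comb A ?I (\<lambda>i. c i + (- 1) * d i) x = lin_comb A ?I c x \<oplus> (- 1) \<odot> lin_comb A ?I d x"
      unfolding smult by (rule add[symmetric])
    also have "\<dots> = \<zero>" using that V.lin_comb_closed[OF x(1)] by (simp add: smult_minus_one r_neg)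
    finally show ?thesis using x(2) unfolding independent_family_def by fastforce
  qed
  have "\<exists>i\<in>?I. co w i \<noteq> 0"
  proof (rule ccontr)
    assume "\<not> ?thesis"
    hence "lin_comb A ?I (co w) x = \<zero>" using x(1) by (intro V.lin_comb_zero) auto
    thus False using co[OF w(1)] w(2) by simp
  qed
  then obtain i where i: "i \<in> ?I" "co w i \<noteq> 0" by blast
  have coadd: "co (u \<oplus> v) i = co u i + co v i" if "u \<in> carrier A" "v \<in> carrier A" for u v
  proof -
    have "lin_comb A ?I (co (u \<oplus> v)) x = lin_comb A ?I (\<lambda>i. co u i + co v i) x"
      using that co[of u] co[of v] co[of "u \<oplus> v"] add[of "co u" "co v"] by simp
    thus ?thesis using unique i(1) by blast
  qed
  have cosmult: "co (b \<odot> u) i = b * co u i" if "u \<in> carrier A" for b u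
  proof -
    have "lin_comb A ?I (co (b \<odot> u)) x = lin_comb A ?I (\<lambda>i. b * co u i) x"
      using that co[of u] co[of "b \<odot> u"] smult[of b "co u"] by simp
    thus ?thesis using unique i(1) by blast
  qed
  show ?thesis
  proof (rule that)
    show "linear_functional (\<lambda>v. co v i / co w i)"
      unfolding linear_functional_def by (auto simp: coadd cosmult add_divide_distrib)
    show "co w i / co w i = 1" using i(2) by simp
  qed
qed

end

section \<open>Dimension of ideals and of their quotients\<close>

context kalgebra
begin

lemma kvectorspace_ideal:
  assumes "ideal J A"
  shows "kvectorspace (A\<lparr>carrier := J\<rparr>)"
  unfolding kvectorspace_def
  by (rule vectorspace_subspace)
     (rule ideal_subset[OF assms] ideal_zero_closed[OF assms] ideal_add_closed[OF assms]
        ideal_smult_closed[OF assms]; assumption?)+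

lemma fin_dim_ideal:
  assumes fd: "vectorspace.fin_dim ground A" and J: "ideal J A"
  shows "vectorspace.fin_dim ground (A\<lparr>carrier := J\<rparr>)"
proof -
  interpret V: kvectorspace A by (rule kvectorspace_A)
  interpret VJ: kvectorspace "A\<lparr>carrier := J\<rparr>" by (rule kvectorspace_ideal[OF J])
  have sub: "submodule ground J A"
    by (rule LinearCombinations.submodule.intro)
       (rule V.module_axioms ideal_subset[OF J] ideal_zero_closed[OF J] ideal_add_closed[OF J]
        ideal_smult_closed[OF J]; assumption?)+
  show ?thesis
  proof (rule VJ.fin_dim_if_bounded)
    fix T assume T: "finite T" "T \<subseteq> carrier (A\<lparr>carrier := J\<rparr>)" "VJ.lin_indpt T"
    have TJ: "T \<subseteq> J" using T(2) by simp
    have "V.lin_indpt T" using V.span_li_not_depend(2)[OF TJ sub] T(3) by simp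
    thus "card T \<le> V.dim" using TJ ideal_subset[OF J] by (intro V.li_le_dim(2)[OF fd]) auto
  qed
qed

lemma dim_one_generator:
  assumes fd: "vectorspace.fin_dim ground A" and J: "ideal J A"
    and dim: "vectorspace.dim ground (A\<lparr>carrier := J\<rparr>) = 1"
  obtains w where "w \<in> J" "w \<noteq> \<zero>" "\<And>v. v \<in> J \<Longrightarrow> \<exists>c. v = c \<odot> w"
proof -
  let ?V = "A\<lparr>carrier := J\<rparr>"
  interpret VJ: kvectorspace ?V by (rule kvectorspace_ideal[OF J])
  obtain x where x: "x \<in> {1..1} \<rightarrow> carrier ?V" "independent_family ?V {1..1} x" "spanning_family ?V {1..1::nat} x"
    using VJ.basis_family_exists[OF fin_dim_ideal[OF fd J]] unfolding dim by blast
  have x1: "x 1 \<in> J" using x(1) by auto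
  have lin_comb: "lin_comb ?V {1..1} c x = c 1 \<odot> x 1" for c
    using VJ.lin_comb_insert[of "{}" 1 x c] x1 ideal.Icarr[OF J x1] by simp
  show ?thesis
  proof (rule that[OF x1])
    show "x 1 \<noteq> \<zero>"
    proof
      assume "x 1 = \<zero>"
      hence "lin_comb ?V {1..1} (\<lambda>_. 1) x = \<zero>\<^bsub>?V\<^esub>" unfolding lin_comb by simp
      hence "(1::'k) = 0" using x(2) unfolding independent_family_def by fastforce
      thus False by simp
    qed
    fix v assume "v \<in> J"
    hence "v \<in> carrier ?V" by simp
    then obtain c where "v = lin_comb ?V {1..1} c x" using x(3) unfolding spanning_family_def by blast
    thus "\<exists>c. v = c \<odot> x 1" unfolding lin_comb by blast
  qed
qed

text \<open>
  Independence in \<open>A / W\<close>, stated in \<open>A\<close> itself to avoid computing with cosets.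
\<close>

definition independent_mod :: "'a set \<Rightarrow> 'i set \<Rightarrow> ('i \<Rightarrow> 'a) \<Rightarrow> bool" where
  "independent_mod W I x \<longleftrightarrow> (\<forall>c. lin_comb A I c x \<in> W \<longrightarrow> (\<forall>i\<in>I. c i = 0))"

definition spanning_mod :: "'a set \<Rightarrow> 'a set \<Rightarrow> 'i set \<Rightarrow> ('i \<Rightarrow> 'a) \<Rightarrow> bool" where
  "spanning_mod U W I x \<longleftrightarrow> (\<forall>v\<in>U. \<exists>c. \<exists>w\<in>W. v = lin_comb A I c x \<oplus> w)"

context
  fixes U W :: "'a set"
  assumes U: "ideal U A" and W: "ideal W A" and WU: "W \<subseteq> U"
begin

abbreviation (input) "Q \<equiv> quotient_space A U W"

lemma UA: "u \<in> U \<Longrightarrow> u \<in> carrier A" by (rule ideal.Icarr[OF U])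

lemma WA: "u \<in> W \<Longrightarrow> u \<in> carrier A" by (rule ideal.Icarr[OF W])

lemma quotient_space_simps:
  "carrier Q = (\<lambda>x. W +> x) ` U" "\<zero>\<^bsub>Q\<^esub> = W"
  "u \<in> U \<Longrightarrow> v \<in> U \<Longrightarrow> (W +> u) \<oplus>\<^bsub>Q\<^esub> (W +> v) = W +> (u \<oplus> v)"
  "u \<in> U \<Longrightarrow> c \<odot>\<^bsub>Q\<^esub> (W +> u) = W +> (c \<odot> u)"
  using quotient_algebra_simps(1)[OF W] quotient_algebra_simps(4)[OF W, of u v]
    quotient_algebra_smult[OF W, of u c] UA
  by (simp_all add: quotient_space_def)

lemma coset_eq_zero_iff: "u \<in> carrier A \<Longrightarrow> W +> u = W \<longleftrightarrow> u \<in> W"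
  using ideal.rcos_const_imp_mem[OF W] a_rcos_zero[OF W] by blast

lemma kvectorspace_quotient: "kvectorspace Q"
  unfolding kvectorspace_def
proof (rule vs_criteria)
  note q = quotient_space_simps
  have W0: "W +> \<zero> = W" using coset_eq_zero_iff ideal_zero_closed[OF W] by simp
  show "field (ground :: 'k ring)" ..
  show "\<zero>\<^bsub>Q\<^esub> \<in> carrier Q" unfolding q using W0 ideal_zero_closed[OF U] by blast
  show "\<forall>v w. v \<in> carrier Q \<and> w \<in> carrier Q \<longrightarrow> v \<oplus>\<^bsub>Q\<^esub> w \<in> carrier Q"
    unfolding q(1) using ideal_add_closed[OF U] by (auto simp: q(3))
  show "\<forall>v\<in>carrier Q. \<exists>neg_v\<in>carrier Q. v \<oplus>\<^bsub>Q\<^esub> neg_v = \<zero>\<^bsub>Q\<^esub>"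
  proof
    fix v assume "v \<in> carrier Q"
    then obtain u where u: "u \<in> U" "v = W +> u" unfolding q(1) by blast
    have nu: "(- 1) \<odot> u \<in> U" by (rule ideal_smult_closed[OF U u(1)])
    have "v \<oplus>\<^bsub>Q\<^esub> (W +> ((- 1) \<odot> u)) = W +> (u \<oplus> (- 1) \<odot> u)" unfolding u(2) by (rule q(3)[OF u(1) nu])
    also have "\<dots> = W" using UA[OF u(1)] W0 by (simp add: smult_minus_one r_neg)
    finally show "\<exists>neg_v\<in>carrier Q. v \<oplus>\<^bsub>Q\<^esub> neg_v = \<zero>\<^bsub>Q\<^esub>" unfolding q(1,2) using nu by blast
  qed
  show "\<forall>c v. c \<in> carrier ground \<and> v \<in> carrier Q \<longrightarrow> c \<odot>\<^bsub>Q\<^esub> v \<in> carrier Q"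
    unfolding q(1) using ideal_smult_closed[OF U] by (auto simp: q(4))
  show "\<forall>v w. v \<in> carrier Q \<and> w \<in> carrier Q \<longrightarrow> v \<oplus>\<^bsub>Q\<^esub> w = w \<oplus>\<^bsub>Q\<^esub> v"
    unfolding q(1) by (auto simp: q(3) UA a_comm)
  show "\<forall>v w x. v \<in> carrier Q \<and> w \<in> carrier Q \<and> x \<in> carrier Q \<longrightarrow>
     v \<oplus>\<^bsub>Q\<^esub> w \<oplus>\<^bsub>Q\<^esub> x = v \<oplus>\<^bsub>Q\<^esub> (w \<oplus>\<^bsub>Q\<^esub> x)"
    unfolding q(1) by (auto simp: q(3) UA a_assoc ideal_add_closed[OF U])
  show "\<forall>v\<in>carrier Q. v \<oplus>\<^bsub>Q\<^esub> \<zero>\<^bsub>Q\<^esub> = v"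
  proof
    fix v assume "v \<in> carrier Q"
    then obtain u where u: "u \<in> U" "v = W +> u" unfolding q(1) by blast
    have "v \<oplus>\<^bsub>Q\<^esub> (W +> \<zero>) = v" unfolding u(2) using q(3)[OF u(1) ideal_zero_closed[OF U]] UA[OF u(1)] by simp
    thus "v \<oplus>\<^bsub>Q\<^esub> \<zero>\<^bsub>Q\<^esub> = v" unfolding q(2) W0 .
  qed
  show "\<forall>a b v. a \<in> carrier ground \<and> b \<in> carrier ground \<and> v \<in> carrier Q \<longrightarrow>
      (a \<otimes>\<^bsub>ground\<^esub> b) \<odot>\<^bsub>Q\<^esub> v = a \<odot>\<^bsub>Q\<^esub> (b \<odot>\<^bsub>Q\<^esub> v)"
    unfolding q(1) by (auto simp: q(4) UA smult_smult ideal_smult_closed[OF U])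
  show "\<forall>v\<in>carrier Q. \<one>\<^bsub>ground\<^esub> \<odot>\<^bsub>Q\<^esub> v = v"
    unfolding q(1) by (auto simp: q(4) UA)
  show "\<forall>a b v. a \<in> carrier ground \<and> b \<in> carrier ground \<and> v \<in> carrier Q \<longrightarrow>
      (a \<oplus>\<^bsub>ground\<^esub> b) \<odot>\<^bsub>Q\<^esub> v = a \<odot>\<^bsub>Q\<^esub> v \<oplus>\<^bsub>Q\<^esub> b \<odot>\<^bsub>Q\<^esub> v"
    unfolding q(1) by (auto simp: q(3,4) UA smult_add_left ideal_smult_closed[OF U])
  show "\<forall>a v w. a \<in> carrier ground \<and> v \<in> carrier Q \<and> w \<in> carrier Q \<longrightarrow>
      a \<odot>\<^bsub>Q\<^esub> (v \<oplus>\<^bsub>Q\<^esub> w) = a \<odot>\<^bsub>Q\<^esub> v \<oplus>\<^bsub>Q\<^esub> a \<odot>\<^bsub>Q\<^esub> w"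
    unfolding q(1) by (auto simp: q(3,4) UA smult_add_right ideal_smult_closed[OF U] ideal_add_closed[OF U])
qed

lemma lin_comb_quotient:
  assumes "finite I" "x \<in> I \<rightarrow> U"
  shows "lin_comb Q I c (\<lambda>i. W +> x i) = W +> lin_comb A I c x"
  using assms
proof (induction I)
  case empty
  interpret V: kvectorspace A by (rule kvectorspace_A)
  interpret Q: kvectorspace Q by (rule kvectorspace_quotient)
  show ?case using coset_eq_zero_iff[OF zero_closed] ideal_zero_closed[OF W] quotient_space_simps(2) by simp
next
  case (insert i I)
  interpret V: kvectorspace A by (rule kvectorspace_A)
  interpret Q: kvectorspace Q by (rule kvectorspace_quotient)
  have xi: "x i \<in> U" and xI: "x \<in> I \<rightarrow> U" using insert.prems by auto
  have "lin_comb Q (insert i I) c (\<lambda>i. W +> x i) = c i \<odot>\<^bsub>Q\<^esub> (W +> x i) \<oplus>\<^bsub>Q\<^esub> lin_comb Q I c (\<lambda>i. W +> x i)"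
    using insert.hyps insert.prems quotient_space_simps(1) by (intro Q.lin_comb_insert) auto
  also have "\<dots> = (W +> (c i \<odot> x i)) \<oplus>\<^bsub>Q\<^esub> (W +> lin_comb A I c x)"
    using quotient_space_simps(4)[OF xi] insert.IH[OF xI] by simp
  also have "\<dots> = W +> (c i \<odot> x i \<oplus> lin_comb A I c x)"
    by (rule quotient_space_simps(3)[OF ideal_smult_closed[OF U xi] lin_comb_ideal[OF U xI]])
  also have "c i \<odot> x i \<oplus> lin_comb A I c x = lin_comb A (insert i I) c x"
    using insert.hyps insert.prems UA by (intro V.lin_comb_insert[symmetric]) auto
  finally show ?case .
qed

lemma independent_quotient_iff:
  assumes "finite I" "x \<in> I \<rightarrow> U"
  shows "independent_family Q I (\<lambda>i. W +> x i) \<longleftrightarrow> independent_mod W I x"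
proof -
  have "lin_comb A I c x \<in> carrier A" for c using lin_comb_ideal[OF U assms(2)] UA by blast
  thus ?thesis
    unfolding independent_family_def independent_mod_def lin_comb_quotient[OF assms] quotient_space_simps(2)
    by (simp add: coset_eq_zero_iff)
qed

lemma spanning_quotient_iff:
  assumes "finite I" "x \<in> I \<rightarrow> U"
  shows "spanning_family Q I (\<lambda>i. W +> x i) \<longleftrightarrow> spanning_mod U W I x"
proof -
  have l: "lin_comb A I c x \<in> U" for c by (rule lin_comb_ideal[OF U assms(2)])
  have "W +> v = W +> lin_comb A I c x \<longleftrightarrow> (\<exists>w\<in>W. v = lin_comb A I c x \<oplus> w)" if v: "v \<in> U" for v c
  proof -
    have L: "lin_comb A I c x \<in> carrier A" and vA: "v \<in> carrier A" using l UA v by auto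
    have "W +> v = W +> lin_comb A I c x \<longleftrightarrow> v \<ominus> lin_comb A I c x \<in> W"
      by (rule quotient_eq_iff_same_a_r_cos[OF W vA L, symmetric])
    also have "\<dots> \<longleftrightarrow> (\<exists>w\<in>W. v = lin_comb A I c x \<oplus> w)"
    proof
      assume *: "v \<ominus> lin_comb A I c x \<in> W"
      have "v = lin_comb A I c x \<oplus> (v \<ominus> lin_comb A I c x)" using L vA by (simp add: a_minus_def a_lcomm[of "lin_comb A I c x"] r_neg)
      thus "\<exists>w\<in>W. v = lin_comb A I c x \<oplus> w" using * by blast
    next
      assume "\<exists>w\<in>W. v = lin_comb A I c x \<oplus> w"
      then obtain w where w: "w \<in> W" "v = lin_comb A I c x \<oplus> w" by blast
      have "v \<ominus> lin_comb A I c x = w" using L WA[OF w(1)] unfolding w(2)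
        by (simp add: a_minus_def a_comm[of "lin_comb A I c x" w] a_assoc r_neg)
      thus "v \<ominus> lin_comb A I c x \<in> W" using w(1) by simp
    qed
    finally show ?thesis .
  qed
  thus ?thesis
    unfolding spanning_family_def spanning_mod_def quotient_space_simps(1) ball_simps lin_comb_quotient[OF assms] by simp
qed

lemma coset_family:
  assumes "y \<in> I \<rightarrow> carrier Q"
  obtains x where "x \<in> I \<rightarrow> U" "\<And>i. i \<in> I \<Longrightarrow> y i = W +> x i"
proof -
  have "\<forall>i\<in>I. \<exists>u. u \<in> U \<and> y i = W +> u" using assms unfolding quotient_space_simps(1) by blast
  then obtain x where "\<forall>i\<in>I. x i \<in> U \<and> y i = W +> x i" by metis
  thus ?thesis by (intro that[of x]) auto
qed

text \<open>
  Representatives of independent cosets are independent in \<open>A\<close>, which bounds their number.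
\<close>

lemma fin_dim_quotient:
  assumes fd: "vectorspace.fin_dim ground A"
  shows "vectorspace.fin_dim ground Q"
proof -
  interpret V: kvectorspace A by (rule kvectorspace_A)
  interpret Q: kvectorspace Q by (rule kvectorspace_quotient)
  show ?thesis
  proof (rule Q.fin_dim_if_bounded)
    fix T assume T: "finite T" "T \<subseteq> carrier Q" "Q.lin_indpt T"
    have "(\<lambda>t. t) \<in> T \<rightarrow> carrier Q" using T(2) by auto
    then obtain x where x: "x \<in> T \<rightarrow> U" "\<And>t. t \<in> T \<Longrightarrow> t = W +> x t" using coset_family by blast
    have xA: "x \<in> T \<rightarrow> carrier A" using x(1) UA by blast
    have "independent_family A T x" unfolding independent_family_def
    proof (intro allI impI ballI)
      fix c t assume c: "lin_comb A T c x = \<zero>" and t: "t \<in> T"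
      have "Q.lincomb c T = lin_comb Q T c (\<lambda>t. W +> x t)"
        unfolding Q.lincomb_def lin_comb_def
        by (rule Q.M.finsum_cong') (use T(2) x Q.scalar_closed in \<open>auto simp flip: x(2)\<close>)
      also have "\<dots> = \<zero>\<^bsub>Q\<^esub>"
        unfolding lin_comb_quotient[OF T(1) x(1)] c quotient_space_simps(2)
        using coset_eq_zero_iff[OF zero_closed] ideal_zero_closed[OF W] by simp
      finally show "c t = 0" using T(1,3) t unfolding Q.lin_dep_def by auto
    qed
    thus "card T \<le> V.dim" using V.independent_family_card_le[OF fd T(1) xA] by blast
  qed
qed

lemma dim_quotient_eq_card:
  assumes "finite I" "x \<in> I \<rightarrow> U" "independent_mod W I x" "spanning_mod U W I x"
  shows "vectorspace.dim ground Q = card I"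
proof -
  interpret Q: kvectorspace Q by (rule kvectorspace_quotient)
  show ?thesis
  proof (rule Q.dim_eq_card_family)
    show "(\<lambda>i. W +> x i) \<in> I \<rightarrow> carrier Q" using assms(2) unfolding quotient_space_simps(1) by blast
  qed (use assms independent_quotient_iff[OF assms(1,2)] spanning_quotient_iff[OF assms(1,2)] in simp_all)
qed

lemma independent_mod_card_le:
  assumes "vectorspace.fin_dim ground A" "finite I" "x \<in> I \<rightarrow> U" "independent_mod W I x"
  shows "card I \<le> vectorspace.dim ground Q"
proof -
  interpret Q: kvectorspace Q by (rule kvectorspace_quotient)
  show ?thesis
  proof (rule Q.independent_family_card_le[OF fin_dim_quotient[OF assms(1)] assms(2)])
    show "(\<lambda>i. W +> x i) \<in> I \<rightarrow> carrier Q" using assms(3) unfolding quotient_space_simps(1) by blast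
  qed (use assms independent_quotient_iff[OF assms(2,3)] in simp)
qed

lemma basis_mod_exists:
  assumes fd: "vectorspace.fin_dim ground A" and n: "vectorspace.dim ground Q = n"
  obtains q where "q \<in> {1..n} \<rightarrow> U" "independent_mod W {1..n} q" "spanning_mod U W {1..n} q"
proof -
  interpret Q: kvectorspace Q by (rule kvectorspace_quotient)
  obtain y where y: "y \<in> {1..n} \<rightarrow> carrier Q" "independent_family Q {1..n} y" "spanning_family Q {1..n} y"
    using Q.basis_family_exists[OF fin_dim_quotient[OF fd]] unfolding n by blast
  obtain q where q: "q \<in> {1..n} \<rightarrow> U" "\<And>i. i \<in> {1..n} \<Longrightarrow> y i = W +> q i"
    using coset_family[OF y(1)] by blast
  have "lin_comb Q {1..n} c y = lin_comb Q {1..n} c (\<lambda>i. W +> q i)" for c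
    unfolding lin_comb_def
  proof (rule Q.M.finsum_cong'[OF refl])
    show "(\<lambda>i. c i \<odot>\<^bsub>Q\<^esub> (W +> q i)) \<in> {1..n} \<rightarrow> carrier Q"
      using q(1) unfolding quotient_space_simps(1) by (intro funcsetI Q.scalar_closed[unfolded quotient_space_simps(1)]) blast
  qed (simp only: q(2))
  hence "independent_family Q {1..n} (\<lambda>i. W +> q i)" "spanning_family Q {1..n} (\<lambda>i. W +> q i)"
    using y(2,3) unfolding independent_family_def spanning_family_def by simp_all
  thus ?thesis
    using independent_quotient_iff[OF finite_atLeastAtMost q(1)] spanning_quotient_iff[OF finite_atLeastAtMost q(1)]
    by (intro that[OF q(1)]) simp_all
qed

end

end

section \<open>The residue field\<close>

context kalgebra
begin

text \<open>
  The Horner scheme, whose recursion follows the construction of polynomials by \<^const>\<open>pCons\<close>.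
\<close>

definition poly_eval :: "'a \<Rightarrow> 'k poly \<Rightarrow> 'a" where
  "poly_eval a p = fold_coeffs (\<lambda>c s. c \<odot> \<one> \<oplus> a \<otimes> s) p \<zero>"

lemma poly_eval_0 [simp]: "poly_eval a 0 = \<zero>"
  by (simp add: poly_eval_def)

lemma poly_eval_pCons:
  assumes "a \<in> carrier A"
  shows "poly_eval a (pCons c p) = c \<odot> \<one> \<oplus> a \<otimes> poly_eval a p"
  using assms by (cases "p = 0 \<and> c = 0") (auto simp: poly_eval_def)

lemma poly_eval_closed:
  assumes a: "a \<in> carrier A"
  shows "poly_eval a p \<in> carrier A"
  by (induction p) (simp_all add: poly_eval_pCons[OF a] a)

lemma poly_eval_add:
  assumes a: "a \<in> carrier A"
  shows "poly_eval a (p + q) = poly_eval a p \<oplus> poly_eval a q"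
proof (induction p q rule: poly_induct2)
  case (pCons c p d q)
  have *: "u \<oplus> v \<oplus> (x \<oplus> y) = (u \<oplus> x) \<oplus> (v \<oplus> y)"
    if "u \<in> carrier A" "v \<in> carrier A" "x \<in> carrier A" "y \<in> carrier A" for u v x y
    using that by (simp add: a_assoc a_lcomm[of v x])
  show ?case
    using poly_eval_closed[OF a, of p] poly_eval_closed[OF a, of q] a
    by (simp add: poly_eval_pCons[OF a] pCons.IH smult_add_left r_distr *)
qed simp

lemma poly_eval_smult:
  assumes a: "a \<in> carrier A"
  shows "poly_eval a (Polynomial.smult c p) = c \<odot> poly_eval a p"
proof (induction p)
  case (pCons d p)
  thus ?case using poly_eval_closed[OF a, of p] a
    by (simp add: poly_eval_pCons[OF a] smult_add_right smult_smult smult_mult_right)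
qed simp

lemma poly_eval_linear_mult:
  assumes a: "a \<in> carrier A"
  shows "poly_eval a ([:- z, 1:] * p) = (a \<oplus> (- z) \<odot> \<one>) \<otimes> poly_eval a p"
proof -
  have "[:- z, 1:] * p = pCons 0 p + Polynomial.smult (- z) p"
    by (simp add: mult_pCons_left)
  hence "poly_eval a ([:- z, 1:] * p) = a \<otimes> poly_eval a p \<oplus> (- z) \<odot> poly_eval a p"
    using poly_eval_closed[OF a, of p] a
    by (simp only: poly_eval_add[OF a] poly_eval_pCons[OF a] poly_eval_smult[OF a]) simp
  thus ?thesis using poly_eval_closed[OF a, of p] a by (simp add: l_distr smult_mult_left)
qed

lemma poly_eval_monom:
  assumes a: "a \<in> carrier A"
  shows "poly_eval a (Polynomial.monom c i) = c \<odot> (a [^] i)"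
proof (induction i)
  case 0
  show ?case using a by (simp add: monom_0 poly_eval_pCons[OF a])
next
  case (Suc i)
  thus ?case using a
    by (simp add: monom_Suc poly_eval_pCons[OF a] smult_mult_right m_comm)
qed

lemma poly_eval_sum_monom:
  assumes a: "a \<in> carrier A" and "finite I"
  shows "poly_eval a (\<Sum>i\<in>I. Polynomial.monom (c i) i) = lin_comb A I c (\<lambda>i. a [^] i)"
  using assms(2)
proof (induction I)
  case empty
  interpret V: kvectorspace A by (rule kvectorspace_A)
  show ?case by simp
next
  case (insert i I)
  interpret V: kvectorspace A by (rule kvectorspace_A)
  show ?case using insert a V.lin_comb_insert[of I i "\<lambda>i. a [^] i" c]
    by (simp add: poly_eval_add[OF a] poly_eval_monom[OF a])
qed

end

text \<open>
  The residue field is the ground field. The powers of \<open>a\<close> are linearly dependent, so \<open>a\<close> is a root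
  of a nonzero polynomial; this polynomial splits into linear factors, and one of the factors
  \<open>a - z\<close> has to lie in the prime ideal \<open>m\<close>.
\<close>

lemma residue_scalar_exists:
  fixes A :: "('k::alg_closed_field, 'a, 'c) module_scheme" (structure)
  assumes A: "kalgebra A" and fd: "vectorspace.fin_dim ground A" and max: "maximalideal m A"
    and a: "a \<in> carrier A"
  shows "\<exists>z. a \<oplus> (- z) \<odot> \<one> \<in> m"
proof -
  interpret kalgebra A by fact
  interpret V: kvectorspace A by (rule kvectorspace_A)
  interpret m: maximalideal m A by fact
  have m: "ideal m A" by (rule m.is_ideal)
  have prime: "x \<in> m \<or> y \<in> m" if "x \<otimes> y \<in> m" "x \<in> carrier A" "y \<in> carrier A" for x y
    using primeideal.I_prime[OF maximalideal_prime[OF max]] that by blast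
  have root: "\<exists>z. a \<oplus> (- z) \<odot> \<one> \<in> m" if "p \<noteq> 0" "poly_eval a p \<in> m" for p
    using that
  proof (induction "Polynomial.degree p" arbitrary: p rule: less_induct)
    case less
    show ?case
    proof (cases "Polynomial.degree p = 0")
      case True
      then obtain c where p: "p = [:c:]" by (rule degree_eq_zeroE)
      hence c: "c \<noteq> 0" "c \<odot> \<one> \<in> m" using less.prems a by (simp_all add: poly_eval_pCons[OF a])
      have "(1 / c) \<odot> (c \<odot> \<one>) \<in> m" by (rule ideal_smult_closed[OF m c(2)])
      hence "\<one> \<in> m" using c(1) by (simp add: smult_smult)
      thus ?thesis using m.one_imp_carrier m.I_notcarr by simp
    next
      case False
      then obtain z where z: "poly p z = 0" using alg_closed_imp_poly_has_root by blast
      then obtain q where q: "p = [:- z, 1:] * q" unfolding poly_eq_0_iff_dvd by (auto simp: dvd_def)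
      have q0: "q \<noteq> 0" using less.prems(1) q by auto
      have "Polynomial.degree p = Suc (Polynomial.degree q)" unfolding q
        using q0 by (subst degree_mult_eq) auto
      moreover have "(a \<oplus> (- z) \<odot> \<one>) \<otimes> poly_eval a q \<in> m"
        using less.prems(2) unfolding q poly_eval_linear_mult[OF a] .
      ultimately show ?thesis
        using prime[of "a \<oplus> (- z) \<odot> \<one>" "poly_eval a q"] less.hyps[of q] q0 poly_eval_closed[OF a] a
        by auto
    qed
  qed
  let ?I = "{..V.dim}"
  have "\<not> independent_family A ?I (\<lambda>i. a [^] i)"
    using V.independent_family_card_le[OF fd, of ?I "\<lambda>i. a [^] i"] a by auto
  then obtain c i where c: "lin_comb A ?I c (\<lambda>i. a [^] i) = \<zero>" "i \<in> ?I" "c i \<noteq> 0"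
    unfolding independent_family_def by blast
  let ?p = "\<Sum>i\<in>?I. Polynomial.monom (c i) i"
  have "poly.coeff ?p i = c i" using c(2) by (simp add: coeff_sum)
  hence "?p \<noteq> 0" using c(3) by auto
  moreover have "poly_eval a ?p \<in> m"
    using poly_eval_sum_monom[OF a, of ?I c] c(1) ideal_zero_closed[OF m] by simp
  ultimately show ?thesis by (rule root)
qed

section \<open>The bilinear form of a Gorenstein algebra\<close>

(* Otherwise the simplifier unfolds powers of the maximal ideal into nested products. *)
declare ideal_power.simps(2) [simp del]

text \<open>
  The data extracted from a Gorenstein algebra of socle degree three: a generator \<open>w\<close> of the
  socle and a functional \<open>l\<close> with \<open>l(w) = 1\<close>. The condition \<open>l(1) = 0\<close> makes the dual polynomial
  have no constant term.
\<close>

locale gorenstein_functional = kalgebra A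
  for A :: "('k::field_char_0, 'a, 'c) module_scheme" (structure) +
  fixes m :: "'a set" and w :: 'a and l :: "'a \<Rightarrow> 'k"
  assumes maximal: "maximalideal m A"
    and P4: "ideal_power A m 4 = {\<zero>}"
    and w_P3: "w \<in> ideal_power A m 3"
    and socle_multiple: "x \<in> carrier A \<Longrightarrow> (\<And>y. y \<in> m \<Longrightarrow> y \<otimes> x = \<zero>) \<Longrightarrow> \<exists>c. x = c \<odot> w"
    and lin: "linear_functional l" and l_w: "l w = 1" and l_one: "l \<one> = 0"
begin

abbreviation "P \<equiv> ideal_power A m"

lemma m_ideal: "ideal m A"
  by (rule maximalideal.axioms(1)[OF maximal])

lemma P_ideal: "ideal (P k) A"
  by (rule ideal_power_is_ideal[OF m_ideal])

lemma P_closed: "x \<in> P k \<Longrightarrow> x \<in> carrier A"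
  by (rule ideal.Icarr[OF P_ideal])

lemma mem_m_closed: "x \<in> m \<Longrightarrow> x \<in> carrier A"
  by (rule ideal.Icarr[OF m_ideal])

lemma m_mult_P: "a \<in> m \<Longrightarrow> b \<in> P k \<Longrightarrow> a \<otimes> b \<in> P (Suc k)"
  unfolding ideal_power.simps by (rule ideal_prod.prod)

lemma P_Suc_subset: "P (Suc k) \<subseteq> P k"
  using ideal_prod_inter[OF m_ideal P_ideal[of k]] unfolding ideal_power.simps by simp

lemma P_antimono: "j \<le> k \<Longrightarrow> P k \<subseteq> P j"
  by (rule lift_Suc_antimono_le) (rule P_Suc_subset)

lemma P_1: "P (Suc 0) = m"
proof
  show "P (Suc 0) \<subseteq> m"
    using ideal_prod_inter[OF m_ideal P_ideal[of 0]] unfolding ideal_power.simps by simp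
  show "m \<subseteq> P (Suc 0)"
  proof
    fix x assume x: "x \<in> m"
    have "x \<otimes> \<one> \<in> P (Suc 0)" by (rule m_mult_P[OF x]) simp
    thus "x \<in> P (Suc 0)" using mem_m_closed[OF x] by simp
  qed
qed

lemma P_mult: "a \<in> P i \<Longrightarrow> b \<in> P j \<Longrightarrow> a \<otimes> b \<in> P (i + j)"
proof (induction i arbitrary: a)
  case 0
  thus ?case using ideal.I_l_closed[OF P_ideal] by simp
next
  case (Suc i)
  have "a \<in> ideal_prod A m (P i)" using Suc.prems(1) unfolding ideal_power.simps .
  thus ?case
  proof (induction rule: ideal_prod.induct)
    case (prod x y)
    have "x \<otimes> (y \<otimes> b) \<in> P (Suc (i + j))" by (rule m_mult_P[OF prod(1) Suc.IH[OF prod(2) Suc.prems(2)]])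
    thus ?case using mem_m_closed[OF prod(1)] P_closed[OF prod(2)] P_closed[OF Suc.prems(2)] by (simp add: m_assoc)
  next
    case (sum x y)
    have "x \<in> carrier A" "y \<in> carrier A"
      using sum(1,2) P_closed[of _ "Suc i"] unfolding ideal_power.simps by auto
    thus ?case using ideal_add_closed[OF P_ideal sum.IH] P_closed[OF Suc.prems(2)] by (simp add: l_distr)
  qed
qed

lemma P_eq_zero: "x \<in> P k \<Longrightarrow> 4 \<le> k \<Longrightarrow> x = \<zero>"
  using P_antimono[of 4 k] P4 by auto

lemma w_closed: "w \<in> carrier A" by (rule P_closed[OF w_P3])

lemma socle_eq_multiple:
  assumes "x \<in> carrier A" "\<And>y. y \<in> m \<Longrightarrow> y \<otimes> x = \<zero>"
  shows "x = l x \<odot> w"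
proof -
  obtain c where c: "x = c \<odot> w" using socle_multiple[OF assms] by blast
  have "l x = c" unfolding c functional_smult[OF lin w_closed] l_w by simp
  thus ?thesis using c by simp
qed

lemma socle_eq_zero:
  assumes "x \<in> carrier A" "\<And>y. y \<in> m \<Longrightarrow> y \<otimes> x = \<zero>" "l x = 0"
  shows "x = \<zero>"
  using socle_eq_multiple[OF assms(1,2)] assms(3) w_closed by simp

lemma socle_in_P3:
  assumes "x \<in> carrier A" "\<And>y. y \<in> m \<Longrightarrow> y \<otimes> x = \<zero>"
  shows "x \<in> P 3"
  using ideal_smult_closed[OF P_ideal w_P3, of "l x"] socle_eq_multiple[OF assms] by simp

lemma m_mult_P3: "y \<in> m \<Longrightarrow> x \<in> P 3 \<Longrightarrow> y \<otimes> x = \<zero>"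
  using m_mult_P[of y x 3] P_eq_zero[of "y \<otimes> x" "Suc 3"] by simp

lemma P3_eq_zero: "x \<in> P 3 \<Longrightarrow> l x = 0 \<Longrightarrow> x = \<zero>"
  by (rule socle_eq_zero) (auto simp: P_closed m_mult_P3)

text \<open>
  A nonzero element \<open>a\<close> has a nonzero multiple in the socle: take the last power of \<open>m\<close> that does
  not kill \<open>a\<close>. On the socle \<open>l\<close> is injective.
\<close>

lemma nondegenerate:
  assumes a: "a \<in> carrier A" and l0: "\<And>y. y \<in> carrier A \<Longrightarrow> l (y \<otimes> a) = 0"
  shows "a = \<zero>"
proof (rule ccontr)
  assume "a \<noteq> \<zero>"
  let ?Z = "\<lambda>k. \<forall>b\<in>P k. b \<otimes> a = \<zero>"
  have Z4: "?Z 4" using P4 a by simp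
  define k where "k = (LEAST k. ?Z k)"
  have Zk: "?Z k" unfolding k_def by (rule LeastI[of ?Z, OF Z4])
  have "\<not> ?Z 0" using a \<open>a \<noteq> \<zero>\<close> by (auto intro!: bexI[of _ \<one>])
  hence "k \<noteq> 0" using Zk by (intro notI) simp
  then obtain j where j: "k = Suc j" by (cases k) auto
  hence "\<not> ?Z j" unfolding k_def using not_less_Least[of j ?Z] by simp
  then obtain b where b: "b \<in> P j" "b \<otimes> a \<noteq> \<zero>" by blast
  have bA: "b \<in> carrier A" by (rule P_closed[OF b(1)])
  have "b \<otimes> a = \<zero>"
  proof (rule socle_eq_zero)
    fix y assume y: "y \<in> m"
    have "(y \<otimes> b) \<otimes> a = \<zero>" using Zk m_mult_P[OF y b(1)] unfolding j by blast
    thus "y \<otimes> (b \<otimes> a) = \<zero>" using mem_m_closed[OF y] bA a by (simp add: m_assoc)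
  qed (use bA a l0 in auto)
  thus False using b(2) by simp
qed

lemma eq_by_functional:
  assumes a: "a \<in> carrier A" and b: "b \<in> carrier A"
    and l: "\<And>y. y \<in> carrier A \<Longrightarrow> l (y \<otimes> a) = l (y \<otimes> b)"
  shows "a = b"
proof -
  have nb: "(- 1) \<odot> b \<in> carrier A" using b by simp
  have "a \<oplus> (- 1) \<odot> b = \<zero>"
  proof (rule nondegenerate)
    fix y assume y: "y \<in> carrier A"
    have "l (y \<otimes> (a \<oplus> (- 1) \<odot> b)) = l (y \<otimes> a) + (- 1) * l (y \<otimes> b)"
      using functional_add[OF functional_mult[OF lin y] a nb] functional_smult[OF functional_mult[OF lin y] b]
      by simp
    thus "l (y \<otimes> (a \<oplus> (- 1) \<odot> b)) = 0" using l[OF y] by simp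
  qed (use a nb in simp)
  hence "a \<ominus> b = \<zero>" using b by (simp add: smult_minus_one a_minus_def)
  thus ?thesis using a b by simp
qed

lemma pairing_sym: "a \<in> carrier A \<Longrightarrow> b \<in> carrier A \<Longrightarrow> l (a \<otimes> b) = l (b \<otimes> a)"
  by (simp add: m_comm)

lemma pairing_add: "y \<in> carrier A \<Longrightarrow> a \<in> carrier A \<Longrightarrow> b \<in> carrier A \<Longrightarrow> l (y \<otimes> (a \<oplus> b)) = l (y \<otimes> a) + l (y \<otimes> b)"
  by (rule functional_add[OF functional_mult[OF lin]])

lemma pairing_smult: "y \<in> carrier A \<Longrightarrow> a \<in> carrier A \<Longrightarrow> l (y \<otimes> (c \<odot> a)) = c * l (y \<otimes> a)"
  by (rule functional_smult[OF functional_mult[OF lin]])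

lemma pairing_lin_comb: "y \<in> carrier A \<Longrightarrow> x \<in> I \<rightarrow> carrier A \<Longrightarrow> l (y \<otimes> lin_comb A I c x) = (\<Sum>i\<in>I. c i * l (y \<otimes> x i))"
  by (rule functional_mult_lin_comb[OF lin])

lemma pairing_add_left: "y \<in> carrier A \<Longrightarrow> a \<in> carrier A \<Longrightarrow> b \<in> carrier A \<Longrightarrow> l ((a \<oplus> b) \<otimes> y) = l (a \<otimes> y) + l (b \<otimes> y)"
  using pairing_add[of y a b] by (simp add: m_comm)

lemma pairing_smult_left: "y \<in> carrier A \<Longrightarrow> a \<in> carrier A \<Longrightarrow> l ((c \<odot> a) \<otimes> y) = c * l (a \<otimes> y)"
  using pairing_smult[of y a c] by (simp add: m_comm)

lemma lin_comb_carrier: "x \<in> I \<rightarrow> carrier A \<Longrightarrow> lin_comb A I c x \<in> carrier A"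
  by (rule lin_comb_ideal[OF oneideal])

lemma pairing_lin_comb_left: "y \<in> carrier A \<Longrightarrow> x \<in> I \<rightarrow> carrier A \<Longrightarrow> l (lin_comb A I c x \<otimes> y) = (\<Sum>i\<in>I. c i * l (x i \<otimes> y))"
  using pairing_lin_comb[of y x I c] lin_comb_carrier[of x I c] by (simp add: m_comm[of _ y] Pi_iff)

lemma P2_mult_P2: "a \<in> P 2 \<Longrightarrow> b \<in> P 2 \<Longrightarrow> a \<otimes> b = \<zero>"
  using P_mult[of a 2 b 2] P_eq_zero[of "a \<otimes> b" 4] by simp

lemma P2_in_m: "a \<in> P 2 \<Longrightarrow> a \<in> m"
  using P_antimono[of "Suc 0" 2] P_1 by auto

lemma P3_in_P2: "a \<in> P 3 \<Longrightarrow> a \<in> P 2"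
  using P_antimono[of 2 3] by auto

lemma m_mult_m: "a \<in> m \<Longrightarrow> b \<in> m \<Longrightarrow> a \<otimes> b \<in> P 2"
  using m_mult_P[of a b "Suc 0"] P_1 by (simp add: numeral_2_eq_2)

lemma m_mult_P2: "a \<in> m \<Longrightarrow> b \<in> P 2 \<Longrightarrow> a \<otimes> b \<in> P 3"
  using m_mult_P[of a b 2] by simp

text \<open>
  The orthogonal complement of \<open>m\<^sup>2\<close> in \<open>m\<close> with respect to the form \<open>(a, b) \<mapsto> l(a b)\<close>.
\<close>

definition W :: "'a set" where
  "W = {a \<in> m. \<forall>b\<in>P 2. a \<otimes> b = \<zero>}"

lemma W_in_m: "a \<in> W \<Longrightarrow> a \<in> m" by (simp add: W_def)

lemma W_closed: "a \<in> W \<Longrightarrow> a \<in> carrier A" by (simp add: W_def mem_m_closed)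

lemma W_mult_P2: "a \<in> W \<Longrightarrow> b \<in> P 2 \<Longrightarrow> a \<otimes> b = \<zero>" by (simp add: W_def)

lemma P2_in_W: "a \<in> P 2 \<Longrightarrow> a \<in> W" by (simp add: W_def P2_in_m P2_mult_P2)

lemma W_ideal: "ideal W A"
proof (rule idealI_closed)
  show "x \<oplus> y \<in> W" if "x \<in> W" "y \<in> W" for x y
    using that W_closed[OF that(1)] W_closed[OF that(2)] P_closed[of _ 2]
    by (auto simp: W_def l_distr intro: ideal_add_closed[OF m_ideal])
  show "x \<otimes> y \<in> W" if "x \<in> carrier A" "y \<in> W" for x y
    using that W_closed[OF that(2)] P_closed[of _ 2]
    by (auto simp: W_def m_assoc intro: ideal.I_l_closed[OF m_ideal])
qed (use W_closed P2_in_W[OF ideal_zero_closed[OF P_ideal]] in auto)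

lemma W_mult_m_socle:
  assumes "a \<in> W" "b \<in> m" "y \<in> m"
  shows "y \<otimes> (a \<otimes> b) = \<zero>"
proof -
  have "y \<otimes> (a \<otimes> b) = a \<otimes> (y \<otimes> b)"
    using W_closed[OF assms(1)] mem_m_closed[OF assms(2)] mem_m_closed[OF assms(3)] by (simp add: m_lcomm)
  thus ?thesis using W_mult_P2[OF assms(1) m_mult_m[OF assms(3,2)]] by simp
qed

end

section \<open>Dual bases and orthogonal families\<close>

lemma (in kalgebra) add_sub_cancel:
  assumes "u \<in> carrier A" "v \<in> carrier A"
  shows "u \<oplus> (v \<oplus> (- 1) \<odot> u) = v"
  using assms by (simp add: smult_minus_one a_lcomm[of u] r_neg)

text \<open>
  The form pairs \<open>m/W\<close> with \<open>m\<^sup>2/m\<^sup>3\<close>; the families \<open>x\<close> and \<open>q\<close> are dual bases for this pairing.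
\<close>

locale gorenstein_dual_bases = gorenstein_functional A m w l
  for A :: "('k::field_char_0, 'a, 'c) module_scheme" (structure) and m w l +
  fixes n :: nat and q x :: "nat \<Rightarrow> 'a"
  assumes q_P2: "i \<in> {1..n} \<Longrightarrow> q i \<in> P 2"
    and q_spanning: "spanning_mod (P 2) (P 3) {1..n} q"
    and x_in_m: "i \<in> {1..n} \<Longrightarrow> x i \<in> m"
    and dual: "i \<in> {1..n} \<Longrightarrow> j \<in> {1..n} \<Longrightarrow> l (x i \<otimes> q j) = (if i = j then 1 else 0)"
begin

lemma q_closed: "i \<in> {1..n} \<Longrightarrow> q i \<in> carrier A"
  by (rule P_closed[OF q_P2])

lemma x_closed: "i \<in> {1..n} \<Longrightarrow> x i \<in> carrier A"
  by (rule mem_m_closed[OF x_in_m])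

lemma lin_comb_q_P2: "lin_comb A {1..n} c q \<in> P 2"
  by (rule lin_comb_ideal[OF P_ideal]) (use q_P2 in blast)

lemma lin_comb_x_m: "lin_comb A {1..n} c x \<in> m"
  by (rule lin_comb_ideal[OF m_ideal]) (use x_in_m in blast)

lemma pairing_lin_comb_q: "y \<in> carrier A \<Longrightarrow> l (y \<otimes> lin_comb A {1..n} c q) = (\<Sum>i\<in>{1..n}. c i * l (y \<otimes> q i))"
  by (rule pairing_lin_comb) (use q_closed in auto)

lemma pairing_lin_comb_x_left: "y \<in> carrier A \<Longrightarrow> l (lin_comb A {1..n} c x \<otimes> y) = (\<Sum>i\<in>{1..n}. c i * l (x i \<otimes> y))"
  by (rule pairing_lin_comb_left) (use x_closed in auto)

lemma pairing_lin_comb_x_q: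
  assumes "k \<in> {1..n}"
  shows "l (lin_comb A {1..n} c x \<otimes> q k) = c k"
proof -
  have "l (lin_comb A {1..n} c x \<otimes> q k) = (\<Sum>i\<in>{1..n}. if i = k then c k else 0)"
    unfolding pairing_lin_comb_x_left[OF q_closed[OF assms]] by (rule sum.cong) (use assms dual in auto)
  thus ?thesis using assms by simp
qed

lemma pairing_x_lin_comb_q:
  assumes "k \<in> {1..n}"
  shows "l (x k \<otimes> lin_comb A {1..n} c q) = c k"
proof -
  have "l (x k \<otimes> lin_comb A {1..n} c q) = (\<Sum>i\<in>{1..n}. if i = k then c k else 0)"
    unfolding pairing_lin_comb_q[OF x_closed[OF assms]] by (rule sum.cong) (use assms dual in auto)
  thus ?thesis using assms by simp
qed

text \<open>
  The products \<open>a q\<^sub>j\<close> lie in \<open>m\<^sup>3 = K w\<close>, where \<open>l\<close> is injective, and \<open>a m\<^sup>3 = 0\<close>.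
\<close>

lemma in_W_if_orthogonal_q:
  assumes a: "a \<in> m" and orth: "\<And>j. j \<in> {1..n} \<Longrightarrow> l (a \<otimes> q j) = 0"
  shows "a \<in> W"
  unfolding W_def
proof (intro CollectI conjI ballI a)
  fix b assume "b \<in> P 2"
  then obtain d t where t: "t \<in> P 3" and b: "b = lin_comb A {1..n} d q \<oplus> t"
    using q_spanning unfolding spanning_mod_def by blast
  have aA: "a \<in> carrier A" by (rule mem_m_closed[OF a])
  have "a \<otimes> lin_comb A {1..n} d q = \<zero>"
    by (rule P3_eq_zero[OF m_mult_P2[OF a lin_comb_q_P2]], unfold pairing_lin_comb_q[OF aA]) (simp add: orth)
  moreover have "a \<otimes> t = \<zero>" by (rule m_mult_P3[OF a t])
  ultimately show "a \<otimes> b = \<zero>"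
    using aA P_closed[OF lin_comb_q_P2] P_closed[OF t] unfolding b by (simp add: r_distr)
qed

lemma decompose_m:
  assumes b: "b \<in> m"
  obtains b' where "b' \<in> W" "b = lin_comb A {1..n} (\<lambda>i. l (b \<otimes> q i)) x \<oplus> b'"
proof -
  let ?u = "lin_comb A {1..n} (\<lambda>i. l (b \<otimes> q i)) x"
  have uA: "?u \<in> carrier A" and bA: "b \<in> carrier A" by (rule mem_m_closed[OF lin_comb_x_m], rule mem_m_closed[OF b])
  have "b \<oplus> (- 1) \<odot> ?u \<in> W"
  proof (rule in_W_if_orthogonal_q)
    show "b \<oplus> (- 1) \<odot> ?u \<in> m"
      by (intro ideal_add_closed[OF m_ideal] ideal_smult_closed[OF m_ideal] b lin_comb_x_m)
    fix j assume j: "j \<in> {1..n}"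
    have "l ((b \<oplus> (- 1) \<odot> ?u) \<otimes> q j) = l (b \<otimes> q j) + (- 1) * l (?u \<otimes> q j)"
      using pairing_add_left[OF q_closed[OF j] bA smult_closed[OF uA]] pairing_smult_left[OF q_closed[OF j] uA] by simp
    thus "l ((b \<oplus> (- 1) \<odot> ?u) \<otimes> q j) = 0" using pairing_lin_comb_x_q[OF j] by simp
  qed
  thus ?thesis using add_sub_cancel[OF uA bA] by (intro that[of "b \<oplus> (- 1) \<odot> ?u"]) simp_all
qed

text \<open>
  The form induced on \<open>W/m\<^sup>2\<close> is nondegenerate. Given \<open>a\<close> in its radical, subtract the element of
  \<open>m\<^sup>2\<close> with the same pairings with the \<open>x\<^sub>i\<close>. The difference \<open>a'\<close> is orthogonal to all \<open>x\<^sub>i\<close> and to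
  \<open>W\<close>, hence to \<open>m\<close>; as \<open>a' m\<close> lies in the socle, \<open>a'\<close> kills \<open>m\<close>, so it lies in the socle itself.
\<close>

lemma W_orthogonal_W_in_P2:
  assumes a: "a \<in> W" and orth: "\<And>b. b \<in> W \<Longrightarrow> l (a \<otimes> b) = 0"
  shows "a \<in> P 2"
proof -
  let ?u = "lin_comb A {1..n} (\<lambda>i. l (x i \<otimes> a)) q"
  define a' where "a' = a \<oplus> (- 1) \<odot> ?u"
  have uA: "?u \<in> carrier A" and aA: "a \<in> carrier A" by (rule P_closed[OF lin_comb_q_P2], rule W_closed[OF a])
  have a'A: "a' \<in> carrier A" using uA aA by (simp add: a'_def)
  have Ba': "l (y \<otimes> a') = l (y \<otimes> a) - l (y \<otimes> ?u)" if "y \<in> carrier A" for y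
    unfolding a'_def using pairing_add[OF that aA smult_closed[OF uA]] pairing_smult[OF that uA] by simp
  have a'W: "a' \<in> W" unfolding a'_def
    by (intro ideal_add_closed[OF W_ideal] ideal_smult_closed[OF W_ideal] a P2_in_W lin_comb_q_P2)
  have "a' \<in> P 3"
  proof (rule socle_in_P3[OF a'A])
    fix b assume b: "b \<in> m"
    have bA: "b \<in> carrier A" by (rule mem_m_closed[OF b])
    obtain b' where b': "b' \<in> W" "b = lin_comb A {1..n} (\<lambda>i. l (b \<otimes> q i)) x \<oplus> b'" by (rule decompose_m[OF b])
    have xa: "l (x i \<otimes> a') = 0" if "i \<in> {1..n}" for i
      using Ba'[OF x_closed[OF that]] pairing_x_lin_comb_q[OF that] by simp
    have "l (b' \<otimes> a') = 0"
      using Ba'[OF W_closed[OF b'(1)]] W_mult_P2[OF b'(1) lin_comb_q_P2] orth[OF b'(1)]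
        pairing_sym[OF W_closed[OF b'(1)] aA] functional_zero[OF lin] by simp
    moreover have "l (lin_comb A {1..n} (\<lambda>i. l (b \<otimes> q i)) x \<otimes> a') = 0"
      unfolding pairing_lin_comb_x_left[OF a'A] using xa by simp
    ultimately have "l (b \<otimes> a') = 0"
      using pairing_add_left[OF a'A mem_m_closed[OF lin_comb_x_m] W_closed[OF b'(1)], of "\<lambda>i. l (b \<otimes> q i)"] b'(2) by simp
    hence l0: "l (a' \<otimes> b) = 0" using pairing_sym[OF a'A bA] by simp
    have "a' \<otimes> b = \<zero>"
    proof (rule socle_eq_zero[OF m_closed[OF a'A bA] _ l0])
      show "y \<otimes> (a' \<otimes> b) = \<zero>" if "y \<in> m" for y by (rule W_mult_m_socle[OF a'W b that])
    qed
    thus "b \<otimes> a' = \<zero>" using m_comm[OF a'A bA] by simp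
  qed
  hence "?u \<oplus> a' \<in> P 2" by (intro ideal_add_closed[OF P_ideal] lin_comb_q_P2 P3_in_P2)
  thus ?thesis using add_sub_cancel[OF uA aA] by (simp add: a'_def)
qed

text \<open>
  The indices start at \<open>n + 1\<close> to match the variables \<open>x\<^sub>n\<^sub>+\<^sub>1, \<dots>, x\<^sub>h\<close>, and the value \<open>2\<close> is the
  one that \<open>x\<^sub>j\<^sup>2\<close> takes on \<open>y\<^sub>j\<^sup>2\<close>.
\<close>

definition orthogonal_family :: "nat \<Rightarrow> (nat \<Rightarrow> 'a) \<Rightarrow> bool" where
  "orthogonal_family r z \<longleftrightarrow> (\<forall>j\<in>{n+1..n+r}. z j \<in> W) \<and>
     (\<forall>i\<in>{n+1..n+r}. \<forall>j\<in>{n+1..n+r}. l (z i \<otimes> z j) = (if i = j then 2 else 0))"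

definition joined :: "(nat \<Rightarrow> 'a) \<Rightarrow> nat \<Rightarrow> 'a" where
  "joined z i = (if i \<le> n then x i else z i)"

lemma joined_in_m:
  assumes "orthogonal_family r z"
  shows "joined z \<in> {1..n+r} \<rightarrow> m"
  using assms x_in_m W_in_m by (auto simp: joined_def orthogonal_family_def)

text \<open>
  Pairing a combination that lies in \<open>m\<^sup>2\<close> with \<open>q\<^sub>k\<close> isolates the coefficient of \<open>x\<^sub>k\<close>, since the
  \<open>z\<^sub>j\<close> and \<open>m\<^sup>2\<close> are orthogonal to \<open>m\<^sup>2\<close>; pairing it with \<open>z\<^sub>k\<close> then isolates the coefficient of \<open>z\<^sub>k\<close>.
\<close>

lemma joined_independent:
  assumes z: "orthogonal_family r z"
  shows "independent_mod (P 2) {1..n+r} (joined z)"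
  unfolding independent_mod_def
proof (intro allI impI)
  fix c assume c: "lin_comb A {1..n+r} c (joined z) \<in> P 2"
  have jA: "joined z \<in> {1..n+r} \<rightarrow> carrier A" using joined_in_m[OF z] mem_m_closed by blast
  have zW: "z j \<in> W" if "j \<in> {n+1..n+r}" for j using z that by (simp add: orthogonal_family_def)
  have zz: "l (z i \<otimes> z j) = (if i = j then 2 else 0)" if "i \<in> {n+1..n+r}" "j \<in> {n+1..n+r}" for i j
    using z that by (simp add: orthogonal_family_def)
  have B: "l (lin_comb A {1..n+r} c (joined z) \<otimes> y) = (\<Sum>i\<in>{1..n+r}. c i * l (joined z i \<otimes> y))"
    if "y \<in> carrier A" for y by (rule pairing_lin_comb_left[OF that jA])
  have cn: "c k = 0" if k: "k \<in> {1..n}" for k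
  proof -
    have "l (joined z i \<otimes> q k) = (if i = k then 1 else 0)" if i: "i \<in> {1..n+r}" for i
    proof (cases "i \<le> n")
      case True
      thus ?thesis using i k dual by (simp add: joined_def)
    next
      case False
      hence "z i \<otimes> q k = \<zero>" using i by (intro W_mult_P2[OF zW q_P2[OF k]]) simp
      thus ?thesis using False k functional_zero[OF lin] by (simp add: joined_def)
    qed
    hence "(\<Sum>i\<in>{1..n+r}. c i * l (joined z i \<otimes> q k)) = (\<Sum>i\<in>{1..n+r}. if i = k then c k else 0)"
      by (intro sum.cong) auto
    hence "l (lin_comb A {1..n+r} c (joined z) \<otimes> q k) = c k"
      using B[OF q_closed[OF k]] k by simp
    thus ?thesis using P2_mult_P2[OF c q_P2[OF k]] functional_zero[OF lin] by simp
  qed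
  have cz: "c k = 0" if k: "k \<in> {n+1..n+r}" for k
  proof -
    have zk: "z k \<in> W" by (rule zW[OF k])
    have "(\<Sum>i\<in>{1..n+r}. c i * l (joined z i \<otimes> z k)) = (\<Sum>i\<in>{1..n+r}. if i = k then 2 * c k else 0)"
    proof (rule sum.cong[OF refl])
      fix i assume i: "i \<in> {1..n+r}"
      show "c i * l (joined z i \<otimes> z k) = (if i = k then 2 * c k else 0)"
      proof (cases "i \<le> n")
        case True
        thus ?thesis using i k cn[of i] by simp
      next
        case False
        thus ?thesis using i k zz[of i k] by (simp add: joined_def)
      qed
    qed
    hence "l (lin_comb A {1..n+r} c (joined z) \<otimes> z k) = 2 * c k"
      using B[OF W_closed[OF zk]] k by simp
    moreover have "lin_comb A {1..n+r} c (joined z) \<otimes> z k = \<zero>"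
      using W_mult_P2[OF zk c] m_comm[OF W_closed[OF zk] P_closed[OF c]] by simp
    ultimately show ?thesis using functional_zero[OF lin] by simp
  qed
  show "\<forall>i\<in>{1..n+r}. c i = 0"
  proof
    fix i assume "i \<in> {1..n+r}"
    thus "c i = 0" using cn[of i] cz[of i] by (cases "i \<le> n") auto
  qed
qed

lemma lin_comb_z_W:
  assumes "orthogonal_family r z"
  shows "lin_comb A {n+1..n+r} c z \<in> W"
  by (rule lin_comb_ideal[OF W_ideal]) (use assms in \<open>auto simp: orthogonal_family_def\<close>)

lemma pairing_lin_comb_z:
  assumes z: "orthogonal_family r z" and k: "k \<in> {n+1..n+r}"
  shows "l (z k \<otimes> lin_comb A {n+1..n+r} c z) = 2 * c k"
proof -
  have zA: "z \<in> {n+1..n+r} \<rightarrow> carrier A" using z W_closed by (auto simp: orthogonal_family_def)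
  have "z k \<in> carrier A" using zA k by blast
  hence "l (z k \<otimes> lin_comb A {n+1..n+r} c z) = (\<Sum>i\<in>{n+1..n+r}. c i * l (z k \<otimes> z i))"
    by (rule pairing_lin_comb[OF _ zA])
  also have "\<dots> = (\<Sum>i\<in>{n+1..n+r}. if i = k then 2 * c k else 0)"
  proof (rule sum.cong[OF refl])
    fix i assume i: "i \<in> {n+1..n+r}"
    have "l (z k \<otimes> z i) = (if k = i then 2 else 0)" using z i k unfolding orthogonal_family_def by blast
    thus "c i * l (z k \<otimes> z i) = (if i = k then 2 * c k else 0)" by simp
  qed
  finally show ?thesis using k by simp
qed

text \<open>
  On the orthogonal complement in \<open>W\<close> of a maximal orthogonal family every vector is isotropic,
  because a nonisotropic one could be rescaled with a square root and added to the family. By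
  polarisation the form vanishes on this complement, which therefore lies in the radical \<open>m\<^sup>2\<close>.
\<close>

lemma maximal_orthogonal_family_spans:
  assumes sqrt: "\<And>t::'k. \<exists>s. s * s = t"
    and z: "orthogonal_family r z" and max: "\<And>z'. \<not> orthogonal_family (Suc r) z'"
    and b: "b \<in> W"
  obtains c t where "t \<in> P 2" "b = lin_comb A {n+1..n+r} c z \<oplus> t"
proof -
  let ?N = "{n+1..n+r}"
  have zW: "z j \<in> W" if "j \<in> ?N" for j using z that by (simp add: orthogonal_family_def)
  have zA: "z j \<in> carrier A" if "j \<in> ?N" for j by (rule W_closed[OF zW[OF that]])
  have isotropic: "l (c \<otimes> c) = 0" if c: "c \<in> W" and orth: "\<And>j. j \<in> ?N \<Longrightarrow> l (z j \<otimes> c) = 0" for c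
  proof (rule ccontr)
    assume nz: "l (c \<otimes> c) \<noteq> 0"
    \<comment> \<open>\<open>s c\<close> has the norm \<open>2\<close> required of a new member\<close>
    obtain s where s: "s * s = 2 / l (c \<otimes> c)" using sqrt by blast
    have cA: "c \<in> carrier A" by (rule W_closed[OF c])
    let ?z = "z(n + Suc r := s \<odot> c)"
    have "orthogonal_family (Suc r) ?z" unfolding orthogonal_family_def
    proof (intro conjI ballI)
      fix j assume "j \<in> {n+1..n+Suc r}"
      thus "?z j \<in> W" using zW[of j] ideal_smult_closed[OF W_ideal c] by (cases "j = n + Suc r") auto
    next
      fix i j assume ij: "i \<in> {n+1..n+Suc r}" "j \<in> {n+1..n+Suc r}"
      have new: "l (z k \<otimes> (s \<odot> c)) = 0" if "k \<in> ?N" for k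
        using pairing_smult[OF zA[OF that] cA] orth[OF that] by simp
      have new': "l ((s \<odot> c) \<otimes> z k) = 0" if "k \<in> ?N" for k
        using new[OF that] pairing_sym[OF zA[OF that] smult_closed[OF cA]] by simp
      have cc: "l ((s \<odot> c) \<otimes> (s \<odot> c)) = 2"
        using pairing_smult[OF smult_closed[OF cA] cA] pairing_smult_left[OF cA cA] s nz by (simp flip: mult.assoc)
      have old: "l (z i \<otimes> z j) = (if i = j then 2 else 0)" if "i \<in> ?N" "j \<in> ?N"
        using z that unfolding orthogonal_family_def by blast
      show "l (?z i \<otimes> ?z j) = (if i = j then 2 else 0)"
        using ij new[of i] new'[of j] cc old by (cases "i = n + Suc r"; cases "j = n + Suc r") auto
    qed
    thus False using max by blast
  qed
  have orthogonal: "l (c \<otimes> d) = 0"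
    if c: "c \<in> W" "\<And>j. j \<in> ?N \<Longrightarrow> l (z j \<otimes> c) = 0" and d: "d \<in> W" "\<And>j. j \<in> ?N \<Longrightarrow> l (z j \<otimes> d) = 0" for c d
  proof -
    have cA: "c \<in> carrier A" and dA: "d \<in> carrier A" by (rule W_closed[OF c(1)], rule W_closed[OF d(1)])
    have "l ((c \<oplus> d) \<otimes> (c \<oplus> d)) = 0"
      by (rule isotropic) (use c d ideal_add_closed[OF W_ideal c(1) d(1)] pairing_add[OF zA cA dA] in auto)
    moreover have "l ((c \<oplus> d) \<otimes> (c \<oplus> d)) = l (c \<otimes> c) + l (d \<otimes> c) + (l (c \<otimes> d) + l (d \<otimes> d))"
      using pairing_add[OF a_closed[OF cA dA] cA dA] pairing_add_left[OF cA cA dA] pairing_add_left[OF dA cA dA] by simp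
    ultimately have "l (c \<otimes> d) + l (c \<otimes> d) = 0"
      using isotropic[OF c] isotropic[OF d] pairing_sym[OF dA cA] by simp
    thus ?thesis by (simp flip: mult_2)
  qed
  \<comment> \<open>orthogonal projection away from the family; the divisor is \<open>l(z\<^sub>j\<^sup>2) = 2\<close>\<close>
  let ?pr = "\<lambda>e. e \<oplus> (- 1) \<odot> lin_comb A ?N (\<lambda>j. l (z j \<otimes> e) / 2) z"
  have prW: "?pr e \<in> W" if "e \<in> W" for e
    by (intro ideal_add_closed[OF W_ideal] ideal_smult_closed[OF W_ideal] that lin_comb_z_W[OF z])
  have prz: "l (z j \<otimes> ?pr e) = 0" if e: "e \<in> W" and j: "j \<in> ?N" for e j
    using pairing_add[OF zA[OF j] W_closed[OF e] smult_closed[OF W_closed[OF lin_comb_z_W[OF z]]]]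
      pairing_smult[OF zA[OF j] W_closed[OF lin_comb_z_W[OF z]]] pairing_lin_comb_z[OF z j] by simp
  have "?pr b \<in> P 2"
  proof (rule W_orthogonal_W_in_P2[OF prW[OF b]])
    fix e assume e: "e \<in> W"
    let ?u = "lin_comb A ?N (\<lambda>j. l (z j \<otimes> e) / 2) z"
    have uA: "?u \<in> carrier A" by (rule W_closed[OF lin_comb_z_W[OF z]])
    have bA: "?pr b \<in> carrier A" by (rule W_closed[OF prW[OF b]])
    have "l (?pr b \<otimes> e) = l (?pr b \<otimes> (?u \<oplus> ?pr e))"
      using add_sub_cancel[OF uA W_closed[OF e]] by simp
    also have "\<dots> = l (?pr b \<otimes> ?u) + l (?pr b \<otimes> ?pr e)"
      by (rule pairing_add[OF bA uA W_closed[OF prW[OF e]]])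
    also have "l (?pr b \<otimes> ?u) = (\<Sum>j\<in>?N. l (z j \<otimes> e) / 2 * l (?pr b \<otimes> z j))"
      by (rule pairing_lin_comb[OF bA]) (use zA in blast)
    also have "\<dots> = 0" using prz[OF b] pairing_sym[OF bA zA] by simp
    also have "l (?pr b \<otimes> ?pr e) = 0"
      by (rule orthogonal[OF prW[OF b] prz[OF b] prW[OF e] prz[OF e]])
    finally show "l (?pr b \<otimes> e) = 0" by simp
  qed
  moreover have "b = lin_comb A ?N (\<lambda>j. l (z j \<otimes> b) / 2) z \<oplus> ?pr b"
    using add_sub_cancel[OF W_closed[OF lin_comb_z_W[OF z]] W_closed[OF b]] by simp
  ultimately show ?thesis by (rule that)
qed

end

section \<open>Adapted generators\<close>

context gorenstein_dual_bases
begin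

lemma w_in_m: "w \<in> m"
  by (rule P2_in_m[OF P3_in_P2[OF w_P3]])

lemma m_mult_w: "y \<in> m \<Longrightarrow> y \<otimes> w = \<zero>"
  by (rule m_mult_P3[OF _ w_P3])

lemma shift_by_w:
  assumes a: "a \<in> m" and b: "b \<in> m"
  shows "(a \<oplus> c \<odot> w) \<otimes> b = a \<otimes> b" "b \<otimes> (a \<oplus> c \<odot> w) = b \<otimes> a"
proof -
  have A: "a \<in> carrier A" "b \<in> carrier A" by (rule mem_m_closed[OF a], rule mem_m_closed[OF b])
  show "(a \<oplus> c \<odot> w) \<otimes> b = a \<otimes> b"
    using A w_closed m_mult_w[OF b] m_comm[OF w_closed A(2)] by (simp add: l_distr smult_mult_left)
  show "b \<otimes> (a \<oplus> c \<odot> w) = b \<otimes> a"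
    using A w_closed m_mult_w[OF b] by (simp add: r_distr smult_mult_right)
qed

lemma l_shift_by_w: "a \<in> carrier A \<Longrightarrow> l (a \<oplus> (- l a) \<odot> w) = 0"
  using functional_add[OF lin _ smult_closed[OF w_closed]] functional_smult[OF lin w_closed] l_w by simp

lemma normalize_orthogonal_family:
  assumes z: "orthogonal_family r z"
  obtains z' where "orthogonal_family r z'" "\<And>j. j \<in> {n+1..n+r} \<Longrightarrow> l (z' j) = 0"
proof -
  let ?z = "\<lambda>j. z j \<oplus> (- l (z j)) \<odot> w"
  have zW: "z j \<in> W" if "j \<in> {n+1..n+r}" for j using z that by (simp add: orthogonal_family_def)
  have z'W: "?z j \<in> W" if "j \<in> {n+1..n+r}" for j
    by (intro ideal_add_closed[OF W_ideal] ideal_smult_closed[OF W_ideal] zW[OF that] P2_in_W P3_in_P2 w_P3)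
  have "?z i \<otimes> ?z j = z i \<otimes> z j" if "i \<in> {n+1..n+r}" "j \<in> {n+1..n+r}" for i j
    unfolding shift_by_w(1)[OF W_in_m[OF zW[OF that(1)]] W_in_m[OF z'W[OF that(2)]]]
    by (rule shift_by_w(2)[OF W_in_m[OF zW[OF that(2)]] W_in_m[OF zW[OF that(1)]]])
  hence "orthogonal_family r ?z" using z z'W unfolding orthogonal_family_def by simp
  thus ?thesis using l_shift_by_w W_closed[OF zW] by (intro that[of ?z]) auto
qed

text \<open>
  Three successive corrections of the \<open>x\<^sub>i\<close>, each of which preserves the effect of the previous
  ones. The combination \<open>v\<^sub>i\<close> of the \<open>z\<^sub>j\<close> restores orthogonality to the \<open>z\<^sub>j\<close>; the element \<open>u\<^sub>i\<close> of \<open>m\<^sup>2\<close>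
  is chosen by duality so that \<open>l(x\<^sub>j u\<^sub>i)\<close> is half of \<open>- l(x\<^sub>i x\<^sub>j)\<close>, and in \<open>l((x\<^sub>i + u\<^sub>i) (x\<^sub>j + u\<^sub>j))\<close>
  the two halves add up, while \<open>u\<^sub>i u\<^sub>j = 0\<close>; a multiple of \<open>w\<close> finally corrects \<open>l(x\<^sub>i)\<close>.
\<close>

lemma normalize_dual_basis:
  assumes z: "orthogonal_family r z"
  obtains x' where "\<And>i. i \<in> {1..n} \<Longrightarrow> x' i \<in> m"
    and "\<And>i k. i \<in> {1..n} \<Longrightarrow> k \<in> {1..n} \<Longrightarrow> l (x' i \<otimes> q k) = (if i = k then 1 else 0)"
    and "\<And>i. i \<in> {1..n} \<Longrightarrow> l (x' i) = 0"
    and "\<And>i j. i \<in> {1..n} \<Longrightarrow> j \<in> {1..n} \<Longrightarrow> l (x' i \<otimes> x' j) = 0"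
    and "\<And>i k. i \<in> {1..n} \<Longrightarrow> k \<in> {n+1..n+r} \<Longrightarrow> l (z k \<otimes> x' i) = 0"
proof -
  let ?N = "{n+1..n+r}"
  have zW: "z j \<in> W" if "j \<in> ?N" for j using z that by (simp add: orthogonal_family_def)
  have zA: "z j \<in> carrier A" if "j \<in> ?N" for j by (rule W_closed[OF zW[OF that]])
  define v where "v i = lin_comb A ?N (\<lambda>j. - l (z j \<otimes> x i) / 2) z" for i
  have vW: "v i \<in> W" for i unfolding v_def by (rule lin_comb_z_W[OF z])
  have vA: "v i \<in> carrier A" for i by (rule W_closed[OF vW])
  define x1 where "x1 i = x i \<oplus> v i" for i
  have x1m: "x1 i \<in> m" if "i \<in> {1..n}" for i
    unfolding x1_def by (rule ideal_add_closed[OF m_ideal x_in_m[OF that] W_in_m[OF vW]])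
  have x1A: "x1 i \<in> carrier A" if "i \<in> {1..n}" for i by (rule mem_m_closed[OF x1m[OF that]])
  have zx1: "l (z k \<otimes> x1 i) = 0" if "i \<in> {1..n}" "k \<in> ?N" for i k
    unfolding x1_def pairing_add[OF zA[OF that(2)] x_closed[OF that(1)] vA]
    unfolding v_def pairing_lin_comb_z[OF z that(2)] by simp
  have x1P: "x1 i \<otimes> t = x i \<otimes> t" if "i \<in> {1..n}" "t \<in> P 2" for i t
    unfolding x1_def using W_mult_P2[OF vW that(2)] x_closed[OF that(1)] vA P_closed[OF that(2)] by (simp add: l_distr)
  define u where "u i = lin_comb A {1..n} (\<lambda>k. - l (x1 i \<otimes> x1 k) / 2) q" for i
  have uP: "u i \<in> P 2" for i unfolding u_def by (rule lin_comb_q_P2)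
  have uA: "u i \<in> carrier A" for i by (rule P_closed[OF uP])
  have x1u: "l (x1 j \<otimes> u i) = - l (x1 i \<otimes> x1 j) / 2" if "j \<in> {1..n}" for i j
    unfolding x1P[OF that uP] unfolding u_def pairing_x_lin_comb_q[OF that] ..
  define x2 where "x2 i = x1 i \<oplus> u i" for i
  have x2m: "x2 i \<in> m" if "i \<in> {1..n}" for i
    unfolding x2_def by (rule ideal_add_closed[OF m_ideal x1m[OF that] P2_in_m[OF uP]])
  have x2A: "x2 i \<in> carrier A" if "i \<in> {1..n}" for i by (rule mem_m_closed[OF x2m[OF that]])
  have x2x2: "l (x2 i \<otimes> x2 j) = 0" if i: "i \<in> {1..n}" and j: "j \<in> {1..n}" for i j
  proof -
    have "l (x2 i \<otimes> x2 j) = l (x2 i \<otimes> x1 j) + l (x2 i \<otimes> u j)"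
      unfolding x2_def[of j] by (rule pairing_add[OF x2A[OF i] x1A[OF j] uA])
    also have "l (x2 i \<otimes> x1 j) = l (x1 i \<otimes> x1 j) + l (u i \<otimes> x1 j)"
      unfolding x2_def by (rule pairing_add_left[OF x1A[OF j] x1A[OF i] uA])
    also have "l (u i \<otimes> x1 j) = - l (x1 i \<otimes> x1 j) / 2"
      using x1u[OF j, of i] pairing_sym[OF uA x1A[OF j]] by simp
    also have "l (x2 i \<otimes> u j) = l (x1 i \<otimes> u j) + l (u i \<otimes> u j)"
      unfolding x2_def by (rule pairing_add_left[OF uA x1A[OF i] uA])
    also have "l (x1 i \<otimes> u j) = - l (x1 i \<otimes> x1 j) / 2"
      using x1u[OF i, of j] pairing_sym[OF x1A[OF j] x1A[OF i]] by simp
    also have "u i \<otimes> u j = \<zero>" by (rule P2_mult_P2[OF uP uP])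
    finally show ?thesis using functional_zero[OF lin] by simp
  qed
  have x2q: "l (x2 i \<otimes> q k) = (if i = k then 1 else 0)" if i: "i \<in> {1..n}" and k: "k \<in> {1..n}" for i k
    unfolding x2_def pairing_add_left[OF q_closed[OF k] x1A[OF i] uA] P2_mult_P2[OF uP q_P2[OF k]]
      x1P[OF i q_P2[OF k]] dual[OF i k] functional_zero[OF lin] by simp
  have zx2: "l (z k \<otimes> x2 i) = 0" if i: "i \<in> {1..n}" and k: "k \<in> ?N" for i k
    unfolding x2_def pairing_add[OF zA[OF k] x1A[OF i] uA] zx1[OF i k] W_mult_P2[OF zW[OF k] uP]
      functional_zero[OF lin] by simp
  let ?x = "\<lambda>i. x2 i \<oplus> (- l (x2 i)) \<odot> w"
  have xm: "?x i \<in> m" if "i \<in> {1..n}" for i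
    by (intro ideal_add_closed[OF m_ideal] ideal_smult_closed[OF m_ideal] x2m[OF that] w_in_m)
  show ?thesis
  proof (rule that[of ?x])
    fix i assume i: "i \<in> {1..n}"
    show "?x i \<in> m" by (rule xm[OF i])
    show "l (?x i) = 0" by (rule l_shift_by_w[OF x2A[OF i]])
    show "l (?x i \<otimes> q k) = (if i = k then 1 else 0)" if k: "k \<in> {1..n}" for k
      unfolding shift_by_w(1)[OF x2m[OF i] P2_in_m[OF q_P2[OF k]]] by (rule x2q[OF i k])
    show "l (?x i \<otimes> ?x j) = 0" if j: "j \<in> {1..n}" for j
      unfolding shift_by_w(1)[OF x2m[OF i] xm[OF j]] shift_by_w(2)[OF x2m[OF j] x2m[OF i]] by (rule x2x2[OF i j])
    show "l (z k \<otimes> ?x i) = 0" if k: "k \<in> ?N" for k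
      unfolding shift_by_w(2)[OF x2m[OF i] W_in_m[OF zW[OF k]]] by (rule zx2[OF i k])
  qed
qed

lemma lin_comb_joined:
  assumes z: "orthogonal_family r z"
  shows "lin_comb A {1..n+r} (\<lambda>i. if i \<le> n then c i else d i) (joined z) = lin_comb A {1..n} c x \<oplus> lin_comb A {n+1..n+r} d z"
proof -
  have jA: "joined z i \<in> carrier A" if "i \<in> {1..n+r}" for i using joined_in_m[OF z] mem_m_closed that by blast
  have zA: "z j \<in> carrier A" if "j \<in> {n+1..n+r}" for j using z that W_closed by (simp add: orthogonal_family_def)
  have split: "{1..n+r} = {1..n} \<union> {n+1..n+r}" by auto
  let ?c = "\<lambda>i. if i \<le> n then c i else d i"
  have "lin_comb A {1..n+r} ?c (joined z) =
     finsum A (\<lambda>i. ?c i \<odot> joined z i) {1..n} \<oplus> finsum A (\<lambda>i. ?c i \<odot> joined z i) {n+1..n+r}"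
    unfolding lin_comb_def split by (rule finsum_Un_disjoint) (use jA in auto)
  also have "finsum A (\<lambda>i. ?c i \<odot> joined z i) {1..n} = lin_comb A {1..n} c x"
    unfolding lin_comb_def by (rule finsum_cong') (use x_closed in \<open>auto simp: joined_def\<close>)
  also have "finsum A (\<lambda>i. ?c i \<odot> joined z i) {n+1..n+r} = lin_comb A {n+1..n+r} d z"
    unfolding lin_comb_def by (rule finsum_cong') (use zA in \<open>auto simp: joined_def\<close>)
  finally show ?thesis .
qed

lemma joined_spanning:
  assumes sqrt: "\<And>t::'k. \<exists>s. s * s = t"
    and z: "orthogonal_family r z" and max: "\<And>z'. \<not> orthogonal_family (Suc r) z'"
  shows "spanning_mod m (P 2) {1..n+r} (joined z)"
  unfolding spanning_mod_def
proof
  fix b assume b: "b \<in> m"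
  obtain b' where b': "b' \<in> W" "b = lin_comb A {1..n} (\<lambda>i. l (b \<otimes> q i)) x \<oplus> b'" by (rule decompose_m[OF b])
  obtain d t where t: "t \<in> P 2" "b' = lin_comb A {n+1..n+r} d z \<oplus> t"
    by (rule maximal_orthogonal_family_spans[OF sqrt z max b'(1)])
  have "b = lin_comb A {1..n+r} (\<lambda>i. if i \<le> n then l (b \<otimes> q i) else d i) (joined z) \<oplus> t"
    unfolding lin_comb_joined[OF z] using b'(2) unfolding t(2)
    using mem_m_closed[OF lin_comb_x_m] W_closed[OF lin_comb_z_W[OF z]] P_closed[OF t(1)] by (simp add: a_assoc)
  thus "\<exists>c. \<exists>t\<in>P 2. b = lin_comb A {1..n+r} c (joined z) \<oplus> t" using t(1) by blast
qed

text \<open>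
  The size of an orthogonal family is bounded by \<open>h\<close>, so a maximal one exists. It is normalised,
  and so are the \<open>x\<^sub>i\<close> relative to it. The two families together form a basis of \<open>m/m\<^sup>2\<close>, so
  their number is \<open>h\<close>.
\<close>

theorem adapted_generators_exist:
  assumes sqrt: "\<And>t::'k. \<exists>s. s * s = t" and fd: "vectorspace.fin_dim ground A"
    and h: "vectorspace.dim ground (quotient_space A m (P 2)) = h"
  obtains \<xi> where "n \<le> h" "\<xi> \<in> {1..h} \<rightarrow> m"
    and "\<And>i. i \<in> {1..h} \<Longrightarrow> l (\<xi> i) = 0"
    and "\<And>i j. i \<in> {1..h} \<Longrightarrow> j \<in> {1..h} \<Longrightarrow> l (\<xi> i \<otimes> \<xi> j) = (if i = j \<and> n < i then 2 else 0)"
    and "\<And>j b. j \<in> {n+1..h} \<Longrightarrow> b \<in> P 2 \<Longrightarrow> \<xi> j \<otimes> b = \<zero>"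
    and "\<And>i k. i \<in> {1..n} \<Longrightarrow> k \<in> {1..n} \<Longrightarrow> l (\<xi> i \<otimes> q k) = (if i = k then 1 else 0)"
    and "spanning_mod m (P 2) {1..h} \<xi>"
proof -
  have P2m: "P 2 \<subseteq> m" using P2_in_m by blast
  have bound: "n + r \<le> h" if "orthogonal_family r z" for r z
    using independent_mod_card_le[OF m_ideal P_ideal P2m fd _ joined_in_m[OF that] joined_independent[OF that]]
    unfolding h by simp
  let ?ex = "\<lambda>r. \<exists>z. orthogonal_family r z"
  define r where "r = (GREATEST r. ?ex r)"
  have ex0: "?ex 0" by (simp add: orthogonal_family_def)
  have le: "r' \<le> h" if "?ex r'" for r' using bound that by fastforce
  obtain z0 where z0: "orthogonal_family r z0"
    using GreatestI_nat[of ?ex 0 h, OF ex0] le unfolding r_def by blast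
  have max: "\<not> orthogonal_family (Suc r) z'" for z'
  proof
    assume "orthogonal_family (Suc r) z'"
    hence "Suc r \<le> r" unfolding r_def by (intro Greatest_le_nat[of ?ex "Suc (GREATEST r. ?ex r)" h]) (use le in auto)
    thus False by simp
  qed
  obtain z where z: "orthogonal_family r z" and lz: "\<And>j. j \<in> {n+1..n+r} \<Longrightarrow> l (z j) = 0"
    by (rule normalize_orthogonal_family[OF z0]) (rule that; assumption)
  obtain x' where x': "\<And>i. i \<in> {1..n} \<Longrightarrow> x' i \<in> m"
    "\<And>i k. i \<in> {1..n} \<Longrightarrow> k \<in> {1..n} \<Longrightarrow> l (x' i \<otimes> q k) = (if i = k then 1 else 0)"
    "\<And>i. i \<in> {1..n} \<Longrightarrow> l (x' i) = 0"
    "\<And>i j. i \<in> {1..n} \<Longrightarrow> j \<in> {1..n} \<Longrightarrow> l (x' i \<otimes> x' j) = 0"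
    "\<And>i k. i \<in> {1..n} \<Longrightarrow> k \<in> {n+1..n+r} \<Longrightarrow> l (z k \<otimes> x' i) = 0"
    by (rule normalize_dual_basis[OF z]) (rule that; assumption)
  \<comment> \<open>Orthogonal families do not depend on \<open>x\<close>, so \<open>r\<close> is also the maximal size relative to \<open>x'\<close>.\<close>
  interpret D: gorenstein_dual_bases A m w l n q x'
    by unfold_locales (fact q_P2 q_spanning x'(1,2))+
  have Dz: "D.orthogonal_family r z" using z unfolding orthogonal_family_def D.orthogonal_family_def .
  have Dmax: "\<not> D.orthogonal_family (Suc r) z'" for z'
    using max unfolding orthogonal_family_def D.orthogonal_family_def .
  let ?X = "D.joined z"
  note ind = D.joined_independent[OF Dz] and span = D.joined_spanning[OF sqrt Dz Dmax]
  have hr: "h = n + r"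
    using dim_quotient_eq_card[OF m_ideal P_ideal P2m _ D.joined_in_m[OF Dz] ind span] unfolding h by simp
  have zW: "z j \<in> W" if "j \<in> {n+1..n+r}" for j using z that by (simp add: orthogonal_family_def)
  show ?thesis
  proof (rule that[of ?X])
    show "n \<le> h" using hr by simp
    show "?X \<in> {1..h} \<rightarrow> m" unfolding hr by (rule D.joined_in_m[OF Dz])
    show "spanning_mod m (P 2) {1..h} ?X" unfolding hr by (rule span)
    show "l (?X i) = 0" if "i \<in> {1..h}" for i
      using that x'(3)[of i] lz[of i] unfolding hr D.joined_def by (cases "i \<le> n") auto
    show "?X j \<otimes> b = \<zero>" if "j \<in> {n+1..h}" "b \<in> P 2" for j b
      using that W_mult_P2[OF zW] unfolding hr D.joined_def by auto
    show "l (?X i \<otimes> q k) = (if i = k then 1 else 0)" if "i \<in> {1..n}" "k \<in> {1..n}" for i k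
      using x'(2)[OF that] that unfolding D.joined_def by auto
    fix i j assume i: "i \<in> {1..h}" and j: "j \<in> {1..h}"
    consider "i \<le> n" "j \<le> n" | "i \<le> n" "n < j" | "n < i" "j \<le> n" | "n < i" "n < j" by linarith
    thus "l (?X i \<otimes> ?X j) = (if i = j \<and> n < i then 2 else 0)"
    proof cases
      case 1
      thus ?thesis using x'(4)[of i j] i j by (simp add: D.joined_def)
    next
      case 2
      hence i': "i \<in> {1..n}" and j': "j \<in> {n+1..n+r}" using i j hr by auto
      have "l (x' i \<otimes> z j) = 0"
        using x'(5)[OF i' j'] pairing_sym[OF W_closed[OF zW[OF j']] mem_m_closed[OF x'(1)[OF i']]] by simp
      thus ?thesis using 2 by (simp add: D.joined_def)
    next
      case 3
      thus ?thesis using x'(5)[of j i] i j hr by (simp add: D.joined_def)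
    next
      case 4
      hence "i \<in> {n+1..n+r}" "j \<in> {n+1..n+r}" using i j hr by auto
      hence "l (z i \<otimes> z j) = (if i = j then 2 else 0)" using z unfolding orthogonal_family_def by blast
      thus ?thesis using 4 by (simp add: D.joined_def)
    qed
  qed
qed

end

section \<open>Evaluation of power series at adapted generators\<close>

locale adapted_generators = gorenstein_functional A m w l
  for A :: "('k::field_char_0, 'a, 'c) module_scheme" (structure) and m w l +
  fixes n h :: nat and q \<xi> :: "nat \<Rightarrow> 'a"
  assumes residue: "a \<in> carrier A \<Longrightarrow> \<exists>c. a \<oplus> (- c) \<odot> \<one> \<in> m"
    and n_le_h: "n \<le> h"
    and q_P2: "i \<in> {1..n} \<Longrightarrow> q i \<in> P 2"
    and gens_in_m: "\<xi> \<in> {1..h} \<rightarrow> m"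
    and l_gen: "i \<in> {1..h} \<Longrightarrow> l (\<xi> i) = 0"
    and l_gen_gen: "i \<in> {1..h} \<Longrightarrow> j \<in> {1..h} \<Longrightarrow> l (\<xi> i \<otimes> \<xi> j) = (if i = j \<and> n < i then 2 else 0)"
    and gen_mult_P2: "j \<in> {n+1..h} \<Longrightarrow> b \<in> P 2 \<Longrightarrow> \<xi> j \<otimes> b = \<zero>"
    and l_gen_q: "i \<in> {1..n} \<Longrightarrow> k \<in> {1..n} \<Longrightarrow> l (\<xi> i \<otimes> q k) = (if i = k then 1 else 0)"
    and gens_spanning: "spanning_mod m (P 2) {1..h} \<xi>"
begin

lemma gen_in_m: "i \<in> {1..h} \<Longrightarrow> \<xi> i \<in> m" using gens_in_m by blast

lemma gen_closed: "i \<in> {1..h} \<Longrightarrow> \<xi> i \<in> carrier A" by (rule mem_m_closed[OF gen_in_m])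

text \<open>
  The value at the generators of the monomial with exponent \<open>a\<close>. All other variables
  are sent to zero, which keeps \<open>mon\<close> multiplicative.
\<close>

definition mon :: "exponent \<Rightarrow> 'a" where
  "mon a = (if keys a \<subseteq> {1..h} then finprod A (\<lambda>i. \<xi> i [^] lookup a i) {1..h} else \<zero>)"

lemma mon_closed: "mon a \<in> carrier A"
  unfolding mon_def using gen_closed by (auto intro!: finprod_closed nat_pow_closed simp del: One_nat_def)

lemma mon_0: "mon 0 = \<one>"
  by (simp add: mon_def)

lemma mon_add: "mon (a + b) = mon a \<otimes> mon b"
proof (cases "keys a \<subseteq> {1..h} \<and> keys b \<subseteq> {1..h}")
  case True
  let ?p = "\<lambda>a. finprod A (\<lambda>i. \<xi> i [^] lookup a i) {1..h}"
  have "?p (a + b) = finprod A (\<lambda>i. \<xi> i [^] lookup a i \<otimes> \<xi> i [^] lookup b i) {1..h}"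
    by (rule finprod_cong') (auto simp: lookup_add nat_pow_mult gen_closed simp del: One_nat_def)
  also have "\<dots> = ?p a \<otimes> ?p b"
    by (rule finprod_multf) (auto simp: gen_closed simp del: One_nat_def)
  finally show ?thesis using True by (simp only: mon_def keys_add_exponent Un_subset_iff simp_thms if_True)
next
  case False
  hence "mon a = \<zero> \<or> mon b = \<zero>" by (auto simp: mon_def)
  moreover have "mon (a + b) = \<zero>" using False by (simp only: mon_def keys_add_exponent Un_subset_iff if_False)
  ultimately show ?thesis using mon_closed[of a] mon_closed[of b] by auto
qed

lemma mon_single:
  assumes i: "i \<in> {1..h}"
  shows "mon (single i 1) = \<xi> i"
proof -
  have "finprod A (\<lambda>j. \<xi> j [^] lookup (single i (1::nat)) j) {1..h} =
     finprod A (\<lambda>j. if i = j then \<xi> j else \<one>) {1..h}"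
  proof (rule finprod_cong'[OF refl])
    fix j assume "j \<in> {1..h}"
    thus "\<xi> j [^] lookup (single i (1::nat)) j = (if i = j then \<xi> j else \<one>)"
      using gen_closed[of j] by (simp add: lookup_single when_def)
  qed (use gen_closed in auto)
  also have "\<dots> = \<xi> i" by (rule finprod_singleton) (use i gen_closed in auto)
  finally show ?thesis using i by (simp add: mon_def)
qed

lemma mon_P: "mon a \<in> P (total_degree a)"
proof (induction "total_degree a" arbitrary: a)
  case 0
  thus ?case by (simp add: mon_closed)
next
  case (Suc k)
  show ?case
  proof (cases "keys a \<subseteq> {1..h}")
    case True
    have "a \<noteq> 0" using Suc(2) by auto
    then obtain i b where i: "i \<in> keys a" and b: "a = single i 1 + b"
      by (rule exponent_nonzero_split)
    have k: "k = total_degree b" using Suc(2) unfolding b by simp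
    have ih: "i \<in> {1..h}" using i True by blast
    have "\<xi> i \<otimes> mon b \<in> P (Suc k)" using m_mult_P[OF gen_in_m[OF ih] Suc(1)[OF k]] k by simp
    moreover have "mon a = \<xi> i \<otimes> mon b" unfolding b mon_add mon_single[OF ih] ..
    ultimately show ?thesis using Suc(2) by simp
  next
    case False
    thus ?thesis using ideal_zero_closed[OF P_ideal] by (simp add: mon_def)
  qed
qed

definition \<mu> :: "exponent \<Rightarrow> 'k" where "\<mu> a = l (mon a)"

lemma mon_eq_zero: "total_degree a > 3 \<Longrightarrow> mon a = \<zero>"
  by (rule P_eq_zero[OF mon_P]) simp

lemma vanishes_above_l_mon:
  assumes "y \<in> carrier A"
  shows "vanishes_above 3 (\<lambda>a. l (y \<otimes> mon a))"
  unfolding vanishes_above_def using mon_eq_zero assms functional_zero[OF lin] by simp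

lemma vanishes_above_\<mu>: "vanishes_above 3 \<mu>"
  unfolding vanishes_above_def \<mu>_def using mon_eq_zero functional_zero[OF lin] by simp

abbreviation "R \<equiv> power_series h :: ('k, exponent \<Rightarrow> 'k) module"

sublocale R: kalgebra R by (rule kalgebra_power_series)

abbreviation "L \<equiv> low_exponents h 3"

definition \<psi> :: "(exponent \<Rightarrow> 'k) \<Rightarrow> 'a" where "\<psi> f = lin_comb A L f mon"

lemma \<psi>_closed: "\<psi> f \<in> carrier A"
  unfolding \<psi>_def by (rule lin_comb_carrier) (use mon_closed in blast)

lemma pairing_\<psi>: "y \<in> carrier A \<Longrightarrow> l (y \<otimes> \<psi> f) = (\<Sum>c\<in>L. f c * l (y \<otimes> mon c))"
  unfolding \<psi>_def by (rule pairing_lin_comb) (use mon_closed in auto)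

lemma \<psi>_add: "\<psi> (f \<oplus>\<^bsub>R\<^esub> g) = \<psi> f \<oplus> \<psi> g"
  by (rule eq_by_functional)
     (simp_all add: \<psi>_closed pairing_\<psi> pairing_add power_series_simps(4) distrib_right sum.distrib)

lemma \<psi>_smult: "\<psi> (c \<odot>\<^bsub>R\<^esub> f) = c \<odot> \<psi> f"
  by (rule eq_by_functional)
     (simp_all add: \<psi>_closed pairing_\<psi> pairing_smult power_series_simps(6) sum_distrib_left mult.assoc)

lemma \<psi>_monomial:
  assumes "e \<in> L"
  shows "\<psi> (monomial e) = mon e"
  by (rule eq_by_functional) (simp_all add: \<psi>_closed mon_closed pairing_\<psi> sum_monomial assms)

lemma \<psi>_one: "\<psi> \<one>\<^bsub>R\<^esub> = \<one>"
proof -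
  have "\<one>\<^bsub>R\<^esub> = monomial 0" by (simp add: power_series_simps monomial_def)
  moreover have "0 \<in> L" by (simp add: low_exponents_def)
  ultimately show ?thesis using \<psi>_monomial[of 0] mon_0 by simp
qed

text \<open>
  An element of \<open>A\<close> is determined by its pairings, so the identity may be tested under \<open>l\<close>,
  where it becomes an identity between finite sums in the ground field.
\<close>

lemma \<psi>_mult:
  assumes f: "f \<in> carrier R" and g: "g \<in> carrier R"
  shows "\<psi> (f \<otimes>\<^bsub>R\<^esub> g) = \<psi> f \<otimes> \<psi> g"
proof (rule eq_by_functional[OF \<psi>_closed m_closed[OF \<psi>_closed \<psi>_closed]])
  fix y assume y: "y \<in> carrier A"
  have ym: "y \<otimes> mon c \<in> carrier A" for c using y mon_closed by simp
  have "l (y \<otimes> \<psi> (f \<otimes>\<^bsub>R\<^esub> g)) = (\<Sum>a\<in>L. (f \<otimes>\<^bsub>R\<^esub> g) a * l (y \<otimes> mon (a + 0)))"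
    unfolding pairing_\<psi>[OF y] by simp
  also have "\<dots> = (\<Sum>c\<in>L. f c * (\<Sum>e\<in>L. g e * l (y \<otimes> mon (e + (c + 0)))))"
    by (rule moment_conv[OF f g vanishes_above_l_mon[OF y]])
  also have "\<dots> = (\<Sum>c\<in>L. f c * l ((y \<otimes> \<psi> g) \<otimes> mon c))"
  proof (rule sum.cong[OF refl])
    fix c
    have "(\<Sum>e\<in>L. g e * l (y \<otimes> mon (e + (c + 0)))) = (\<Sum>e\<in>L. g e * l ((y \<otimes> mon c) \<otimes> mon e))"
      using y mon_closed by (simp add: mon_add m_assoc m_comm[of "mon c"])
    also have "\<dots> = l ((y \<otimes> mon c) \<otimes> \<psi> g)" by (rule pairing_\<psi>[OF ym, symmetric])
    also have "(y \<otimes> mon c) \<otimes> \<psi> g = (y \<otimes> \<psi> g) \<otimes> mon c"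
      using y mon_closed \<psi>_closed by (simp add: m_assoc m_comm[of "mon c"])
    finally show "f c * (\<Sum>e\<in>L. g e * l (y \<otimes> mon (e + (c + 0)))) = f c * l ((y \<otimes> \<psi> g) \<otimes> mon c)" by simp
  qed
  also have "\<dots> = l ((y \<otimes> \<psi> g) \<otimes> \<psi> f)" by (rule pairing_\<psi>[symmetric]) (simp add: y \<psi>_closed)
  also have "(y \<otimes> \<psi> g) \<otimes> \<psi> f = y \<otimes> (\<psi> f \<otimes> \<psi> g)"
    using y \<psi>_closed by (simp add: m_assoc m_comm[of "\<psi> g"])
  finally show "l (y \<otimes> \<psi> (f \<otimes>\<^bsub>R\<^esub> g)) = l (y \<otimes> (\<psi> f \<otimes> \<psi> g))" .
qed

abbreviation "S \<equiv> \<psi> ` carrier R"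

lemma S_closed: "s \<in> S \<Longrightarrow> s \<in> carrier A" using \<psi>_closed by blast

lemma S_zero: "\<zero> \<in> S"
proof -
  have "\<psi> (0 \<odot>\<^bsub>R\<^esub> \<zero>\<^bsub>R\<^esub>) = \<zero>" unfolding \<psi>_smult using \<psi>_closed by simp
  thus ?thesis using imageI[OF R.smult_closed[OF R.zero_closed, of 0], of \<psi>] by simp
qed

lemma S_add: "s \<in> S \<Longrightarrow> t \<in> S \<Longrightarrow> s \<oplus> t \<in> S"
  by (elim imageE, simp only: \<psi>_add[symmetric]) (rule imageI, rule R.a_closed)

lemma S_smult: "s \<in> S \<Longrightarrow> c \<odot> s \<in> S"
  by (elim imageE, simp only: \<psi>_smult[symmetric]) (rule imageI, rule R.smult_closed)

lemma S_mult: "s \<in> S \<Longrightarrow> t \<in> S \<Longrightarrow> s \<otimes> t \<in> S"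
  by (elim imageE, simp only: \<psi>_mult[symmetric]) (rule imageI, rule R.m_closed)

lemma S_one: "\<one> \<in> S"
  unfolding \<psi>_one[symmetric] by (rule imageI) (rule R.one_closed)

lemma gen_in_S:
  assumes i: "i \<in> {1..h}"
  shows "\<xi> i \<in> S"
proof -
  have keys: "keys (single i (1::nat)) \<subseteq> {1..h}" using i by simp
  hence "single i 1 \<in> L" by (simp add: low_exponents_def)
  hence "\<xi> i = \<psi> (monomial (single i 1))" by (simp only: \<psi>_monomial mon_single[OF i])
  thus ?thesis using imageI[OF monomial_closed[OF keys], of \<psi>] by simp
qed

text \<open>
  The generators span \<open>m\<close> modulo \<open>m\<^sup>2\<close>, hence their products span \<open>m\<^sup>k\<close> modulo \<open>m\<^sup>k\<^sup>+\<^sup>1\<close>. As \<open>m\<^sup>4 = 0\<close>,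
  three applications exhaust \<open>m\<close>.
\<close>

lemma P_decompose:
  assumes "a \<in> P (Suc k)"
  shows "\<exists>s\<in>S \<inter> P (Suc k). \<exists>t\<in>P (Suc (Suc k)). a = s \<oplus> t"
  using assms
proof (induction k arbitrary: a)
  case 0
  then obtain c t where t: "t \<in> P 2" "a = lin_comb A {1..h} c \<xi> \<oplus> t"
    using gens_spanning unfolding P_1 spanning_mod_def by blast
  have "lin_comb A {1..h} c \<xi> \<in> m" by (rule lin_comb_ideal[OF m_ideal gens_in_m])
  moreover have "lin_comb A {1..h} c \<xi> \<in> S"
    by (rule lin_comb_subspace) (use S_closed S_zero S_add S_smult gen_in_S in blast)+
  ultimately show ?case using t unfolding P_1 numeral_2_eq_2 by blast
next
  case (Suc k)
  have "a \<in> ideal_prod A m (P (Suc k))" using Suc.prems unfolding ideal_power.simps(2)[of A m "Suc k"] .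
  thus ?case
  proof (induction rule: ideal_prod.induct)
    case (prod i j)
    obtain c t where t: "t \<in> P 2" "i = lin_comb A {1..h} c \<xi> \<oplus> t"
      using gens_spanning prod(1) unfolding spanning_mod_def by blast
    let ?s = "lin_comb A {1..h} c \<xi>"
    have sm: "?s \<in> m" by (rule lin_comb_ideal[OF m_ideal gens_in_m])
    have sS: "?s \<in> S" by (rule lin_comb_subspace) (use S_closed S_zero S_add S_smult gen_in_S in blast)+
    obtain s' t' where s': "s' \<in> S" "s' \<in> P (Suc k)" and t': "t' \<in> P (Suc (Suc k))" and j: "j = s' \<oplus> t'"
      using Suc.IH[OF prod(2)] by blast
    have A: "?s \<in> carrier A" "t \<in> carrier A" "s' \<in> carrier A" "t' \<in> carrier A"
      using mem_m_closed[OF sm] P_closed t(1) s'(2) t' by auto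
    have "i \<otimes> j = ?s \<otimes> s' \<oplus> (?s \<otimes> t' \<oplus> t \<otimes> j)"
      unfolding j t(2) using A by (simp add: l_distr r_distr a_ac)
    moreover have "?s \<otimes> s' \<in> S \<inter> P (Suc (Suc k))" using S_mult[OF sS s'(1)] m_mult_P[OF sm s'(2)] by blast
    moreover have "?s \<otimes> t' \<oplus> t \<otimes> j \<in> P (Suc (Suc (Suc k)))"
      using P_mult[OF t(1) prod(2)] by (intro ideal_add_closed[OF P_ideal] m_mult_P[OF sm t']) simp
    ultimately show ?case by blast
  next
    case (sum a b)
    obtain s t where s: "s \<in> S" "s \<in> P (Suc (Suc k))" and t: "t \<in> P (Suc (Suc (Suc k)))" "a = s \<oplus> t"
      using sum.IH(1) by blast
    obtain s' t' where s': "s' \<in> S" "s' \<in> P (Suc (Suc k))" and t': "t' \<in> P (Suc (Suc (Suc k)))" "b = s' \<oplus> t'"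
      using sum.IH(2) by blast
    have A: "s \<in> carrier A" "t \<in> carrier A" "s' \<in> carrier A" "t' \<in> carrier A"
      using P_closed s(2) t(1) s'(2) t'(1) by blast+
    have "a \<oplus> b = (s \<oplus> s') \<oplus> (t \<oplus> t')" unfolding t(2) t'(2) using A by (simp add: a_assoc a_lcomm[of t s'])
    thus ?case
      using S_add[OF s(1) s'(1)] ideal_add_closed[OF P_ideal s(2) s'(2)] ideal_add_closed[OF P_ideal t(1) t'(1)] by blast
  qed
qed

lemma m_subset_S: "m \<subseteq> S"
proof
  fix a assume "a \<in> m"
  hence "a \<in> P (Suc 0)" unfolding P_1 .
  then obtain s1 t1 where 1: "s1 \<in> S" "t1 \<in> P (Suc (Suc 0))" "a = s1 \<oplus> t1" using P_decompose by blast
  obtain s2 t2 where 2: "s2 \<in> S" "t2 \<in> P (Suc (Suc (Suc 0)))" "t1 = s2 \<oplus> t2" using P_decompose[OF 1(2)] by blast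
  obtain s3 t3 where 3: "s3 \<in> S" "t3 \<in> P (Suc (Suc (Suc (Suc 0))))" "t2 = s3 \<oplus> t3" using P_decompose[OF 2(2)] by blast
  have "t3 = \<zero>" by (rule P_eq_zero[OF 3(2)]) simp
  hence "t2 \<in> S" unfolding 3(3) using S_add[OF 3(1) S_zero] by simp
  thus "a \<in> S" unfolding 1(3) 2(3) by (rule S_add[OF 1(1) S_add[OF 2(1)]])
qed

lemma \<psi>_surj: "S = carrier A"
proof (intro subset_antisym subsetI)
  fix a assume a: "a \<in> carrier A"
  then obtain c where c: "a \<oplus> (- c) \<odot> \<one> \<in> m" using residue by blast
  have "(a \<oplus> (- c) \<odot> \<one>) \<oplus> c \<odot> \<one> \<in> S" by (intro S_add S_smult S_one subsetD[OF m_subset_S c])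
  moreover have "(a \<oplus> (- c) \<odot> \<one>) \<oplus> c \<odot> \<one> = a"
    using a smult_add_left[OF one_closed, of "- c" c] by (simp add: a_assoc)
  ultimately show "a \<in> S" by simp
qed (rule S_closed)

text \<open>
  The equations defining the annihilator say that \<open>\<psi> f\<close> pairs to zero with all monomials in
  the generators. By surjectivity it then pairs to zero with all of \<open>A\<close>.
\<close>

lemma \<psi>_kernel:
  assumes "f \<in> carrier R"
  shows "\<psi> f = \<zero> \<longleftrightarrow> f \<in> annihilator h 3 \<mu>"
proof -
  have pair: "(\<Sum>a\<in>L. f a * \<mu> (a + b)) = l (mon b \<otimes> \<psi> f)" for b
    unfolding pairing_\<psi>[OF mon_closed] \<mu>_def mon_add using mon_closed by (simp add: m_comm[of "mon b"])
  have "\<psi> f = \<zero>" if *: "\<And>b. l (mon b \<otimes> \<psi> f) = 0"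
  proof (rule nondegenerate[OF \<psi>_closed])
    fix y assume y: "y \<in> carrier A"
    then obtain g where g: "y = \<psi> g" using \<psi>_surj by blast
    have "l (\<psi> f \<otimes> \<psi> g) = 0"
      unfolding pairing_\<psi>[OF \<psi>_closed] using * pairing_sym[OF \<psi>_closed mon_closed] by simp
    thus "l (y \<otimes> \<psi> f) = 0" using pairing_sym[OF \<psi>_closed \<psi>_closed] g by simp
  qed
  thus ?thesis
    unfolding annihilator_def using assms pair functional_zero[OF lin] mon_closed by auto
qed

end

lemma algebra_isomorphic_quotient:
  fixes A :: "('k::field, 'a, 'c) module_scheme" and R :: "('k, 'b, 'd) module_scheme"
  assumes A: "kalgebra A" and R: "kalgebra R" and I: "ideal I R"
    and closed: "\<And>f. f \<in> carrier R \<Longrightarrow> \<psi> f \<in> carrier A"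
    and mult: "\<And>f g. f \<in> carrier R \<Longrightarrow> g \<in> carrier R \<Longrightarrow> \<psi> (f \<otimes>\<^bsub>R\<^esub> g) = \<psi> f \<otimes>\<^bsub>A\<^esub> \<psi> g"
    and add: "\<And>f g. f \<in> carrier R \<Longrightarrow> g \<in> carrier R \<Longrightarrow> \<psi> (f \<oplus>\<^bsub>R\<^esub> g) = \<psi> f \<oplus>\<^bsub>A\<^esub> \<psi> g"
    and one: "\<psi> \<one>\<^bsub>R\<^esub> = \<one>\<^bsub>A\<^esub>"
    and smult: "\<And>c f. f \<in> carrier R \<Longrightarrow> \<psi> (c \<odot>\<^bsub>R\<^esub> f) = c \<odot>\<^bsub>A\<^esub> \<psi> f"
    and surj: "\<psi> ` carrier R = carrier A"
    and kernel: "\<And>f. f \<in> carrier R \<Longrightarrow> \<psi> f = \<zero>\<^bsub>A\<^esub> \<longleftrightarrow> f \<in> I"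
  shows "algebra_isomorphic A (quotient_algebra R I)"
proof -
  interpret A: kalgebra A by fact
  interpret R: kalgebra R by fact
  let ?Q = "quotient_algebra R I"
  note Q = R.quotient_algebra_simps[OF I] R.quotient_algebra_smult[OF I]
  have coset: "I +>\<^bsub>R\<^esub> f = I +>\<^bsub>R\<^esub> g \<longleftrightarrow> \<psi> f = \<psi> g" if f: "f \<in> carrier R" and g: "g \<in> carrier R" for f g
  proof -
    have fg: "f \<ominus>\<^bsub>R\<^esub> g = f \<oplus>\<^bsub>R\<^esub> (- 1) \<odot>\<^bsub>R\<^esub> g" using g by (simp add: R.smult_minus_one a_minus_def)
    have "I +>\<^bsub>R\<^esub> f = I +>\<^bsub>R\<^esub> g \<longleftrightarrow> \<psi> (f \<ominus>\<^bsub>R\<^esub> g) = \<zero>\<^bsub>A\<^esub>"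
      unfolding kernel[OF R.minus_closed[OF f g]] by (rule R.quotient_eq_iff_same_a_r_cos[OF I f g, symmetric])
    also have "\<psi> (f \<ominus>\<^bsub>R\<^esub> g) = \<psi> f \<ominus>\<^bsub>A\<^esub> \<psi> g"
      by (subst fg) (simp only: add[OF f R.smult_closed[OF g]] smult[OF g] A.smult_minus_one[OF closed[OF g]] a_minus_def)
    also have "\<dots> = \<zero>\<^bsub>A\<^esub> \<longleftrightarrow> \<psi> f = \<psi> g" using closed[OF f] closed[OF g] by simp
    finally show ?thesis .
  qed
  define \<rho> where "\<rho> = inv_into (carrier R) \<psi>"
  have \<rho>: "\<rho> a \<in> carrier R" "\<psi> (\<rho> a) = a" if "a \<in> carrier A" for a
    using inv_into_into[of a \<psi> "carrier R"] f_inv_into_f[of a \<psi> "carrier R"] that unfolding \<rho>_def surj by blast+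
  define \<phi> where "\<phi> a = I +>\<^bsub>R\<^esub> \<rho> a" for a
  have \<phi>: "\<phi> (\<psi> f) = I +>\<^bsub>R\<^esub> f" if f: "f \<in> carrier R" for f
    unfolding \<phi>_def using coset[OF \<rho>(1) f] \<rho>(2) closed[OF f] by simp
  have ex: "\<exists>f\<in>carrier R. a = \<psi> f" if "a \<in> carrier A" for a using that surj by blast
  have "\<phi> \<in> ring_iso A ?Q"
  proof (rule ring_iso_memI)
    fix x assume "x \<in> carrier A"
    then obtain f where f: "f \<in> carrier R" "x = \<psi> f" using ex by blast
    show "\<phi> x \<in> carrier ?Q" unfolding f(2) \<phi>[OF f(1)] R.carrier_quotient_algebra using f(1) by blast
    fix y assume "y \<in> carrier A"
    then obtain g where g: "g \<in> carrier R" "y = \<psi> g" using ex by blast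
    show "\<phi> (x \<otimes>\<^bsub>A\<^esub> y) = \<phi> x \<otimes>\<^bsub>?Q\<^esub> \<phi> y"
      unfolding f(2) g(2) mult[OF f(1) g(1), symmetric]
      unfolding \<phi>[OF f(1)] \<phi>[OF g(1)] \<phi>[OF R.m_closed[OF f(1) g(1)]] Q(3)[OF f(1) g(1)] ..
    show "\<phi> (x \<oplus>\<^bsub>A\<^esub> y) = \<phi> x \<oplus>\<^bsub>?Q\<^esub> \<phi> y"
      unfolding f(2) g(2) add[OF f(1) g(1), symmetric]
      unfolding \<phi>[OF f(1)] \<phi>[OF g(1)] \<phi>[OF R.a_closed[OF f(1) g(1)]] Q(4)[OF f(1) g(1)] ..
  next
    show "\<phi> \<one>\<^bsub>A\<^esub> = \<one>\<^bsub>?Q\<^esub>" unfolding one[symmetric] \<phi>[OF R.one_closed] Q(2) ..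
    show "bij_betw \<phi> (carrier A) (carrier ?Q)"
    proof (rule bij_betw_imageI)
      show "inj_on \<phi> (carrier A)"
      proof (rule inj_onI)
        fix x y assume x: "x \<in> carrier A" and y: "y \<in> carrier A" and eq: "\<phi> x = \<phi> y"
        thus "x = y" unfolding \<phi>_def coset[OF \<rho>(1)[OF x] \<rho>(1)[OF y]] using \<rho>(2) by simp
      qed
      show "\<phi> ` carrier A = carrier ?Q"
        unfolding R.carrier_quotient_algebra surj[symmetric] image_image by (rule image_cong[OF refl \<phi>])
    qed
  qed
  moreover have "\<phi> (c \<odot>\<^bsub>A\<^esub> x) = c \<odot>\<^bsub>?Q\<^esub> \<phi> x" if x: "x \<in> carrier A" for c x
  proof -
    obtain f where f: "f \<in> carrier R" "x = \<psi> f" using ex[OF x] by blast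
    show ?thesis unfolding f(2) smult[OF f(1), symmetric]
      unfolding \<phi>[OF f(1)] \<phi>[OF R.smult_closed[OF f(1)]] Q(5)[OF f(1)] ..
  qed
  ultimately show ?thesis unfolding algebra_isomorphic_def by blast
qed

lemma (in adapted_generators) algebra_isomorphic_annihilator:
  "algebra_isomorphic A (quotient_algebra R (annihilator h 3 \<mu>))"
proof (rule algebra_isomorphic_quotient[of A R _ \<psi>])
  show "kalgebra A" by (rule kalgebra_axioms)
  show "kalgebra R" by (rule kalgebra_power_series)
  show "ideal (annihilator h 3 \<mu>) R" by (rule ideal_annihilator[OF vanishes_above_\<mu>])
  show "\<psi> \<one>\<^bsub>R\<^esub> = \<one>" by (rule \<psi>_one)
  show "\<psi> ` carrier R = carrier A" by (rule \<psi>_surj)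
  fix f assume f: "f \<in> carrier R"
  show "\<psi> f \<in> carrier A" by (rule \<psi>_closed)
  show "\<psi> f = \<zero> \<longleftrightarrow> f \<in> annihilator h 3 \<mu>" by (rule \<psi>_kernel[OF f])
  show "\<psi> (c \<odot>\<^bsub>R\<^esub> f) = c \<odot> \<psi> f" for c by (rule \<psi>_smult)
  fix g assume g: "g \<in> carrier R"
  show "\<psi> (f \<otimes>\<^bsub>R\<^esub> g) = \<psi> f \<otimes> \<psi> g" by (rule \<psi>_mult[OF f g])
  show "\<psi> (f \<oplus>\<^bsub>R\<^esub> g) = \<psi> f \<oplus> \<psi> g" by (rule \<psi>_add)
qed

section \<open>The cubic form of a Gorenstein algebra\<close>

lemma single_Suc_0_eq_iff [simp]:
  "single i (Suc 0) = single j (Suc 0) \<longleftrightarrow> i = j"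
proof
  assume "single i (Suc 0) = single j (Suc 0)"
  hence "lookup (single i (Suc 0)) i = lookup (single j (Suc 0)) i"
    by (rule arg_cong)
  thus "i = j" by (simp add: lookup_single when_def split: if_splits)
qed simp

lemma lookup_monomial_deriv_eq:
  fixes p :: "'k::field_char_0 mpoly"
  shows "lookup (monomial_deriv a p) b = moment p (a + b) / exponent_fact b"
  using lookup_monomial_deriv[of b a p] by (simp add: field_simps)

lemma polynomials_simps:
  "carrier (polynomials n) = {p. \<forall>a\<in>keys p. keys a \<subseteq> {1..n}}"
  "\<zero>\<^bsub>polynomials n\<^esub> = 0" "p \<oplus>\<^bsub>polynomials n\<^esub> q = p + q" "c \<odot>\<^bsub>polynomials n\<^esub> p = scale c p"
  by (simp_all add: polynomials_def)

lemma kvectorspace_polynomials: "kvectorspace (polynomials n :: ('k::field, 'k mpoly) module)"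
  unfolding kvectorspace_def
proof (rule vs_criteria)
  let ?V = "polynomials n :: ('k, 'k mpoly) module"
  note s = polynomials_simps
  show "field (ground :: 'k ring)" ..
  show "\<zero>\<^bsub>?V\<^esub> \<in> carrier ?V" by (simp add: s)
  show "\<forall>v w. v \<in> carrier ?V \<and> w \<in> carrier ?V \<longrightarrow> v \<oplus>\<^bsub>?V\<^esub> w \<in> carrier ?V"
    unfolding s using keys_add by fast
  show "\<forall>v\<in>carrier ?V. \<exists>neg_v\<in>carrier ?V. v \<oplus>\<^bsub>?V\<^esub> neg_v = \<zero>\<^bsub>?V\<^esub>"
  proof
    fix v assume "v \<in> carrier ?V"
    hence "- v \<in> carrier ?V" by (simp add: s in_keys_iff)
    thus "\<exists>neg_v\<in>carrier ?V. v \<oplus>\<^bsub>?V\<^esub> neg_v = \<zero>\<^bsub>?V\<^esub>" by (rule bexI[rotated]) (simp add: s)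
  qed
  show "\<forall>c v. c \<in> carrier ground \<and> v \<in> carrier ?V \<longrightarrow> c \<odot>\<^bsub>?V\<^esub> v \<in> carrier ?V"
    by (simp add: s in_keys_iff)
qed (auto simp: polynomials_simps lookup_add algebra_simps intro!: poly_mapping_eqI)

lemma lookup_lin_comb_polynomials:
  assumes "finite I" "x \<in> I \<rightarrow> carrier (polynomials n)"
  shows "lookup (lin_comb (polynomials n) I c x) b = (\<Sum>i\<in>I. c i * lookup (x i :: 'k::field mpoly) b)"
  using assms
proof (induction I)
  case empty
  interpret V: kvectorspace "polynomials n :: ('k, 'k mpoly) module" by (rule kvectorspace_polynomials)
  show ?case by (simp add: polynomials_simps)
next
  case (insert i I)
  interpret V: kvectorspace "polynomials n :: ('k, 'k mpoly) module" by (rule kvectorspace_polynomials)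
  show ?case
    using insert V.lin_comb_insert[of I i x c] by (simp add: polynomials_simps(3,4) lookup_add)
qed

lemma monomial_deriv_closed:
  fixes F :: "'k::field_char_0 mpoly"
  assumes "poly_form n d F"
  shows "monomial_deriv a F \<in> carrier (polynomials n)"
  unfolding polynomials_simps
proof (intro CollectI ballI)
  fix b assume "b \<in> keys (monomial_deriv a F)"
  hence "moment F (a + b) \<noteq> 0" by (auto simp: in_keys_iff lookup_monomial_deriv_eq)
  hence "keys (a + b) \<subseteq> {1..n}" by (rule moment_form(1)[OF assms])
  thus "keys b \<subseteq> {1..n}" by (simp add: keys_add_exponent)
qed

text \<open>
  The derivatives of the zero form span the zero space, whose dimension is not \<open>n \<ge> 1\<close>.
\<close>

lemma nondegenerate_form_nonzero:
  fixes F :: "'k::field_char_0 mpoly"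
  assumes F: "nondegenerate_form n 3 F" and n: "n \<ge> 1"
  shows "F \<noteq> 0"
proof
  assume "F = 0"
  let ?V = "polynomials n :: ('k, 'k mpoly) module"
  interpret V: kvectorspace ?V by (rule kvectorspace_polynomials)
  define D where "D = {monomial_deriv a F | a. keys a \<subseteq> {1..n} \<and> total_degree a = 3 - 1}"
  have "monomial_deriv a F = 0" for a
    by (rule poly_mapping_eqI) (simp add: lookup_monomial_deriv_eq moment_def \<open>F = 0\<close>)
  hence D: "u = 0" if "u \<in> D" for u using that unfolding D_def by blast
  have DV: "D \<subseteq> carrier ?V"
  proof
    fix u assume "u \<in> D"
    hence "u = 0" by (rule D)
    thus "u \<in> carrier ?V" by (simp add: polynomials_simps)
  qed
  have sub: "subspace ground (V.span D) ?V" by (rule V.span_is_subspace[OF DV])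
  let ?W = "?V\<lparr>carrier := V.span D\<rparr>"
  interpret W: kvectorspace ?W
    unfolding kvectorspace_def by (rule V.subspace_is_vs[OF sub])
  have zero: "v = 0" if v: "v \<in> V.span D" for v
  proof -
    obtain a B where B: "finite B" "B \<subseteq> D" "v = V.lincomb a B" using v unfolding V.span_def by blast
    have v': "v = lin_comb ?V B a (\<lambda>u. u)" unfolding B(3) by (simp add: V.lincomb_def lin_comb_def)
    have BV: "(\<lambda>u. u) \<in> B \<rightarrow> carrier ?V" using B(2) DV by blast
    show ?thesis
    proof (rule poly_mapping_eqI)
      fix b
      have "lookup v b = (\<Sum>u\<in>B. a u * lookup u b)"
        unfolding v' by (rule lookup_lin_comb_polynomials[OF B(1) BV])
      also have "\<dots> = 0"
      proof (rule sum.neutral, rule ballI)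
        fix u assume "u \<in> B"
        hence "u = 0" using B(2) D by blast
        thus "a u * lookup u b = 0" by simp
      qed
      finally show "lookup v b = lookup 0 b" by simp
    qed
  qed
  have "spanning_family ?W {} (\<lambda>i::nat. 0)"
    unfolding spanning_family_def W.lin_comb_empty using zero by (auto simp: polynomials_simps)
  hence "W.dim = card ({}::nat set)"
    by (intro W.dim_eq_card_family) (auto simp: independent_family_def)
  moreover have "W.dim = n" using F unfolding nondegenerate_form_def D_def by simp
  ultimately show False using n by simp
qed

text \<open>
  A suitable multiple of a single monomial that occurs in \<open>F\<close>.
\<close>

lemma dual_series_exists:
  fixes F :: "'k::field_char_0 mpoly"
  assumes F: "poly_form n d F" "F \<noteq> 0"
  obtains \<sigma> where "series_form n d \<sigma>" "act \<sigma> F = 1"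
proof -
  obtain e where "lookup F e \<noteq> 0" using F(2) by (metis poly_mapping_eqI lookup_zero)
  hence e: "moment F e \<noteq> 0" by (simp add: moment_def)
  note e' = moment_form[OF F(1) e]
  define \<sigma> where "\<sigma> = (\<lambda>a. if a = e then 1 / moment F e else 0)"
  have \<sigma>: "series_form n d \<sigma>" using e' by (auto simp: series_form_def power_series_simps(1) \<sigma>_def)
  have "e \<in> low_exponents n d" using e' by (simp add: low_exponents_def)
  hence "(\<Sum>a\<in>low_exponents n d. \<sigma> a * moment F a) = 1"
    using e by (simp add: \<sigma>_def if_distrib[of "\<lambda>x. x * _"] cong: if_cong)
  thus ?thesis using act_eq_1_iff[OF F(1) \<sigma>] \<sigma> that by blast
qed

context adapted_generators
begin

text \<open>
  The cubic part in the first \<open>n\<close> variables of the polynomial with moments \<open>\<mu>\<close>.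
\<close>

definition F :: "'k mpoly" where
  "F = Abs_poly_mapping (\<lambda>a. if a \<in> low_exponents n 3 \<and> total_degree a = 3 then \<mu> a / exponent_fact a else 0)"

lemma lookup_F:
  "lookup F a = (if a \<in> low_exponents n 3 \<and> total_degree a = 3 then \<mu> a / exponent_fact a else 0)"
proof -
  let ?f = "\<lambda>a. if a \<in> low_exponents n 3 \<and> total_degree a = 3 then \<mu> a / exponent_fact a else 0"
  have "finite {a. ?f a \<noteq> 0}" by (rule finite_subset[OF _ finite_low_exponents[of n 3]]) auto
  thus ?thesis unfolding F_def by (subst lookup_Abs_poly_mapping) auto
qed

lemma moment_F: "moment F a = (if a \<in> low_exponents n 3 \<and> total_degree a = 3 then \<mu> a else 0)"
  by (simp add: moment_def lookup_F)

lemma poly_form_F: "poly_form n 3 F"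
proof -
  have "a \<in> low_exponents n 3 \<and> total_degree a = 3" if "a \<in> keys F" for a
    using that by (simp add: in_keys_iff lookup_F split: if_splits)
  thus ?thesis by (simp add: poly_form_def polynomials_simps low_exponents_def)
qed

text \<open>
  The conditions on adapted generators determine \<open>\<mu>\<close> in each degree: it vanishes in degrees zero
  and one; in degree two only the squares \<open>\<xi>\<^sub>j\<^sup>2\<close> with \<open>j > n\<close> contribute; in degree three a factor
  \<open>\<xi>\<^sub>j\<close> with \<open>j > n\<close> kills the remaining product, which lies in \<open>m\<^sup>2\<close>.
\<close>

lemma cubic_moment_F: "cubic_moment h n F = \<mu>"
proof
  fix a :: exponent
  let ?sq = "\<exists>j\<in>{n+1..h}. a = single j 2"
  show "cubic_moment h n F a = \<mu> a"
  proof (cases "keys a \<subseteq> {1..h} \<and> total_degree a \<le> 3")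
    case False
    have "mon a = \<zero>" using False mon_eq_zero[of a] by (cases "total_degree a \<le> 3") (auto simp: mon_def)
    moreover have "moment F a = 0" using False n_le_h by (auto simp: moment_F low_exponents_def)
    moreover have "\<not> ?sq" using False by auto
    ultimately show ?thesis using functional_zero[OF lin] by (simp add: cubic_moment_def \<mu>_def)
  next
    case True
    hence keys: "keys a \<subseteq> {1..h}" and deg: "total_degree a \<le> 3" by blast+
    consider "total_degree a = 0" | "total_degree a = 1" | "total_degree a = 2" | "total_degree a = 3"
      using deg by linarith
    thus ?thesis
    proof cases
      case 1
      have "\<not> ?sq"
      proof
        assume ?sq
        then obtain j where "a = single j 2" by blast
        hence "total_degree a = 2" by (simp only: total_degree_single)
        thus False using 1 by simp
      qed
      hence "cubic_moment h n F a = moment F a" by (simp add: cubic_moment_def)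
      moreover have "a = 0" using 1 by simp
      ultimately show ?thesis by (simp add: moment_F \<mu>_def mon_0 l_one)
    next
      case 2
      hence "a \<noteq> 0" by auto
      then obtain i b where i: "i \<in> keys a" and b: "a = single i 1 + b"
        by (rule exponent_nonzero_split)
      have "total_degree b = 0" using 2 unfolding b by simp
      hence a: "a = single i 1" using b by simp
      have ih: "i \<in> {1..h}" using i keys by blast
      have "\<not> ?sq" using 2 by auto
      moreover have "\<mu> a = 0" unfolding \<mu>_def a mon_single[OF ih] by (rule l_gen[OF ih])
      ultimately show ?thesis using 2 by (simp add: cubic_moment_def moment_F)
    next
      case 3
      hence "a \<noteq> 0" by auto
      then obtain i b where i: "i \<in> keys a" and b: "a = single i 1 + b"
        by (rule exponent_nonzero_split)
      have db: "total_degree b = 1" using 3 unfolding b by simp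
      hence "b \<noteq> 0" by auto
      then obtain j c where j: "j \<in> keys b" and c: "b = single j 1 + c"
        by (rule exponent_nonzero_split)
      have "total_degree c = 0" using db unfolding c by simp
      hence b': "b = single j 1" using c by simp
      have a: "a = single i 1 + single j 1" using b b' by simp
      have ih: "i \<in> {1..h}" and jh: "j \<in> {1..h}" using i j keys unfolding b keys_add_exponent by auto
      have sq: "?sq \<longleftrightarrow> i = j \<and> n < i"
      proof
        assume ?sq
        then obtain l where l: "l \<in> {n+1..h}" "single i (1::nat) + single j 1 + 0 = single l 2"
          unfolding a by auto
        show "i = j \<and> n < i" using exponent_sum_single_double(1,3)[OF l(2)] l(1) by auto
      next
        assume "i = j \<and> n < i"
        thus ?sq unfolding a using ih single_one_add_one[of j] by (intro bexI[of _ j]) auto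
      qed
      have "\<mu> a = (if i = j \<and> n < i then 2 else 0)"
        unfolding \<mu>_def a mon_add mon_single[OF ih] mon_single[OF jh] by (rule l_gen_gen[OF ih jh])
      thus ?thesis using 3 sq by (simp add: cubic_moment_def moment_F)
    next
      case 4
      have nsq: "\<not> ?sq" using 4 by auto
      show ?thesis
      proof (cases "keys a \<subseteq> {1..n}")
        case True
        thus ?thesis using 4 nsq by (simp add: cubic_moment_def moment_F low_exponents_def)
      next
        case False
        then obtain j where j: "j \<in> keys a" "j \<in> {n+1..h}" using keys by fastforce
        obtain b where b: "a = single j 1 + b"
          using exponent_split[of a j] j(1) by (auto simp: in_keys_iff)
        have db: "total_degree b = 2" using 4 unfolding b by simp
        have jh: "j \<in> {1..h}" using j(2) by auto
        have "mon a = \<zero>" unfolding b mon_add mon_single[OF jh]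
          by (rule gen_mult_P2[OF j(2)]) (use mon_P[of b] db in simp)
        hence "\<mu> a = 0" using functional_zero[OF lin] by (simp add: \<mu>_def)
        moreover have "moment F a = 0" using False by (simp add: moment_F low_exponents_def)
        ultimately show ?thesis using nsq by (simp add: cubic_moment_def)
      qed
    qed
  qed
qed

text \<open>
  Write \<open>q\<^sub>k = \<psi>(g)\<close>. The coefficient of \<open>y\<^sub>i\<close> in the combination of second derivatives of \<open>F\<close> with
  the quadratic coefficients of \<open>g\<close> is \<open>l(\<xi>\<^sub>i q\<^sub>k)\<close>, that is \<open>1\<close> for \<open>i = k\<close> and \<open>0\<close> otherwise. So every
  variable \<open>y\<^sub>k\<close> is a combination of second derivatives, and these are linear forms.
\<close>

lemma nondegenerate_F: "nondegenerate_form n 3 F"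
proof -
  let ?V = "polynomials n :: ('k, 'k mpoly) module"
  interpret V: kvectorspace ?V by (rule kvectorspace_polynomials)
  define D where "D = {monomial_deriv a F | a. keys a \<subseteq> {1..n} \<and> total_degree a = 3 - 1}"
  have DV: "D \<subseteq> carrier ?V" using monomial_deriv_closed[OF poly_form_F] unfolding D_def by blast
  have sub: "subspace ground (V.span D) ?V" by (rule V.span_is_subspace[OF DV])
  interpret W: kvectorspace "?V\<lparr>carrier := V.span D\<rparr>"
    unfolding kvectorspace_def by (rule V.subspace_is_vs[OF sub])
  let ?W = "?V\<lparr>carrier := V.span D\<rparr>"
  let ?e = "\<lambda>k. single k (1::nat)"
  let ?y = "\<lambda>k. single (?e k) (1::'k)"
  have linear: "lookup v b = 0" if v: "v \<in> V.span D" and b: "\<And>k. k \<in> {1..n} \<Longrightarrow> b \<noteq> ?e k" for v b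
  proof -
    obtain c B where B: "finite B" "B \<subseteq> D" "v = V.lincomb c B" using v unfolding V.span_def by blast
    have "lookup u b = 0" if u: "u \<in> B" for u
    proof -
      obtain a where a: "u = monomial_deriv a F" "total_degree a = 2" using u B(2) unfolding D_def by auto
      have "moment F (a + b) = 0"
      proof (rule ccontr)
        assume nz: "moment F (a + b) \<noteq> 0"
        have db: "total_degree b = 1" and kb: "keys b \<subseteq> {1..n}"
          using moment_form[OF poly_form_F nz] a(2) by (simp_all add: keys_add_exponent)
        hence "b \<noteq> 0" by auto
        then obtain k d where k: "k \<in> keys b" and d: "b = ?e k + d"
          by (rule exponent_nonzero_split)
        have "total_degree d = 0" using db unfolding d by simp
        hence "b = ?e k" using d by simp
        moreover have "k \<in> {1..n}" using k kb by blast
        ultimately show False using b by blast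
      qed
      thus ?thesis by (simp add: a(1) lookup_monomial_deriv_eq)
    qed
    moreover have "V.lincomb c B = lin_comb ?V B c (\<lambda>u. u)" by (simp add: V.lincomb_def lin_comb_def)
    ultimately show ?thesis
      using lookup_lin_comb_polynomials[of B "\<lambda>u. u" n c b] B DV by (auto simp: subset_iff Pi_iff)
  qed
  have yspan: "?y k \<in> V.span D" if k: "k \<in> {1..n}" for k
  proof -
    obtain g where g: "g \<in> carrier R" "q k = \<psi> g" using \<psi>_surj P_closed[OF q_P2[OF k]] by blast
    let ?T = "{a \<in> low_exponents n 2. total_degree a = 2}"
    have T: "finite ?T" by simp
    have mdD: "(\<lambda>a. monomial_deriv a F) \<in> ?T \<rightarrow> D" by (auto simp: low_exponents_def D_def)
    have mdV: "(\<lambda>a. monomial_deriv a F) \<in> ?T \<rightarrow> carrier ?V" using mdD DV by blast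
    have mdW: "(\<lambda>a. monomial_deriv a F) \<in> ?T \<rightarrow> V.span D" using mdD V.in_own_span[OF DV] by blast
    let ?v = "lin_comb ?V ?T g (\<lambda>a. monomial_deriv a F)"
    have "lin_comb ?W ?T g (\<lambda>a. monomial_deriv a F) \<in> V.span D"
      using W.lin_comb_closed[of "\<lambda>a. monomial_deriv a F" ?T g] mdW by simp
    moreover have "lin_comb ?W I g x = lin_comb ?V I g x" if "finite I" "x \<in> I \<rightarrow> V.span D" for I and x :: "exponent \<Rightarrow> 'k mpoly"
      using that
    proof (induction I)
      case (insert i I)
      have "x \<in> insert i I \<rightarrow> carrier ?V" using insert.prems DV V.span_closed[OF DV] by blast
      thus ?case using insert W.lin_comb_insert[of I i x g] V.lin_comb_insert[of I i x g] by simp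
    qed simp
    ultimately have vW: "?v \<in> V.span D" using mdW T by simp
    have "?v = ?y k"
    proof (rule poly_mapping_eqI)
      fix b
      show "lookup ?v b = lookup (?y k) b"
      proof (cases "\<exists>i\<in>{1..n}. b = ?e i")
        case False
        hence "lookup ?v b = 0" using linear[OF vW] by blast
        moreover have "?e k \<noteq> b" using False k by blast
        ultimately show ?thesis by (simp add: lookup_single)
      next
        case True
        then obtain i where i: "i \<in> {1..n}" and b: "b = ?e i" by blast
        have ih: "i \<in> {1..h}" using i n_le_h by simp
        have "lookup ?v b = (\<Sum>a\<in>?T. g a * moment F (a + ?e i))"
          unfolding lookup_lin_comb_polynomials[OF T mdV] lookup_monomial_deriv_eq b exponent_fact_single by simp
        also have "\<dots> = (\<Sum>a\<in>L. g a * l (\<xi> i \<otimes> mon a))"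
        proof (rule sum.mono_neutral_cong_left)
          show "?T \<subseteq> L" using n_le_h by (auto simp: low_exponents_def)
          have ma: "l (\<xi> i \<otimes> mon a) = cubic_moment h n F (a + ?e i)" for a
            unfolding cubic_moment_F \<mu>_def mon_add mon_single[OF ih]
            using mon_closed gen_closed[OF ih] by (simp add: m_comm)
          have nsq: "a + ?e i \<noteq> single j 2" if "j \<in> {n+1..h}" for a j
          proof
            assume "a + ?e i = single j 2"
            hence "i \<in> keys (single j (2::nat))"
              by (metis keys_add_exponent keys_single UnI2 insertI1 zero_neq_one)
            thus False using i that by auto
          qed
          have mF: "l (\<xi> i \<otimes> mon a) = moment F (a + ?e i)" for a
            unfolding ma cubic_moment_def using nsq by auto
          show "g a * moment F (a + ?e i) = g a * l (\<xi> i \<otimes> mon a)" for a unfolding mF ..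
          show "\<forall>a\<in>L - ?T. g a * l (\<xi> i \<otimes> mon a) = 0"
            unfolding mF by (auto simp: moment_F low_exponents_def keys_add_exponent)
        qed simp
        also have "\<dots> = l (\<xi> i \<otimes> q k)" unfolding g(2) by (rule pairing_\<psi>[OF gen_closed[OF ih], symmetric])
        also have "\<dots> = (if i = k then 1 else 0)" by (rule l_gen_q[OF i k])
        finally show ?thesis unfolding b by (auto simp: lookup_single when_def)
      qed
    qed
    thus ?thesis using vW by simp
  qed
  have lcW: "lookup (lin_comb ?W I c ?y) b = (\<Sum>i\<in>I. c i * lookup (?y i) b)"
    if "finite I" "I \<subseteq> {1..n}" for I c b
    using that
  proof (induction I)
    case empty
    show ?case by (simp add: polynomials_simps)
  next
    case (insert i I)
    have "?y \<in> insert i I \<rightarrow> carrier ?W" using insert.prems yspan by auto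
    thus ?case using insert W.lin_comb_insert[of I i ?y c]
      by (simp add: polynomials_simps(3,4) lookup_add lookup_single when_def)
  qed
  have coord: "lookup (lin_comb ?W {1..n} c ?y) (?e k) = c k" if "k \<in> {1..n}" for c k
  proof -
    have "(\<Sum>i\<in>{1..n}. c i * lookup (?y i) (?e k)) = (\<Sum>i\<in>{1..n}. if i = k then c k else 0)"
      by (rule sum.cong) (auto simp: lookup_single when_def)
    thus ?thesis using lcW[of "{1..n}" c "?e k"] that by simp
  qed
  have "W.dim = card {1..n}"
  proof (rule W.dim_eq_card_family[of _ ?y])
    show "?y \<in> {1..n} \<rightarrow> carrier ?W" using yspan by simp
    show "independent_family ?W {1..n} ?y" unfolding independent_family_def
    proof (intro allI impI ballI)
      fix c k assume "lin_comb ?W {1..n} c ?y = \<zero>\<^bsub>?W\<^esub>" "k \<in> {1..n}"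
      thus "c k = 0" using coord[of k c] by (simp add: polynomials_simps)
    qed
    show "spanning_family ?W {1..n} ?y" unfolding spanning_family_def
    proof
      fix v assume "v \<in> carrier ?W"
      hence v: "v \<in> V.span D" by simp
      let ?c = "\<lambda>k. lookup v (?e k)"
      have lW: "lin_comb ?W {1..n} ?c ?y \<in> V.span D"
        using W.lin_comb_closed[of ?y "{1..n}" ?c] yspan by simp
      have "v = lin_comb ?W {1..n} ?c ?y"
      proof (rule poly_mapping_eqI)
        fix b
        show "lookup v b = lookup (lin_comb ?W {1..n} ?c ?y) b"
        proof (cases "\<exists>k\<in>{1..n}. b = ?e k")
          case True
          thus ?thesis using coord by auto
        next
          case False
          thus ?thesis using linear[OF v, of b] linear[OF lW, of b] by auto
        qed
      qed
      thus "\<exists>c. v = lin_comb ?W {1..n} c ?y" by blast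
    qed
  qed simp
  thus ?thesis using poly_form_F unfolding nondegenerate_form_def D_def by simp
qed

end

section \<open>The structure theorem\<close>

lemma (in kalgebra) ideal_socle:
  assumes "ideal m A"
  shows "ideal (socle A m) A"
proof (rule idealI_closed)
  have mA: "y \<in> carrier A" if "y \<in> m" for y by (rule ideal.Icarr[OF assms that])
  show "socle A m \<subseteq> carrier A" by (auto simp: socle_def)
  show "\<zero> \<in> socle A m" using mA by (auto simp: socle_def)
  show "x \<oplus> y \<in> socle A m" if "x \<in> socle A m" "y \<in> socle A m" for x y
    using that mA by (auto simp: socle_def r_distr)
  show "x \<otimes> y \<in> socle A m" if "x \<in> carrier A" "y \<in> socle A m" for x y
    using that mA by (auto simp: socle_def m_lcomm[of _ x])
qed

text \<open>
  The one-dimensional socle contains \<open>m\<^sup>3 \<noteq> 0\<close>, so its generator \<open>w\<close> lies in \<open>m\<^sup>3\<close>. A functional \<open>l\<^sub>0\<close>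
  with \<open>l\<^sub>0(w) = 1\<close> is corrected by the multiple of \<open>a \<mapsto> l\<^sub>0(w a)\<close> that makes it vanish at \<open>1\<close>; the
  value at \<open>w\<close> persists because \<open>w\<^sup>2 = 0\<close>.
\<close>

lemma gorenstein_functional_exists:
  fixes A :: "('k::field_char_0, 'a, 'c) module_scheme" (structure)
  assumes A: "kalgebra A" and fd: "vectorspace.fin_dim ground A" and max: "maximalideal m A"
    and gor: "gorenstein A m" and deg: "has_socle_degree A m 3"
  obtains w l where "gorenstein_functional A m w l"
proof -
  interpret kalgebra A by fact
  let ?P = "ideal_power A m"
  have m: "ideal m A" by (rule maximalideal.axioms(1)[OF max])
  note P = ideal_power_is_ideal[OF m]
  have P3: "?P 3 \<noteq> {\<zero>}" and P4: "?P (Suc 3) = {\<zero>}" using deg by (simp_all add: has_socle_degree_def)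
  obtain w where w: "w \<in> socle A m" "w \<noteq> \<zero>" and gen: "\<And>v. v \<in> socle A m \<Longrightarrow> \<exists>c. v = c \<odot> w"
    using dim_one_generator[OF fd ideal_socle[OF m]] gor unfolding gorenstein_def by blast
  have wA: "w \<in> carrier A" using w(1) by (simp add: socle_def)
  obtain x where x: "x \<in> ?P 3" "x \<noteq> \<zero>" using P3 ideal_zero_closed[OF P] by blast
  have "y \<otimes> x = \<zero>" if "y \<in> m" for y
  proof -
    have "y \<otimes> x \<in> ?P (Suc 3)" unfolding ideal_power.simps by (rule ideal_prod.prod[OF that x(1)])
    thus ?thesis unfolding P4 by simp
  qed
  hence "x \<in> socle A m" using ideal.Icarr[OF P x(1)] by (simp add: socle_def)
  then obtain c where c: "x = c \<odot> w" using gen by blast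
  have "c \<noteq> 0" using x(2) wA unfolding c by auto
  hence "w = (1 / c) \<odot> x" unfolding c using wA by (simp add: smult_smult)
  hence wP3: "w \<in> ?P 3" using ideal_smult_closed[OF P x(1)] by metis
  have "?P 3 \<subseteq> m"
    using ideal_prod_inter[OF m P[of 2]] unfolding numeral_3_eq_3 numeral_2_eq_2 ideal_power.simps by blast
  hence "w \<otimes> w = \<zero>" using wP3 w(1) by (auto simp: socle_def)
  obtain l0 where l0: "linear_functional l0" "l0 w = 1" by (rule functional_exists[OF fd wA w(2)])
  \<comment> \<open>\<open>l\<close> is \<open>l\<^sub>0\<close> composed with multiplication by the unit \<open>1 - l\<^sub>0(1) w\<close>\<close>
  define l where "l a = l0 a - l0 \<one> * l0 (w \<otimes> a)" for a
  note lw = functional_mult[OF l0(1) wA]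
  have "gorenstein_functional A m w l"
  proof (intro gorenstein_functional.intro gorenstein_functional_axioms.intro A max wP3)
    show "?P 4 = {\<zero>}" using P4 by simp
    show "\<exists>c. x = c \<odot> w" if "x \<in> carrier A" "\<And>y. y \<in> m \<Longrightarrow> y \<otimes> x = \<zero>" for x
      by (rule gen) (use that in \<open>simp add: socle_def\<close>)
    show "linear_functional l"
      unfolding linear_functional_def l_def
      by (auto simp: functional_add[OF l0(1)] functional_smult[OF l0(1)]
          functional_add[OF lw] functional_smult[OF lw] algebra_simps)
    show "l w = 1" using l0(2) \<open>w \<otimes> w = \<zero>\<close> functional_zero[OF l0(1)] by (simp add: l_def)
    show "l \<one> = 0" using l0(2) wA by (simp add: l_def)
  qed
  thus ?thesis by (rule that)
qed

text \<open>
  The functionals \<open>a \<mapsto> l(a q\<^sub>j)\<close> on \<open>m\<close> are independent: an element of \<open>m\<^sup>2\<close> orthogonal to \<open>m\<close> lies in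
  the socle \<open>m\<^sup>3\<close>, and the \<open>q\<^sub>j\<close> are independent modulo \<open>m\<^sup>3\<close>.
\<close>

lemma (in gorenstein_functional) dual_bases_exist:
  assumes fd: "vectorspace.fin_dim ground A"
    and n: "vectorspace.dim ground (quotient_space A (P 2) (P 3)) = n"
  obtains q x where "gorenstein_dual_bases A m w l n q x"
proof -
  have P32: "P 3 \<subseteq> P 2" using P3_in_P2 by blast
  obtain q where q: "q \<in> {1..n} \<rightarrow> P 2" "independent_mod (P 3) {1..n} q" "spanning_mod (P 2) (P 3) {1..n} q"
    by (rule basis_mod_exists[OF P_ideal P_ideal P32 fd n])
  have qA: "q j \<in> carrier A" if "j \<in> {1..n}" for j using q(1) P_closed that by blast
  have "\<exists>x. x \<in> {1..n} \<rightarrow> m \<and> (\<forall>i\<in>{1..n}. \<forall>j\<in>{1..n}. l (x i \<otimes> q j) = (if i = j then 1 else 0))"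
  proof (rule dual_family_exists[OF m_ideal])
    show "linear_functional (\<lambda>a. l (a \<otimes> q j))" if "j \<in> {1..n}" for j
      unfolding linear_functional_def using pairing_add_left[OF qA[OF that]] pairing_smult_left[OF qA[OF that]] by blast
    fix c assume c: "\<And>a. a \<in> m \<Longrightarrow> (\<Sum>j\<in>{1..n}. c j * l (a \<otimes> q j)) = 0"
    have Q: "lin_comb A {1..n} c q \<in> P 2" by (rule lin_comb_ideal[OF P_ideal q(1)])
    have "lin_comb A {1..n} c q \<in> P 3"
    proof (rule socle_in_P3[OF P_closed[OF Q]])
      fix y assume y: "y \<in> m"
      show "y \<otimes> lin_comb A {1..n} c q = \<zero>"
      proof (rule P3_eq_zero[OF m_mult_P2[OF y Q]])
        have "q \<in> {1..n} \<rightarrow> carrier A" using qA by blast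
        thus "l (y \<otimes> lin_comb A {1..n} c q) = 0" using c[OF y] by (simp only: pairing_lin_comb[OF mem_m_closed[OF y]])
      qed
    qed
    thus "\<forall>j\<in>{1..n}. c j = 0" using q(2) unfolding independent_mod_def by blast
  qed simp
  then obtain x where x: "x \<in> {1..n} \<rightarrow> m"
    "\<And>i j. i \<in> {1..n} \<Longrightarrow> j \<in> {1..n} \<Longrightarrow> l (x i \<otimes> q j) = (if i = j then 1 else 0)" by blast
  have "gorenstein_dual_bases A m w l n q x"
  proof (intro gorenstein_dual_bases.intro gorenstein_dual_bases_axioms.intro gorenstein_functional_axioms)
    show "q i \<in> P 2" "x i \<in> m" if "i \<in> {1..n}" for i using that q(1) x(1) by blast+
  qed (fact q(3) | rule x(2); assumption)+
  thus ?thesis by (rule that)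
qed

theorem cubic_presentation_of_gorenstein:
  fixes A :: "('k::{alg_closed_field, field_char_0}, 'a, 'c) module_scheme" (structure)
  assumes A: "kalgebra A" and fd: "vectorspace.fin_dim ground A" and max: "maximalideal m A"
    and gor: "gorenstein A m" and deg: "has_socle_degree A m 3"
    and h: "hilbert_function A m 1 = h" and n: "hilbert_function A m 2 = n"
  obtains F where "n \<le> h" "nondegenerate_form n 3 F"
    "algebra_isomorphic A (quotient_algebra (power_series h) (annihilator h 3 (cubic_moment h n F)))"
proof -
  obtain w l where "gorenstein_functional A m w l" by (rule gorenstein_functional_exists[OF A fd max gor deg])
  then interpret gorenstein_functional A m w l .
  have "vectorspace.dim ground (quotient_space A (P 2) (P 3)) = n" using n by (simp add: hilbert_function_def)
  then obtain q x where "gorenstein_dual_bases A m w l n q x" by (rule dual_bases_exist[OF fd])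
  then interpret D: gorenstein_dual_bases A m w l n q x .
  have sqrt: "\<exists>s. s * s = t" for t :: 'k using nth_root_exists[of 2 t] by (auto simp: power2_eq_square)
  have dim: "vectorspace.dim ground (quotient_space A m (P 2)) = h"
    using h by (simp add: hilbert_function_def P_1 numeral_2_eq_2)
  obtain \<xi> where \<xi>: "n \<le> h" "\<xi> \<in> {1..h} \<rightarrow> m"
    "\<And>i. i \<in> {1..h} \<Longrightarrow> l (\<xi> i) = 0"
    "\<And>i j. i \<in> {1..h} \<Longrightarrow> j \<in> {1..h} \<Longrightarrow> l (\<xi> i \<otimes> \<xi> j) = (if i = j \<and> n < i then 2 else 0)"
    "\<And>j b. j \<in> {n+1..h} \<Longrightarrow> b \<in> P 2 \<Longrightarrow> \<xi> j \<otimes> b = \<zero>"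
    "\<And>i k. i \<in> {1..n} \<Longrightarrow> k \<in> {1..n} \<Longrightarrow> l (\<xi> i \<otimes> q k) = (if i = k then 1 else 0)"
    "spanning_mod m (P 2) {1..h} \<xi>"
    by (rule D.adapted_generators_exist[OF sqrt fd dim]) (rule that; assumption)
  interpret G: adapted_generators A m w l n h q \<xi>
  proof unfold_locales
    show "\<exists>c. a \<oplus> (- c) \<odot> \<one> \<in> m" if "a \<in> carrier A" for a by (rule residue_scalar_exists[OF A fd max that])
  qed (fact \<xi> D.q_P2)+
  show ?thesis
  proof (rule that[OF \<xi>(1) G.nondegenerate_F])
    show "algebra_isomorphic A (quotient_algebra (power_series h) (annihilator h 3 (cubic_moment h n G.F)))"
      unfolding G.cubic_moment_F by (rule G.algebra_isomorphic_annihilator)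
  qed
qed

theorem theorem2p4:
  fixes A :: "('k::{alg_closed_field, field_char_0}, 'a, 'c) module_scheme"
    and m :: "'a set" and h n :: nat
  assumes "artinian_local_algebra A m"
    and "hilbert_function A m 1 = h" and "h \<ge> 1"
    and "hilbert_function A m 2 = n" and "n \<ge> 1"
  shows "(gorenstein A m \<and> has_socle_degree A m 3 \<longleftrightarrow>
            n \<le> h \<and>
            (\<exists>F. nondegenerate_form n 3 F \<and>
               (\<forall>\<sigma>. series_form n 3 \<sigma> \<and> act \<sigma> F = 1 \<longrightarrow>
                  algebra_isomorphic A
                    (quotient_algebra (power_series h) (cubic_ideal h n F \<sigma>)))))
       \<and> (gorenstein A m \<and> has_socle_degree A m 3 \<longleftrightarrow>
            n \<le> h \<and>
            (\<exists>F. nondegenerate_form n 3 F \<and>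
               (\<exists>\<sigma>. series_form n 3 \<sigma> \<and> act \<sigma> F = 1 \<and>
                  algebra_isomorphic A
                    (quotient_algebra (power_series h) (cubic_ideal h n F \<sigma>)))))"
proof -
  have A: "kalgebra A" and fd: "vectorspace.fin_dim ground A" and max: "maximalideal m A"
    using assms(1) by (auto simp: artinian_local_algebra_def kalgebra_def)
  let ?G = "gorenstein A m \<and> has_socle_degree A m 3"
  let ?iso = "\<lambda>F \<sigma>. algebra_isomorphic A (quotient_algebra (power_series h) (cubic_ideal h n F \<sigma>))"
  let ?dual = "\<lambda>F \<sigma>. series_form n 3 \<sigma> \<and> act \<sigma> F = 1"
  have form: "poly_form n 3 F" if "nondegenerate_form n 3 F" for F :: "'k mpoly"
    using that by (simp add: nondegenerate_form_def)
  have dual: "\<exists>\<sigma>. ?dual F \<sigma>" if "nondegenerate_form n 3 F" for F :: "'k mpoly"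
    using dual_series_exists[OF form[OF that] nondegenerate_form_nonzero[OF that assms(5)]] by metis
  have forward: "n \<le> h \<and> (\<exists>F. nondegenerate_form n 3 F \<and> (\<forall>\<sigma>. ?dual F \<sigma> \<longrightarrow> ?iso F \<sigma>))" if G: "?G"
  proof -
    obtain F where F: "n \<le> h" "nondegenerate_form n 3 F"
      "algebra_isomorphic A (quotient_algebra (power_series h) (annihilator h 3 (cubic_moment h n F)))"
      by (rule cubic_presentation_of_gorenstein[OF A fd max conjunct1[OF G] conjunct2[OF G] assms(2,4)])
         (rule that; assumption)
    have "?iso F \<sigma>" if "?dual F \<sigma>" for \<sigma>
      using F(3) cubic_ideal_eq_annihilator[OF F(1) form[OF F(2)], of \<sigma>] that by simp
    thus ?thesis using F(1,2) by blast
  qed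
  have backward: "?G" if "n \<le> h" "nondegenerate_form n 3 F" "?dual F \<sigma>" "?iso F \<sigma>" for F \<sigma>
    using gorenstein_of_cubic_presentation[OF A max that(1) form[OF that(2)] _ _ that(4)] that(3) by blast
  show ?thesis
  proof (intro conjI iffI)
    assume "?G"
    thus "n \<le> h" "\<exists>F. nondegenerate_form n 3 F \<and> (\<forall>\<sigma>. ?dual F \<sigma> \<longrightarrow> ?iso F \<sigma>)" using forward by blast+
    show "n \<le> h" "\<exists>F. nondegenerate_form n 3 F \<and> (\<exists>\<sigma>. series_form n 3 \<sigma> \<and> act \<sigma> F = 1 \<and> ?iso F \<sigma>)"
      using forward[OF \<open>?G\<close>] dual by blast+
  next
    assume *: "n \<le> h \<and> (\<exists>F. nondegenerate_form n 3 F \<and> (\<forall>\<sigma>. ?dual F \<sigma> \<longrightarrow> ?iso F \<sigma>))"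
    then obtain F where F: "nondegenerate_form n 3 F" "\<And>\<sigma>. ?dual F \<sigma> \<Longrightarrow> ?iso F \<sigma>" by blast
    obtain \<sigma> where "?dual F \<sigma>" using dual[OF F(1)] by blast
    hence ?G using backward[of F \<sigma>] * F by blast
    thus "gorenstein A m" "has_socle_degree A m 3" by blast+
  next
    assume "n \<le> h \<and> (\<exists>F. nondegenerate_form n 3 F \<and> (\<exists>\<sigma>. series_form n 3 \<sigma> \<and> act \<sigma> F = 1 \<and> ?iso F \<sigma>))"
    hence ?G using backward by blast
    thus "gorenstein A m" "has_socle_degree A m 3" by blast+
  qed
qed

end
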